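(* Let $G$ be the HLS groupoid associated with an approximated group $(\Gamma,(K_n)_{n\in\mathbb N})$, $\Gamma$ countable, and let $\pi$ and $\rho$ be two continuous unitary representations of $G$. Suppose that $\pi$ is amenable and $\pi\prec\rho$ (i.e. $\pi$ is weakly contained in $\rho$). Then $\rho$ is amenable.
   Context: HLS groupoid. An approximated group $(\Gamma,(K_n)_{n\in\mathbb N})$ is a discrete group $\Gamma$ with a decreasing sequence of finite-index normal subgroups $K_n$ with $\bigcap_nK_n=\{e\}$. Put $\Gamma_n=\Gamma/K_n$ with quotient map $q_n:\Gamma\to\Gamma_n$, and $\Gamma_\infty=\Gamma$, $q_\infty=\mathrm{id}_\Gamma$. The HLS groupoid is $G=\bigsqcup_{n\in\mathbb N\cup\{\infty\}}\{n\}\times\Gamma_n$, with topology generated by the singletons $\{(n,g)\}$, $n\in\mathbb N$, $g\in\Gamma_n$, and the sets $\{(n,q_n(g)):n\in\mathbb N\cup\{\infty\},\,n>N\}$, $g\in\Gamma$, $N\in\mathbb N$. Its unit space is $G^0=\{(n,e):n\in\mathbb N\cup\{\infty\}\}$, $d(n,g)=r(n,g)=(n,e)$, $(n,g)(n,h)=(n,gh)$, $(n,g)^{-1}=(n,g^{-1})$. It is a locally compact Hausdorff second countable étale groupoid. Representations. A continuous Hilbert bundle over $G^0$ is a continuous field $\{\mathcal H_u\}_{u\in G^0}$ of separable Hilbert spaces; $C_0(G^0,\mathcal H)$ (resp. $C_b(G^0,\mathcal H)$) is its space of continuous sections vanishing at infinity (resp. bounded). A continuous unitary representation $(\mathcal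 H^\pi,\pi)$ of $G$ is a continuous Hilbert bundle over $G^0$ with unitaries $\pi(x):\mathcal H^\pi_{d(x)}\to\mathcal H^\pi_{r(x)}$ such that $\pi(u)=\mathrm{id}$ for $u\in G^0$, $\pi(xy)=\pi(x)\pi(y)$, $\pi(x)^{-1}=\pi(x^{-1})$, and $x\mapsto\langle\pi(x)\xi(d(x)),\eta(r(x))\rangle$ is continuous for $\xi,\eta\in C_0(G^0,\mathcal H^\pi)$. All representations are assumed to have all fibers non-zero and $C_0(G^0,\mathcal H^\pi)$ countably generated as a Hilbert $C_0(G^0)$-module. Weak containment. A positive definite function associated with $\pi$ is a function $\phi(x)=\langle\pi(x)\xi(d(x)),\xi(r(x))\rangle$ with $\xi\in C_b(G^0,\mathcal H^\pi)$. $\pi\prec\rho$ means: for every positive definite function $\phi$ associated with $\pi$, every compact $K\subseteq G$ and every $\varepsilon>0$ there are $\eta_1,\dots,\eta_n\in C_b(G^0,\mathcal H^\rho)$ with $|\phi(x)-\sum_{i=1}^n\langle\rho(x)\eta_i(d(x)),\eta_i(r(x))\rangle|<\varepsilon$ for all $x\in K$. Amenable representation. For $T$ adjointable on $C_0(G^0,\mathcal H^\pi)$, $T_u$ is its localization on $\mathcal H^\pi_u$, $(T\xi)(u)=T_u\xi(u)$. $T$ is Hilbert–Schmidt if $u\mapsto\operatorname{Tr}(|T_u|^2)$ lies in $C_0(G^0)$; $\|T_u\|_2=\operatorname{Tr}(|T_u|^2)^{1/2}$, $\|T\|_2=\sup_u\|T_u\|_2$. Put $x\cdot T_{d(x)}=\pi(x)T_{d(x)}\pi(x^{-1})$.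 $\pi$ is amenable if there is a net $\{T^i\}$ of Hilbert–Schmidt operators on $C_0(G^0,\mathcal H^\pi)$ with $\|T^i\|_2\le1$, $\|T^i_u\|_2\to1$ uniformly on compact subsets of $G^0$, and $\langle x\cdot T^i_{d(x)},T^i_{r(x)}\rangle\to1$ (Hilbert–Schmidt inner product) uniformly on compact subsets of $G$. *)

theory Defs
  imports "HOL-Analysis.Analysis" "HOL-Algebra.Coset"
begin

section \<open>Hilbert spaces\<close>

class complex_vector = ab_group_add +
  fixes scaleC :: "complex \<Rightarrow> 'a \<Rightarrow> 'a" (infixr \<open>*\<^sub>C\<close> 75)
  assumes scaleC_add_right: "a *\<^sub>C (x + y) = a *\<^sub>C x + a *\<^sub>C y"
    and scaleC_add_left: "(a + b) *\<^sub>C x = a *\<^sub>C x + b *\<^sub>C x"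
    and scaleC_scaleC: "a *\<^sub>C (b *\<^sub>C x) = (a * b) *\<^sub>C x"
    and scaleC_one: "1 *\<^sub>C x = x"

global_interpretation cvec: vector_space "scaleC :: complex \<Rightarrow> 'a \<Rightarrow> 'a::complex_vector"
  by unfold_locales
    (rule scaleC_add_right scaleC_add_left scaleC_scaleC scaleC_one)+

text \<open>The fibres of a bundle are different Hilbert spaces, so they cannot be types.  They are
  linear subspaces of one ambient complex vector space without any topology, each with its own
  inner product.  This is no restriction, since any family of vector spaces embeds in its
  direct sum.\<close>

record 'h hspace =
  hcar :: "'h set"
  hip :: "'h \<Rightarrow> 'h \<Rightarrow> complex"

definition hnorm :: "'h::complex_vector hspace \<Rightarrow> 'h \<Rightarrow> real"
  where "hnorm H v = sqrt (Re (hip H v v))"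

text \<open>Off the carrier the value is 0, since \<open>Metric_space\<close> requires distances to be nonnegative
  and symmetric everywhere.\<close>

definition hdist :: "'h::complex_vector hspace \<Rightarrow> 'h \<Rightarrow> 'h \<Rightarrow> real"
  where "hdist H v w = (if v \<in> hcar H \<and> w \<in> hcar H then hnorm H (v - w) else 0)"

definition htop :: "'h::complex_vector hspace \<Rightarrow> 'h topology"
  where "htop H = Metric_space.mtopology (hcar H) (hdist H)"

text \<open>Inner products are linear in the first variable.\<close>

locale hilbert_space =
  fixes H :: "'h::complex_vector hspace"
  assumes subspace: "cvec.subspace (hcar H)"
    and ip_add: "\<lbrakk>x \<in> hcar H; y \<in> hcar H; z \<in> hcar H\<rbrakk> \<Longrightarrow> hip H (x + y) z = hip H x z + hip H y z"
    and ip_scale: "\<lbrakk>x \<in> hcar H; y \<in> hcar H\<rbrakk> \<Longrightarrow> hip H (c *\<^sub>C x) y = c * hip H x y"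
    and ip_cnj: "\<lbrakk>x \<in> hcar H; y \<in> hcar H\<rbrakk> \<Longrightarrow> hip H y x = cnj (hip H x y)"
    and ip_nonneg: "x \<in> hcar H \<Longrightarrow> 0 \<le> Re (hip H x x)"
    and ip_definite: "\<lbrakk>x \<in> hcar H; hip H x x = 0\<rbrakk> \<Longrightarrow> x = 0"
    and complete: "Metric_space.mcomplete (hcar H) (hdist H)"

definition orthonormal_basis :: "'h::complex_vector hspace \<Rightarrow> 'h set \<Rightarrow> bool"
  where "orthonormal_basis H B \<longleftrightarrow>
    B \<subseteq> hcar H \<and> (\<forall>e\<in>B. \<forall>f\<in>B. hip H e f = (if e = f then 1 else 0)) \<and>
    (\<forall>v\<in>hcar H. (\<forall>e\<in>B. hip H v e = 0) \<longrightarrow> v = 0)"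

definition hadjoint :: "'h::complex_vector hspace \<Rightarrow> ('h \<Rightarrow> 'h) \<Rightarrow> 'h \<Rightarrow> 'h"
  where "hadjoint H A w = (THE z. z \<in> hcar H \<and> (\<forall>v\<in>hcar H. hip H (A v) w = hip H v z))"

text \<open>There are two traces: \<open>pos_trace\<close> for positive operators, with values in \<open>[0, \<infinity>]\<close>, and
  \<open>trace\<close> for trace-class operators.  Neither depends on the choice of the basis there; on a
  positive operator that is not trace-class, \<open>trace\<close> would give the default value 0.\<close>

definition pos_trace :: "'h::complex_vector hspace \<Rightarrow> ('h \<Rightarrow> 'h) \<Rightarrow> ennreal"
  where "pos_trace H A = infsum (\<lambda>e. ennreal (Re (hip H (A e) e))) (SOME B. orthonormal_basis H B)"

definition trace :: "'h::complex_vector hspace \<Rightarrow> ('h \<Rightarrow> 'h) \<Rightarrow> complex"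
  where "trace H A = infsum (\<lambda>e. hip H (A e) e) (SOME B. orthonormal_basis H B)"

definition trace_abs_sq :: "'h::complex_vector hspace \<Rightarrow> ('h \<Rightarrow> 'h) \<Rightarrow> ennreal"
  where "trace_abs_sq H A = pos_trace H (\<lambda>v. hadjoint H A (A v))"

definition hs_norm :: "'h::complex_vector hspace \<Rightarrow> ('h \<Rightarrow> 'h) \<Rightarrow> real"
  where "hs_norm H A = sqrt (enn2real (trace_abs_sq H A))"

definition hs_inner :: "'h::complex_vector hspace \<Rightarrow> ('h \<Rightarrow> 'h) \<Rightarrow> ('h \<Rightarrow> 'h) \<Rightarrow> complex"
  where "hs_inner H A B = trace H (\<lambda>v. hadjoint H B (A v))"


section \<open>Continuous Hilbert bundles\<close>

definition vanishes_at_infinity :: "'x topology \<Rightarrow> ('x \<Rightarrow> real) \<Rightarrow> bool"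
  where "vanishes_at_infinity X f \<longleftrightarrow>
    (\<forall>\<epsilon>>0. \<exists>K. compactin X K \<and> (\<forall>u\<in>topspace X - K. \<bar>f u\<bar> < \<epsilon>))"

definition C0 :: "'x topology \<Rightarrow> ('x \<Rightarrow> complex) set"
  where "C0 X = {f. continuous_map X euclidean f \<and> vanishes_at_infinity X (\<lambda>u. cmod (f u))}"

record ('x, 'h) hbundle =
  fib :: "'x \<Rightarrow> 'h hspace"
  csec :: "('x \<Rightarrow> 'h) set"

text \<open>A continuous field of Hilbert spaces in the sense of Dixmier and Douady; \<open>csec E\<close> is the
  set of continuous sections.\<close>

locale continuous_hilbert_bundle =
  fixes X :: "'x topology" and E :: "('x, 'h::complex_vector, 'm) hbundle_scheme"
  assumes fibre_hilbert: "u \<in> topspace X \<Longrightarrow> hilbert_space (fib E u)"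
    and fibre_separable: "u \<in> topspace X \<Longrightarrow> separable_space (htop (fib E u))"
    and csec_sections: "csec E \<subseteq> (\<Pi>\<^sub>E u\<in>topspace X. hcar (fib E u))"
    and csec_zero: "(\<lambda>u\<in>topspace X. 0) \<in> csec E"
    and csec_add: "\<lbrakk>\<xi> \<in> csec E; \<eta> \<in> csec E\<rbrakk> \<Longrightarrow> (\<lambda>u\<in>topspace X. \<xi> u + \<eta> u) \<in> csec E"
    and csec_scale: "\<xi> \<in> csec E \<Longrightarrow> (\<lambda>u\<in>topspace X. c *\<^sub>C \<xi> u) \<in> csec E"
    and csec_dense: "u \<in> topspace X \<Longrightarrow>
      htop (fib E u) closure_of ((\<lambda>\<xi>. \<xi> u) ` csec E) = hcar (fib E u)"
    and csec_norm: "\<xi> \<in> csec E \<Longrightarrow> continuous_map X euclideanreal (\<lambda>u. hnorm (fib E u) (\<xi> u))"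
    and csec_local: "\<lbrakk>\<xi> \<in> (\<Pi>\<^sub>E u\<in>topspace X. hcar (fib E u));
      \<And>u \<epsilon>. \<lbrakk>u \<in> topspace X; \<epsilon> > 0\<rbrakk> \<Longrightarrow>
        \<exists>\<eta>\<in>csec E. \<exists>U. openin X U \<and> u \<in> U \<and> (\<forall>v\<in>U. hdist (fib E v) (\<xi> v) (\<eta> v) \<le> \<epsilon>)\<rbrakk>
      \<Longrightarrow> \<xi> \<in> csec E"

definition C0_sections :: "'x topology \<Rightarrow> ('x, 'h::complex_vector, 'm) hbundle_scheme \<Rightarrow> ('x \<Rightarrow> 'h) set"
  where "C0_sections X E =
    {\<xi> \<in> csec E. vanishes_at_infinity X (\<lambda>u. hnorm (fib E u) (\<xi> u))}"

definition Cb_sections :: "'x topology \<Rightarrow> ('x, 'h::complex_vector, 'm) hbundle_scheme \<Rightarrow> ('x \<Rightarrow> 'h) set"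
  where "Cb_sections X E =
    {\<xi> \<in> csec E. \<exists>M. \<forall>u\<in>topspace X. hnorm (fib E u) (\<xi> u) \<le> M}"

definition countably_generated :: "'x topology \<Rightarrow> ('x, 'h::complex_vector, 'm) hbundle_scheme \<Rightarrow> bool"
  where "countably_generated X E \<longleftrightarrow>
    (\<exists>S \<subseteq> C0_sections X E. countable S \<and>
      (\<forall>\<xi>\<in>C0_sections X E. \<forall>\<epsilon>>0. \<exists>F a. finite F \<and> F \<subseteq> S \<and> (\<forall>\<eta>\<in>F. a \<eta> \<in> C0 X) \<and>
        (\<forall>u\<in>topspace X. hdist (fib E u) (\<xi> u) (\<Sum>\<eta>\<in>F. a \<eta> u *\<^sub>C \<eta> u) \<le> \<epsilon>)))"

definition adjointable ::
    "'x topology \<Rightarrow> ('x, 'h::complex_vector, 'm) hbundle_scheme \<Rightarrow> (('x \<Rightarrow> 'h) \<Rightarrow> ('x \<Rightarrow> 'h)) \<Rightarrow> bool"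
  where "adjointable X E T \<longleftrightarrow>
    T \<in> C0_sections X E \<rightarrow> C0_sections X E \<and>
    (\<exists>S \<in> C0_sections X E \<rightarrow> C0_sections X E.
      \<forall>\<xi>\<in>C0_sections X E. \<forall>\<eta>\<in>C0_sections X E. \<forall>u\<in>topspace X.
        hip (fib E u) (T \<xi> u) (\<eta> u) = hip (fib E u) (\<xi> u) (S \<eta> u))"

text \<open>For an adjointable \<open>T\<close>, the value \<open>T \<xi> u\<close> depends on \<open>\<xi> u\<close> only, and over a locally compact
  Hausdorff base every vector of a fibre is the value of some section.\<close>

definition localization ::
    "'x topology \<Rightarrow> ('x, 'h::complex_vector, 'm) hbundle_scheme \<Rightarrow> (('x \<Rightarrow> 'h) \<Rightarrow> ('x \<Rightarrow> 'h))
      \<Rightarrow> 'x \<Rightarrow> 'h \<Rightarrow> 'h"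
  where "localization X E T u v = (THE w. \<exists>\<xi>\<in>C0_sections X E. \<xi> u = v \<and> w = T \<xi> u)"

definition hilbert_schmidt ::
    "'x topology \<Rightarrow> ('x, 'h::complex_vector, 'm) hbundle_scheme \<Rightarrow> (('x \<Rightarrow> 'h) \<Rightarrow> ('x \<Rightarrow> 'h)) \<Rightarrow> bool"
  where "hilbert_schmidt X E T \<longleftrightarrow>
    adjointable X E T \<and>
    (\<forall>u\<in>topspace X. trace_abs_sq (fib E u) (localization X E T u) < \<infinity>) \<and>
    (\<lambda>u. complex_of_real (enn2real (trace_abs_sq (fib E u) (localization X E T u)))) \<in> C0 X"

definition hs_sup_norm ::
    "'x topology \<Rightarrow> ('x, 'h::complex_vector, 'm) hbundle_scheme \<Rightarrow> (('x \<Rightarrow> 'h) \<Rightarrow> ('x \<Rightarrow> 'h)) \<Rightarrow> real"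
  where "hs_sup_norm X E T = (SUP u\<in>topspace X. hs_norm (fib E u) (localization X E T u))"


section \<open>Representations of topological groupoids\<close>

record 'x top_groupoid =
  arrows :: "'x topology"
  units :: "'x set"
  src :: "'x \<Rightarrow> 'x"
  rng :: "'x \<Rightarrow> 'x"
  gmul :: "'x \<Rightarrow> 'x \<Rightarrow> 'x"
  ginv :: "'x \<Rightarrow> 'x"

abbreviation unit_space :: "'x top_groupoid \<Rightarrow> 'x topology"
  where "unit_space G \<equiv> subtopology (arrows G) (units G)"

record ('x, 'h) representation = "('x, 'h) hbundle" +
  act :: "'x \<Rightarrow> 'h \<Rightarrow> 'h"

definition coefficient ::
    "'x top_groupoid \<Rightarrow> ('x, 'h::complex_vector) representation \<Rightarrow> ('x \<Rightarrow> 'h) \<Rightarrow> ('x \<Rightarrow> 'h) \<Rightarrow> 'x \<Rightarrow> complex"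
  where "coefficient G \<pi> \<xi> \<eta> x = hip (fib \<pi> (rng G x)) (act \<pi> x (\<xi> (src G x))) (\<eta> (rng G x))"

locale continuous_unitary_representation =
  continuous_hilbert_bundle "unit_space G" \<pi>
  for G :: "'x top_groupoid" and \<pi> :: "('x, 'h::complex_vector) representation" +
  assumes act_bij: "x \<in> topspace (arrows G) \<Longrightarrow>
      bij_betw (act \<pi> x) (hcar (fib \<pi> (src G x))) (hcar (fib \<pi> (rng G x)))"
    and act_add: "\<lbrakk>x \<in> topspace (arrows G); v \<in> hcar (fib \<pi> (src G x)); w \<in> hcar (fib \<pi> (src G x))\<rbrakk>
      \<Longrightarrow> act \<pi> x (v + w) = act \<pi> x v + act \<pi> x w"
    and act_scale: "\<lbrakk>x \<in> topspace (arrows G); v \<in> hcar (fib \<pi> (src G x))\<rbrakk>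
      \<Longrightarrow> act \<pi> x (c *\<^sub>C v) = c *\<^sub>C act \<pi> x v"
    and act_ip: "\<lbrakk>x \<in> topspace (arrows G); v \<in> hcar (fib \<pi> (src G x)); w \<in> hcar (fib \<pi> (src G x))\<rbrakk>
      \<Longrightarrow> hip (fib \<pi> (rng G x)) (act \<pi> x v) (act \<pi> x w) = hip (fib \<pi> (src G x)) v w"
    and act_unit: "\<lbrakk>u \<in> units G; v \<in> hcar (fib \<pi> u)\<rbrakk> \<Longrightarrow> act \<pi> u v = v"
    and act_mul: "\<lbrakk>x \<in> topspace (arrows G); y \<in> topspace (arrows G); src G x = rng G y;
        v \<in> hcar (fib \<pi> (src G y))\<rbrakk> \<Longrightarrow> act \<pi> (gmul G x y) v = act \<pi> x (act \<pi> y v)"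
    and act_inv: "\<lbrakk>x \<in> topspace (arrows G); w \<in> hcar (fib \<pi> (rng G x))\<rbrakk>
      \<Longrightarrow> inv_into (hcar (fib \<pi> (src G x))) (act \<pi> x) w = act \<pi> (ginv G x) w"
    and act_continuous: "\<lbrakk>\<xi> \<in> C0_sections (unit_space G) \<pi>; \<eta> \<in> C0_sections (unit_space G) \<pi>\<rbrakk>
      \<Longrightarrow> continuous_map (arrows G) euclidean (coefficient G \<pi> \<xi> \<eta>)"
    and fibre_nonzero: "u \<in> topspace (unit_space G) \<Longrightarrow> hcar (fib \<pi> u) \<noteq> {0}"
    and sections_countably_generated: "countably_generated (unit_space G) \<pi>"

definition pd_functions ::
    "'x top_groupoid \<Rightarrow> ('x, 'h::complex_vector) representation \<Rightarrow> ('x \<Rightarrow> complex) set"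
  where "pd_functions G \<pi> = {coefficient G \<pi> \<xi> \<xi> | \<xi>. \<xi> \<in> Cb_sections (unit_space G) \<pi>}"

definition weakly_contained ::
    "'x top_groupoid \<Rightarrow> ('x, 'h::complex_vector) representation \<Rightarrow>
      ('x, 'k::complex_vector) representation \<Rightarrow> bool"
  where "weakly_contained G \<pi> \<rho> \<longleftrightarrow>
    (\<forall>\<phi>\<in>pd_functions G \<pi>. \<forall>K. compactin (arrows G) K \<longrightarrow> (\<forall>\<epsilon>>0.
      \<exists>(n::nat) \<eta>. (\<forall>i\<in>{1..n}. \<eta> i \<in> Cb_sections (unit_space G) \<rho>) \<and>
        (\<forall>x\<in>K. cmod (\<phi> x - (\<Sum>i=1..n. coefficient G \<rho> (\<eta> i) (\<eta> i) x)) < \<epsilon>)))"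

definition translate ::
    "'x top_groupoid \<Rightarrow> ('x, 'h::complex_vector) representation \<Rightarrow> 'x \<Rightarrow> ('h \<Rightarrow> 'h) \<Rightarrow> 'h \<Rightarrow> 'h"
  where "translate G \<pi> x A v = act \<pi> x (A (act \<pi> (ginv G x) v))"

text \<open>A net of operators is rendered as a proper filter \<open>F\<close> on the operators: the filter of
  tails of the net.  Conversely every proper filter comes from a net in this way.\<close>

definition amenable_representation ::
    "'x top_groupoid \<Rightarrow> ('x, 'h::complex_vector) representation \<Rightarrow> bool"
  where "amenable_representation G \<pi> \<longleftrightarrow>
    (\<exists>F. F \<noteq> bot \<and>
      F \<le> principal {T. hilbert_schmidt (unit_space G) \<pi> T \<and> hs_sup_norm (unit_space G) \<pi> T \<le> 1} \<and>
      (\<forall>L. compactin (unit_space G) L \<longrightarrow>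
        uniform_limit L (\<lambda>T u. hs_norm (fib \<pi> u) (localization (unit_space G) \<pi> T u)) (\<lambda>_. 1) F) \<and>
      (\<forall>L. compactin (arrows G) L \<longrightarrow>
        uniform_limit L
          (\<lambda>T x. hs_inner (fib \<pi> (rng G x))
            (translate G \<pi> x (localization (unit_space G) \<pi> T (src G x)))
            (localization (unit_space G) \<pi> T (rng G x)))
          (\<lambda>_. 1) F))"


section \<open>The HLS groupoid\<close>

locale approximated_group = group \<Gamma>
  for \<Gamma> :: "('g, 'm) monoid_scheme" (structure) and K :: "nat \<Rightarrow> 'g set" +
  assumes K_normal: "K n \<lhd> \<Gamma>"
    and K_finite_index: "finite (rcosets K n)"
    and K_decreasing: "K (Suc n) \<subseteq> K n"
    and K_Inter: "(\<Inter>n. K n) = {\<one>}"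

text \<open>To treat all indices uniformly, \<open>\<Gamma>\<^sub>\<infinity> = \<Gamma>\<close> is identified with the quotient by the
  trivial subgroup, that is, \<open>g\<close> with \<open>{g}\<close>.\<close>

definition hls_kernel :: "('g, 'm) monoid_scheme \<Rightarrow> (nat \<Rightarrow> 'g set) \<Rightarrow> enat \<Rightarrow> 'g set"
  where "hls_kernel \<Gamma> K n = (case n of enat m \<Rightarrow> K m | \<infinity> \<Rightarrow> {\<one>\<^bsub>\<Gamma>\<^esub>})"

definition hls_quotient :: "('g, 'm) monoid_scheme \<Rightarrow> (nat \<Rightarrow> 'g set) \<Rightarrow> enat \<Rightarrow> 'g set monoid"
  where "hls_quotient \<Gamma> K n = \<Gamma> Mod hls_kernel \<Gamma> K n"

definition hls_proj :: "('g, 'm) monoid_scheme \<Rightarrow> (nat \<Rightarrow> 'g set) \<Rightarrow> enat \<Rightarrow> 'g \<Rightarrow> 'g set"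
  where "hls_proj \<Gamma> K n g = hls_kernel \<Gamma> K n #>\<^bsub>\<Gamma>\<^esub> g"

definition hls_topology :: "('g, 'm) monoid_scheme \<Rightarrow> (nat \<Rightarrow> 'g set) \<Rightarrow> (enat \<times> 'g set) topology"
  where "hls_topology \<Gamma> K = topology_generated_by
    ({{(enat n, a)} | n a. a \<in> carrier (hls_quotient \<Gamma> K (enat n))} \<union>
     {{(n, hls_proj \<Gamma> K n g) | n. enat N < n} | g N. g \<in> carrier \<Gamma>})"

definition hls_groupoid :: "('g, 'm) monoid_scheme \<Rightarrow> (nat \<Rightarrow> 'g set) \<Rightarrow> (enat \<times> 'g set) top_groupoid"
  where "hls_groupoid \<Gamma> K =
    \<lparr> arrows = hls_topology \<Gamma> K,
      units = {(n, \<one>\<^bsub>hls_quotient \<Gamma> K n\<^esub>) | n. True},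
      src = (\<lambda>(n, a). (n, \<one>\<^bsub>hls_quotient \<Gamma> K n\<^esub>)),
      rng = (\<lambda>(n, a). (n, \<one>\<^bsub>hls_quotient \<Gamma> K n\<^esub>)),
      gmul = (\<lambda>(n, a) (m, b). (n, a \<otimes>\<^bsub>hls_quotient \<Gamma> K n\<^esub> b)),
      ginv = (\<lambda>(n, a). (n, inv\<^bsub>hls_quotient \<Gamma> K n\<^esub> a)) \<rparr>"

end

theory Submission
  imports Defs
begin

text \<open>Only the fibre over \<open>\<infinity>\<close> matters.  If \<open>\<pi>\<close> is amenable, a finite part of a Hilbert--Schmidt
  operator on that fibre gives finite families \<open>x\<close>, \<open>y\<close> of vectors such that
  \<open>\<Sum>\<^sub>i\<^sub>j \<langle>g x\<^sub>i, x\<^sub>j\<rangle> cnj \<langle>g y\<^sub>i, y\<^sub>j\<rangle>\<close> is close to \<open>1\<close> for \<open>g\<close> in a given finite set.  Weak containment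
  approximates the matrices \<open>\<langle>g x\<^sub>i, x\<^sub>j\<rangle>\<close> by sums of such matrices of \<open>\<rho>\<close>, so a sum of
  coefficients of \<open>\<rho> \<otimes> cnj \<rho>\<close> is close to \<open>1\<close> too, and by averaging one of its terms, normalised, already is.
  That term is the coefficient of a finite rank operator on the fibre of \<open>\<rho>\<close> over \<open>\<infinity>\<close>.  It extends to
  continuous sections and remains almost invariant over all but finitely many \<open>n\<close>.  Over the
  others, which are isolated and where the group is finite, it is replaced by an invariant operator.\<close>

section \<open>Hilbert spaces\<close>

text \<open>The Hilbert--Schmidt operators on H form H \<otimes> cnj H, and conjugation by a unitary
  g acts there as g \<otimes> cnj g; this is why the quantity to be transferred pairs an entry for x
  with a conjugated entry for y. The obstacle is that weak containment concerns one vector at a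
  time, whereas such a sum involves the whole matrix of a family. Polarisation would produce
  combinations with complex signs, and not one list of families that serves all entries. The
  matrices are therefore approximated by induction on the family. On the span of the orbits of the
  earlier vectors, approximants can be transported by the same linear combinations; a remainder
  orthogonal to that span can be handled by concatenating lists, because these produce no cross
  terms. A single term of the resulting sum can be isolated because every term is positive definite,
  hence bounded by its value at \<one>. Continuity enters only through coefficients: along (n, q_n
  g) they converge to their value at (\<infinity>, g), which carries the estimates from \<infinity>
  to large n once the vectors have been extended to sections.\<close>

context hilbert_space
begin

section \<open>Inner product, norm and distance\<close>

abbreviation car :: "'h set" where "car \<equiv> hcar H"

lemma zero_mem [simp, intro]: "0 \<in> car"
  using subspace cvec.subspace_0 by blast

lemma add_mem [simp, intro]: "x \<in> car \<Longrightarrow> y \<in> car \<Longrightarrow> x + y \<in> car"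
  using subspace cvec.subspace_add by blast

lemma scale_mem [simp, intro]: "x \<in> car \<Longrightarrow> c *\<^sub>C x \<in> car"
  using subspace cvec.subspace_scale by blast

lemma minus_mem [simp, intro]: "x \<in> car \<Longrightarrow> y \<in> car \<Longrightarrow> x - y \<in> car"
  using subspace cvec.subspace_diff by blast

lemma uminus_mem [simp, intro]: "x \<in> car \<Longrightarrow> - x \<in> car"
  using subspace cvec.subspace_neg by blast

lemma sum_mem [simp, intro]: "(\<And>i. i \<in> I \<Longrightarrow> f i \<in> car) \<Longrightarrow> sum f I \<in> car"
  using cvec.subspace_sum[OF subspace, of I f] by blast

lemma ip_zero_left [simp]: "y \<in> car \<Longrightarrow> hip H 0 y = 0"
  using ip_scale[of 0 y 0] by simp

lemma ip_uminus_left: "x \<in> car \<Longrightarrow> y \<in> car \<Longrightarrow> hip H (- x) y = - hip H x y"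
  using ip_scale[of x y "- 1"] by simp

lemma ip_diff_left:
  "\<lbrakk>x \<in> car; y \<in> car; z \<in> car\<rbrakk> \<Longrightarrow> hip H (x - y) z = hip H x z - hip H y z"
  using ip_add[of x "- y" z] ip_uminus_left[of y z] by simp

lemma ip_zero_right [simp]: "x \<in> car \<Longrightarrow> hip H x 0 = 0"
  using ip_cnj[of 0 x] by simp

lemma ip_add_right:
  "\<lbrakk>x \<in> car; y \<in> car; z \<in> car\<rbrakk> \<Longrightarrow> hip H x (y + z) = hip H x y + hip H x z"
  using ip_cnj[of "y + z" x] ip_add[of y z x] ip_cnj[of y x] ip_cnj[of z x] by simp

lemma ip_scale_right:
  "\<lbrakk>x \<in> car; y \<in> car\<rbrakk> \<Longrightarrow> hip H x (c *\<^sub>C y) = cnj c * hip H x y"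
  using ip_cnj[of "c *\<^sub>C y" x] ip_scale[of y x c] ip_cnj[of y x] by simp

lemma ip_diff_right:
  "\<lbrakk>x \<in> car; y \<in> car; z \<in> car\<rbrakk> \<Longrightarrow> hip H x (y - z) = hip H x y - hip H x z"
  using ip_cnj[of "y - z" x] ip_diff_left[of y z x] ip_cnj[of y x] ip_cnj[of z x] by simp

lemma ip_sum_left:
  assumes "\<And>i. i \<in> I \<Longrightarrow> f i \<in> car" "y \<in> car"
  shows "hip H (sum f I) y = (\<Sum>i\<in>I. hip H (f i) y)"
  using assms by (induct I rule: infinite_finite_induct) (auto simp: ip_add)

lemma ip_sum_right:
  assumes "\<And>i. i \<in> I \<Longrightarrow> f i \<in> car" "y \<in> car"
  shows "hip H y (sum f I) = (\<Sum>i\<in>I. hip H y (f i))"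
  using assms by (induct I rule: infinite_finite_induct) (auto simp: ip_add_right)

lemma ip_self_Im [simp]: "x \<in> car \<Longrightarrow> Im (hip H x x) = 0"
  using ip_cnj[of x x] by (simp add: complex_eq_iff)

lemma hnorm_nonneg [simp]: "x \<in> car \<Longrightarrow> 0 \<le> hnorm H x"
  by (simp add: hnorm_def ip_nonneg)

lemma hnorm_sq: "x \<in> car \<Longrightarrow> (hnorm H x)\<^sup>2 = Re (hip H x x)"
  by (simp add: hnorm_def ip_nonneg)

lemma ip_self: "x \<in> car \<Longrightarrow> hip H x x = complex_of_real ((hnorm H x)\<^sup>2)"
  by (simp add: hnorm_sq complex_eq_iff)

lemma hnorm_zero [simp]: "hnorm H 0 = 0"
  by (simp add: hnorm_def)

lemma hnorm_eq_0: "x \<in> car \<Longrightarrow> hnorm H x = 0 \<longleftrightarrow> x = 0"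
  using ip_definite[of x] ip_self[of x] by auto

lemma hnorm_scale: "x \<in> car \<Longrightarrow> hnorm H (c *\<^sub>C x) = cmod c * hnorm H x"
proof -
  assume x: "x \<in> car"
  have "hip H (c *\<^sub>C x) (c *\<^sub>C x) = (c * cnj c) * hip H x x"
    using x by (simp add: ip_scale ip_scale_right)
  also have "\<dots> = complex_of_real ((cmod c)\<^sup>2 * (hnorm H x)\<^sup>2)"
    using x by (simp only: ip_self complex_norm_square[symmetric] of_real_mult)
  finally have "Re (hip H (c *\<^sub>C x) (c *\<^sub>C x)) = (cmod c * hnorm H x)\<^sup>2"
    by (simp add: power_mult_distrib)
  then show ?thesis
    using x by (simp add: hnorm_def[of _ "c *\<^sub>C x"])
qed

lemma hnorm_diff_sq:
  assumes "x \<in> car" "y \<in> car"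
  shows "(hnorm H (x - y))\<^sup>2 = (hnorm H x)\<^sup>2 - 2 * Re (hip H x y) + (hnorm H y)\<^sup>2"
  using assms ip_cnj[of x y] by (simp add: hnorm_sq ip_diff_left ip_diff_right)

lemma hnorm_add_sq:
  assumes "x \<in> car" "y \<in> car"
  shows "(hnorm H (x + y))\<^sup>2 = (hnorm H x)\<^sup>2 + 2 * Re (hip H x y) + (hnorm H y)\<^sup>2"
  using assms ip_cnj[of x y] by (simp add: hnorm_sq ip_add ip_add_right)

text \<open>For \<open>d = 0\<close> this is the Cauchy--Schwarz inequality; the general form serves almost
  orthogonality of almost closest points.\<close>

lemma cmod_ip_sq_le:
  assumes x: "x \<in> car" and y: "y \<in> car" and d: "\<And>t. d \<le> (hnorm H (x - t *\<^sub>C y))\<^sup>2"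
  shows "(cmod (hip H x y))\<^sup>2 \<le> ((hnorm H x)\<^sup>2 - d) * (hnorm H y)\<^sup>2"
proof (cases "y = 0")
  case True
  then show ?thesis using x by simp
next
  case False
  define n where "n = (hnorm H y)\<^sup>2"
  have n: "n > 0" using False y hnorm_eq_0[of y] by (simp add: n_def)
  \<comment> \<open>The orthogonal projection of \<open>x\<close> to the line through
    \<open>y\<close> is \<open>t *\<^sub>C y\<close>, so this \<open>t\<close> gives the sharpest
    case of the hypothesis on \<open>d\<close>.\<close>
  define t where "t = hip H x y / complex_of_real n"
  have "Re (hip H x (t *\<^sub>C y)) = (cmod (hip H x y))\<^sup>2 / n"
  proof -
    have "hip H x (t *\<^sub>C y) = cnj (hip H x y) * hip H x y / n"
      using x y by (simp add: t_def ip_scale_right)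
    also have "\<dots> = complex_of_real ((cmod (hip H x y))\<^sup>2 / n)"
      using complex_norm_square[of "hip H x y"] by (simp add: mult.commute)
    finally show ?thesis by simp
  qed
  moreover have "(hnorm H (t *\<^sub>C y))\<^sup>2 = (cmod (hip H x y))\<^sup>2 / n"
    using n y by (simp add: hnorm_scale t_def norm_divide power_mult_distrib power_divide
        n_def[symmetric]) (simp add: power2_eq_square)
  ultimately have "d \<le> (hnorm H x)\<^sup>2 - (cmod (hip H x y))\<^sup>2 / n"
    using d[of t] x y by (simp add: hnorm_diff_sq)
  then show ?thesis
    using n by (simp add: n_def[symmetric] field_simps)
qed

lemma Cauchy_Schwarz:
  assumes "x \<in> car" "y \<in> car"
  shows "cmod (hip H x y) \<le> hnorm H x * hnorm H y"
proof (rule power2_le_imp_le)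
  show "(cmod (hip H x y))\<^sup>2 \<le> (hnorm H x * hnorm H y)\<^sup>2"
    using cmod_ip_sq_le[OF assms, of 0] by (simp add: power_mult_distrib)
qed (use assms in simp)

lemma hnorm_triangle:
  assumes "x \<in> car" "y \<in> car"
  shows "hnorm H (x + y) \<le> hnorm H x + hnorm H y"
proof (rule power2_le_imp_le)
  have "Re (hip H x y) \<le> hnorm H x * hnorm H y"
    using Cauchy_Schwarz[OF assms] complex_Re_le_cmod order_trans by blast
  then show "(hnorm H (x + y))\<^sup>2 \<le> (hnorm H x + hnorm H y)\<^sup>2"
    using assms by (simp add: hnorm_add_sq power2_sum)
qed (use assms in simp)

lemma hnorm_uminus [simp]: "x \<in> car \<Longrightarrow> hnorm H (- x) = hnorm H x"
  using hnorm_scale[of x "- 1"] by simp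

lemma hnorm_minus_commute: "x \<in> car \<Longrightarrow> y \<in> car \<Longrightarrow> hnorm H (x - y) = hnorm H (y - x)"
  using hnorm_uminus[of "x - y"] by simp

lemma hnorm_triangle_diff:
  assumes "x \<in> car" "y \<in> car" "z \<in> car"
  shows "hnorm H (x - z) \<le> hnorm H (x - y) + hnorm H (y - z)"
  using hnorm_triangle[of "x - y" "y - z"] assms by simp

lemma hdist_eq: "x \<in> car \<Longrightarrow> y \<in> car \<Longrightarrow> hdist H x y = hnorm H (x - y)"
  by (simp add: hdist_def)

lemma Metric_space_car: "Metric_space car (hdist H)"
proof
  show "0 \<le> hdist H x y" for x y by (simp add: hdist_def)
  show "hdist H x y = hdist H y x" for x y
    by (simp add: hdist_def hnorm_minus_commute)
  show "hdist H x y = 0 \<longleftrightarrow> x = y" if "x \<in> car" "y \<in> car" for x y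
    using that by (simp add: hdist_def hnorm_eq_0)
  show "hdist H x z \<le> hdist H x y + hdist H y z" if "x \<in> car" "y \<in> car" "z \<in> car" for x y z
    using that by (simp add: hdist_def hnorm_triangle_diff)
qed

section \<open>Completeness, orthonormal bases and the Parseval identity\<close>

lemma complete_sequence:
  assumes "\<And>n. s n \<in> car"
    and "\<And>\<epsilon>. \<epsilon> > 0 \<Longrightarrow> \<exists>N. \<forall>m\<ge>N. \<forall>n\<ge>N. hnorm H (s m - s n) < \<epsilon>"
  obtains w where "w \<in> car" "(\<lambda>n. hnorm H (s n - w)) \<longlonglongrightarrow> 0"
proof -
  interpret M: Metric_space car "hdist H" by (rule Metric_space_car)
  have "M.MCauchy s"
    unfolding M.MCauchy_def using assms by (fastforce simp: hdist_def)
  then obtain w where w: "limitin M.mtopology s w sequentially"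
    using complete unfolding M.mcomplete_def by blast
  then have "w \<in> car" by (simp add: M.limitin_metric)
  moreover have "(\<lambda>n. hdist H (s n) w) \<longlonglongrightarrow> 0"
    using w by (simp add: M.limitin_metric_dist_null)
  ultimately show ?thesis
    using that assms(1) by (simp add: hdist_def)
qed

text \<open>Bases are by definition maximal orthonormal sets, so Zorn's lemma applies: a nonzero
  vector orthogonal to a maximal set could be normalised and added. Existence gives meaning to the
  choice of a basis in \<open>pos_trace\<close> and \<open>trace\<close>.\<close>

lemma orthonormal_basis_exists: "\<exists>B. orthonormal_basis H B"
proof -
  define \<A> where "\<A> = {B. B \<subseteq> car \<and> (\<forall>e\<in>B. \<forall>f\<in>B. hip H e f = (if e = f then 1 else 0))}"
  have "\<exists>M\<in>\<A>. \<forall>X\<in>\<A>. M \<subseteq> X \<longrightarrow> X = M"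
  proof (rule subset_Zorn')
    fix C assume C: "subset.chain \<A> C"
    show "\<Union>C \<in> \<A>"
      unfolding \<A>_def
    proof (intro CollectI conjI ballI)
      show "\<Union>C \<subseteq> car" using C by (auto simp: subset.chain_def \<A>_def)
      fix e f assume "e \<in> \<Union>C" "f \<in> \<Union>C"
      then obtain X Y where XY: "X \<in> C" "Y \<in> C" "e \<in> X" "f \<in> Y" by blast
      then have "X \<subseteq> Y \<or> Y \<subseteq> X" using C by (meson subset_chain_def)
      then obtain Z where "Z \<in> C" "e \<in> Z" "f \<in> Z" using XY by blast
      then show "hip H e f = (if e = f then 1 else 0)"
        using C unfolding subset.chain_def \<A>_def by blast
    qed
  qed
  then obtain M where M: "M \<in> \<A>" and max: "\<And>X. X \<in> \<A> \<Longrightarrow> M \<subseteq> X \<Longrightarrow> X = M" by blast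
  have "v = 0" if v: "v \<in> car" and orth: "\<And>e. e \<in> M \<Longrightarrow> hip H v e = 0" for v
  proof (rule ccontr)
    assume nz: "v \<noteq> 0"
    define w where "w = complex_of_real (1 / hnorm H v) *\<^sub>C v"
    have n: "hnorm H v \<noteq> 0" using nz v hnorm_eq_0 by blast
    have w: "w \<in> car" using v by (simp add: w_def)
    have ww: "hip H w w = 1"
      using v n by (simp add: ip_self w hnorm_scale w_def norm_divide del: of_real_divide)
    have we: "hip H w e = 0" "hip H e w = 0" if "e \<in> M" for e
    proof -
      have e: "e \<in> car" using M that by (auto simp: \<A>_def)
      show "hip H w e = 0" using v e orth[OF that] by (simp add: w_def ip_scale)
      then show "hip H e w = 0" using ip_cnj[OF w e] by simp
    qed
    have "insert w M \<in> \<A>"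
      using M w ww we by (auto simp: \<A>_def)
    then have "w \<in> M" using max[of "insert w M"] by blast
    then show False using we(1) ww by fastforce
  qed
  then have "orthonormal_basis H M"
    using M by (simp add: orthonormal_basis_def \<A>_def)
  then show ?thesis ..
qed

text \<open>The very choice made inside \<open>pos_trace\<close> and \<open>trace\<close>, so that
  both unfold to sums over this set.\<close>

definition onb :: "'h set" where "onb = (SOME B. orthonormal_basis H B)"

lemma onb: "orthonormal_basis H onb"
  unfolding onb_def by (rule someI_ex) (rule orthonormal_basis_exists)

definition orthonormal :: "'h set \<Rightarrow> bool"
  where "orthonormal B \<longleftrightarrow> B \<subseteq> car \<and> (\<forall>e\<in>B. \<forall>f\<in>B. hip H e f = (if e = f then 1 else 0))"

lemma orthonormal_onb: "orthonormal onb"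
  using onb by (simp add: orthonormal_basis_def orthonormal_def)

lemma onb_mem: "e \<in> onb \<Longrightarrow> e \<in> car"
  using orthonormal_onb by (auto simp: orthonormal_def)

lemma orthonormal_sum_ip:
  assumes B: "orthonormal B" and F: "finite F" "F \<subseteq> B" and f: "f \<in> B"
  shows "hip H (\<Sum>e\<in>F. c e *\<^sub>C e) f = (if f \<in> F then c f else 0)"
proof -
  have Fc: "\<And>e. e \<in> F \<Longrightarrow> e \<in> car" and fc: "f \<in> car" using B F f by (auto simp: orthonormal_def)
  have on: "hip H e f = (if e = f then 1 else 0)" if "e \<in> F" for e
    using B F(2) f that unfolding orthonormal_def by blast
  have "hip H (\<Sum>e\<in>F. c e *\<^sub>C e) f = (\<Sum>e\<in>F. c e * hip H e f)"
    using Fc fc by (simp add: ip_sum_left ip_scale)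
  also have "\<dots> = (\<Sum>e\<in>F. if e = f then c e else 0)"
    using on by (intro sum.cong) auto
  finally show ?thesis using F(1) by simp
qed

lemma orthonormal_sum_norm:
  assumes B: "orthonormal B" and F: "finite F" "F \<subseteq> B"
  shows "(hnorm H (\<Sum>e\<in>F. c e *\<^sub>C e))\<^sup>2 = (\<Sum>e\<in>F. (cmod (c e))\<^sup>2)"
proof -
  have Fc: "\<And>e. e \<in> F \<Longrightarrow> e \<in> car" using B F by (auto simp: orthonormal_def)
  define w where "w = (\<Sum>e\<in>F. c e *\<^sub>C e)"
  have w: "w \<in> car" using Fc by (simp add: w_def)
  have we: "hip H w e = c e" if "e \<in> F" for e
    using orthonormal_sum_ip[OF B F, of e c] that F by (auto simp: w_def)
  have "hip H w w = (\<Sum>e\<in>F. cnj (c e) * hip H w e)"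
    using w Fc by (subst (2) w_def) (simp add: ip_sum_right ip_scale_right)
  also have "\<dots> = (\<Sum>e\<in>F. c e * cnj (c e))" using we by (simp add: mult.commute)
  also have "\<dots> = of_real (\<Sum>e\<in>F. (cmod (c e))\<^sup>2)" by (simp only: complex_norm_square of_real_sum)
  finally show ?thesis using w by (simp add: hnorm_sq w_def[symmetric])
qed

text \<open>Pythagoras: the finite sum is the orthogonal projection of \<open>v\<close> to the span
  of \<open>F\<close>.\<close>

lemma orthonormal_residual_sq:
  assumes B: "orthonormal B" and F: "finite F" "F \<subseteq> B" and v: "v \<in> car"
  shows "(hnorm H (v - (\<Sum>e\<in>F. hip H v e *\<^sub>C e)))\<^sup>2 = (hnorm H v)\<^sup>2 - (\<Sum>e\<in>F. (cmod (hip H v e))\<^sup>2)"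
proof -
  define w where "w = (\<Sum>e\<in>F. hip H v e *\<^sub>C e)"
  have Fc: "\<And>e. e \<in> F \<Longrightarrow> e \<in> car" using B F by (auto simp: orthonormal_def)
  have w: "w \<in> car" using Fc by (simp add: w_def)
  have "hip H v w = (\<Sum>e\<in>F. hip H v e * cnj (hip H v e))"
    using v Fc by (simp add: w_def ip_sum_right ip_scale_right mult.commute)
  also have "\<dots> = of_real (\<Sum>e\<in>F. (cmod (hip H v e))\<^sup>2)" by (simp only: complex_norm_square of_real_sum)
  finally have "Re (hip H v w) = (\<Sum>e\<in>F. (cmod (hip H v e))\<^sup>2)" by simp
  moreover have "(hnorm H w)\<^sup>2 = (\<Sum>e\<in>F. (cmod (hip H v e))\<^sup>2)"
    unfolding w_def by (rule orthonormal_sum_norm[OF B F])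
  ultimately show ?thesis
    using v w by (simp add: hnorm_diff_sq w_def[symmetric])
qed

lemma Bessel_finite:
  assumes "orthonormal B" "finite F" "F \<subseteq> B" "v \<in> car"
  shows "(\<Sum>e\<in>F. (cmod (hip H v e))\<^sup>2) \<le> (hnorm H v)\<^sup>2"
  using orthonormal_residual_sq[OF assms] zero_le_power2[of "hnorm H (v - (\<Sum>e\<in>F. hip H v e *\<^sub>C e))"]
  by linarith

text \<open>By Bessel the squared coefficients are summable. Partial expansions of \<open>v\<close>
  along finite sets that exhaust this sum form a Cauchy sequence; its limit has the same
  coefficients as \<open>v\<close>, and maximality of the basis makes it equal to
  \<open>v\<close>.\<close>

lemma Parseval:
  assumes v: "v \<in> car"
  shows "((\<lambda>e. (cmod (hip H v e))\<^sup>2) has_sum (hnorm H v)\<^sup>2) onb"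
proof -
  define g where "g = (\<lambda>e. (cmod (hip H v e))\<^sup>2)"
  have bd: "\<And>F. finite F \<Longrightarrow> F \<subseteq> onb \<Longrightarrow> sum g F \<le> (hnorm H v)\<^sup>2"
    using Bessel_finite[OF orthonormal_onb _ _ v] by (simp add: g_def)
  have summ: "g summable_on onb"
    by (rule nonneg_bdd_above_summable_on) (auto simp: g_def bdd_above_def intro!: exI[of _ "(hnorm H v)\<^sup>2"] bd[unfolded g_def])
  define S where "S = infsum g onb"
  have S: "(g has_sum S) onb" using summ by (simp add: S_def)
  have "\<exists>F. finite F \<and> F \<subseteq> onb \<and> dist (sum g F) S \<le> 1 / (real n + 1)" for n
    by (rule has_sum_finite_approximation[OF S]) simp
  then obtain F where F: "\<And>n. finite (F n)" "\<And>n. F n \<subseteq> onb"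
    "\<And>n. dist (sum g (F n)) S \<le> 1 / (real n + 1)" by metis
  have tail: "sum g G \<le> 1 / (real n + 1)" if "finite G" "G \<subseteq> onb" "G \<inter> F n = {}" for G n
  proof -
    have "sum g G + sum g (F n) = sum g (G \<union> F n)"
      using that F by (simp add: sum.union_disjoint)
    also have "\<dots> \<le> S"
      by (rule finite_sum_le_has_sum[OF S]) (use that F in \<open>auto simp: g_def\<close>)
    finally show ?thesis using F(3)[of n] by (simp add: dist_real_def)
  qed
  define E where "E n = (\<Union>k\<le>n. F k)" for n
  have E: "finite (E n)" "E n \<subseteq> onb" "F n \<subseteq> E n" for n using F by (auto simp: E_def)
  have Emono: "E m \<subseteq> E n" if "m \<le> n" for m n unfolding E_def by (intro UN_mono) (use that in auto)
  define s where "s n = (\<Sum>e\<in>E n. hip H v e *\<^sub>C e)" for n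
  have s: "s n \<in> car" for n unfolding s_def by (intro sum_mem scale_mem onb_mem) (use E(2) in blast)
  have se: "hip H (s n) e = (if e \<in> E n then hip H v e else 0)" if "e \<in> onb" for e n
    unfolding s_def by (rule orthonormal_sum_ip[OF orthonormal_onb]) (use E that in auto)
  have s_diff: "(hnorm H (s n - s m))\<^sup>2 \<le> 1 / (real m + 1)" if "m \<le> n" for m n
  proof -
    have "s n - s m = (\<Sum>e\<in>E n - E m. hip H v e *\<^sub>C e)"
      using Emono[OF that] E by (simp add: s_def sum_diff)
    then have "(hnorm H (s n - s m))\<^sup>2 = sum g (E n - E m)"
      using orthonormal_sum_norm[OF orthonormal_onb finite_Diff[OF E(1)], of n "E m" "hip H v"] E(2)[of n]
      by (simp add: g_def subset_iff)
    also have "\<dots> \<le> 1 / (real m + 1)" by (rule tail) (use E(1,2)[of n] E(3)[of m] in auto)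
    finally show ?thesis .
  qed
  obtain w where w: "w \<in> car" "(\<lambda>n. hnorm H (s n - w)) \<longlonglongrightarrow> 0"
  proof (rule complete_sequence[of s])
    fix \<epsilon> :: real assume "\<epsilon> > 0"
    then obtain N where N: "1 / (real N + 1) < \<epsilon>\<^sup>2"
      using nat_approx_posE[of "\<epsilon>\<^sup>2"] by (auto simp: add.commute)
    have *: "hnorm H (s n - s m) < \<epsilon>" if "N \<le> m" "m \<le> n" for m n
    proof -
      have "(hnorm H (s n - s m))\<^sup>2 \<le> 1 / (real m + 1)" using s_diff that by blast
      also have "\<dots> \<le> 1 / (real N + 1)" using that by (simp add: frac_le)
      finally have "(hnorm H (s n - s m))\<^sup>2 < \<epsilon>\<^sup>2" using N by linarith
      then show ?thesis using \<open>\<epsilon> > 0\<close> by (simp add: power2_less_imp_less)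
    qed
    have "hnorm H (s m - s n) < \<epsilon>" if "N \<le> m" "N \<le> n" for m n
      using *[of m n] *[of n m] hnorm_minus_commute[OF s s, of m n] that by (cases "m \<le> n") auto
    then show "\<exists>N. \<forall>m\<ge>N. \<forall>n\<ge>N. hnorm H (s m - s n) < \<epsilon>" by blast
  qed (use s in auto)
  have "hip H (v - w) e = 0" if e: "e \<in> onb" for e
  proof -
    have ec: "e \<in> car" and ne: "hnorm H e = 1"
      using e onb_mem orthonormal_onb by (auto simp: orthonormal_def hnorm_def)
    have lim0: "(\<lambda>n. hip H (s n - w) e) \<longlonglongrightarrow> 0"
    proof (rule Lim_null_comparison[OF _ w(2)])
      show "\<forall>\<^sub>F n in sequentially. cmod (hip H (s n - w) e) \<le> hnorm H (s n - w)"
        using Cauchy_Schwarz[of "s _ - w" e] s w(1) ec ne by simp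
    qed
    have lim1: "(\<lambda>n. hip H (v - s n) e) \<longlonglongrightarrow> 0"
    proof (rule Lim_null_comparison)
      show "\<forall>\<^sub>F n in sequentially. cmod (hip H (v - s n) e) \<le> sqrt (1 / (real n + 1))"
      proof (rule always_eventually, rule allI)
        fix n
        have "(cmod (hip H (v - s n) e))\<^sup>2 \<le> 1 / (real n + 1)"
        proof (cases "e \<in> E n")
          case True
          then show ?thesis using v s ec se[OF e] by (simp add: ip_diff_left)
        next
          case False
          \<comment> \<open>A coefficient not yet included is itself a tail, with the single index
            \<open>e\<close>.\<close>
          then have "sum g {e} \<le> 1 / (real n + 1)" using E(3)[of n] e by (intro tail) auto
          then show ?thesis using v s ec se[OF e] False by (simp add: ip_diff_left g_def)
        qed
        then show "cmod (hip H (v - s n) e) \<le> sqrt (1 / (real n + 1))" by (rule real_le_rsqrt)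
      qed
      show "(\<lambda>n. sqrt (1 / (real n + 1))) \<longlonglongrightarrow> 0"
        using tendsto_real_sqrt[OF LIMSEQ_inverse_real_of_nat] by (simp add: inverse_eq_divide add.commute)
    qed
    have "hip H (v - w) e = hip H (v - s n) e + hip H (s n - w) e" for n
      using v w(1) s ec by (simp add: ip_diff_left)
    then have "(\<lambda>n. hip H (v - w) e) \<longlonglongrightarrow> 0"
      using tendsto_add[OF lim1 lim0] by simp
    then show ?thesis by (simp add: LIMSEQ_const_iff)
  qed
  then have vw: "w = v"
    using onb minus_mem[OF v w(1)] unfolding orthonormal_basis_def by auto
  have lim: "(\<lambda>n. (hnorm H (v - s n))\<^sup>2) \<longlonglongrightarrow> 0"
    using tendsto_power[OF w(2), of 2] vw s v by (simp add: hnorm_minus_commute)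
  have "(hnorm H v)\<^sup>2 - S \<le> (hnorm H (v - s n))\<^sup>2" for n
  proof -
    have "(hnorm H (v - s n))\<^sup>2 = (hnorm H v)\<^sup>2 - sum g (E n)"
      unfolding s_def g_def by (rule orthonormal_residual_sq[OF orthonormal_onb _ _ v]) (use E in auto)
    moreover have "sum g (E n) \<le> S"
      by (rule finite_sum_le_has_sum[OF S]) (use E in \<open>auto simp: g_def\<close>)
    ultimately show ?thesis by simp
  qed
  then have "(hnorm H v)\<^sup>2 - S \<le> 0"
    by (intro LIMSEQ_le_const[OF lim]) blast
  moreover have "S \<le> (hnorm H v)\<^sup>2"
    by (rule has_sum_le_finite_sums[OF S bd])
  ultimately show ?thesis using S by (simp add: g_def)
qed

end

section \<open>Hilbert--Schmidt operators\<close>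

lemma has_sum_sum:
  fixes f :: "'i \<Rightarrow> 'a \<Rightarrow> 'b::topological_comm_monoid_add"
  assumes "\<And>i. i \<in> I \<Longrightarrow> (f i has_sum s i) A"
  shows "((\<lambda>x. \<Sum>i\<in>I. f i x) has_sum (\<Sum>i\<in>I. s i)) A"
  using assms by (induct I rule: infinite_finite_induct) (auto intro: has_sum_add)

lemma has_sum_ennreal:
  fixes f :: "'a \<Rightarrow> real"
  assumes "(f has_sum s) A" "\<And>x. x \<in> A \<Longrightarrow> 0 \<le> f x"
  shows "((\<lambda>x. ennreal (f x)) has_sum ennreal s) A"
proof -
  have "((\<lambda>F. ennreal (sum f F)) \<longlongrightarrow> ennreal s) (finite_subsets_at_top A)"
    using assms(1) unfolding has_sum_def by (rule tendsto_ennrealI)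
  moreover have "\<forall>\<^sub>F F in finite_subsets_at_top A. ennreal (sum f F) = (\<Sum>x\<in>F. ennreal (f x))"
    using assms(2) by (intro eventually_finite_subsets_at_top_weakI) (auto simp: subset_iff intro!: sum_ennreal[symmetric])
  ultimately show ?thesis
    unfolding has_sum_def by (rule Lim_transform_eventually)
qed

text \<open>Finiteness of a trace is stated in \<open>ennreal\<close>, while the estimates need real
  sums. A finite total bounds all finite partial sums, whence real summability, and
  \<open>has_sum_ennreal\<close> identifies the value.\<close>

lemma has_sum_of_infsum_ennreal:
  fixes f :: "'a \<Rightarrow> real"
  assumes fin: "infsum (\<lambda>x. ennreal (f x)) A < \<infinity>" and pos: "\<And>x. x \<in> A \<Longrightarrow> 0 \<le> f x"
  shows "(f has_sum enn2real (infsum (\<lambda>x. ennreal (f x)) A)) A"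
proof -
  let ?s = "infsum (\<lambda>x. ennreal (f x)) A"
  have "sum f F \<le> enn2real ?s" if F: "finite F" "F \<subseteq> A" for F
  proof -
    have "ennreal (sum f F) = (\<Sum>x\<in>F. ennreal (f x))"
      using pos F by (intro sum_ennreal[symmetric]) auto
    also have "\<dots> = infsum (\<lambda>x. ennreal (f x)) F" using F by simp
    also have "\<dots> \<le> ?s" by (rule infsum_mono_neutral[OF nonneg_summable_on_complete nonneg_summable_on_complete]) (use F in auto)
    finally show ?thesis
      using fin by (simp add: ennreal_le_iff2 le_ennreal_iff enn2real_mono ennreal_enn2real_if
          less_top[symmetric] flip: ennreal_le_iff)
  qed
  then have summ: "f summable_on A"
    using pos by (intro nonneg_bdd_above_summable_on) (auto simp: bdd_above_def)
  then have hs: "(f has_sum infsum f A) A" by simp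
  then have "?s = ennreal (infsum f A)"
    using pos by (intro infsumI has_sum_ennreal)
  then show ?thesis
    using hs pos by (simp add: infsum_nonneg)
qed

section \<open>Adjoints, traces and finite rank operators\<close>

context hilbert_space
begin

text \<open>Polarisation of \<open>Parseval\<close>: the real part comes from the norms of
  \<open>x + z\<close>, \<open>x\<close> and \<open>z\<close>, and the imaginary part from the real
  one with \<open>\<i> *\<^sub>C y\<close> for \<open>z\<close>, the inner product being conjugate
  linear in its second variable.\<close>

lemma Parseval_ip:
  assumes x: "x \<in> car" and y: "y \<in> car"
  shows "((\<lambda>e. hip H x e * hip H e y) has_sum hip H x y) onb"
proof -
  have Re: "((\<lambda>e. Re (hip H x e * cnj (hip H z e))) has_sum Re (hip H x z)) onb" if z: "z \<in> car" for z
  proof -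
    have 1: "((\<lambda>e. ((cmod (hip H (x + z) e))\<^sup>2 + (- (cmod (hip H x e))\<^sup>2 + - (cmod (hip H z e))\<^sup>2)) * (1/2))
        has_sum ((hnorm H (x + z))\<^sup>2 + (- (hnorm H x)\<^sup>2 + - (hnorm H z)\<^sup>2)) * (1/2)) onb"
      using x z by (intro has_sum_cmult_left has_sum_add has_sum_uminusI Parseval) auto
    have 2: "((hnorm H (x + z))\<^sup>2 + (- (hnorm H x)\<^sup>2 + - (hnorm H z)\<^sup>2)) * (1/2) = Re (hip H x z)"
      using x z by (simp add: hnorm_add_sq)
    have 3: "((cmod (hip H (x + z) e))\<^sup>2 + (- (cmod (hip H x e))\<^sup>2 + - (cmod (hip H z e))\<^sup>2)) * (1/2)
        = Re (hip H x e * cnj (hip H z e))" if "e \<in> onb" for e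
      using x z onb_mem[OF that]
      by (simp only: ip_add cmod_power2 plus_complex.simps) (simp add: power2_eq_square algebra_simps)
    show ?thesis using 1 unfolding 2 by (rule has_sum_cong[THEN iffD1, rotated]) (rule 3)
  qed
  have Im: "((\<lambda>e. Im (hip H x e * cnj (hip H y e))) has_sum Im (hip H x y)) onb"
  proof -
    have 1: "Re (hip H x e * cnj (hip H (\<i> *\<^sub>C y) e)) = Im (hip H x e * cnj (hip H y e))" if "e \<in> onb" for e
      using y onb_mem[OF that] by (simp add: ip_scale)
    have 2: "Re (hip H x (\<i> *\<^sub>C y)) = Im (hip H x y)"
      using x y by (simp add: ip_scale_right)
    show ?thesis using Re[OF scale_mem[OF y, of \<i>]] unfolding 2
      by (rule has_sum_cong[THEN iffD1, rotated]) (rule 1)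
  qed
  have "((\<lambda>e. complex_of_real (Re (hip H x e * cnj (hip H y e))) + \<i> * complex_of_real (Im (hip H x e * cnj (hip H y e))))
     has_sum complex_of_real (Re (hip H x y)) + \<i> * complex_of_real (Im (hip H x y))) onb"
    by (intro has_sum_add has_sum_cmult_right has_sum_of_real Re Im y)
  then have "((\<lambda>e. hip H x e * cnj (hip H y e)) has_sum hip H x y) onb"
    by (simp only: complex_eq[symmetric])
  moreover have "cnj (hip H y e) = hip H e y" if "e \<in> onb" for e
    using ip_cnj[OF y onb_mem[OF that]] by simp
  ultimately show ?thesis by (simp cong: has_sum_cong)
qed

text \<open>An explicit adjoint stands in for linearity and boundedness: it forces \<open>A\<close>
  to be linear on the carrier, and it evaluates the description in \<open>hadjoint\<close>.\<close>

definition adjoint_pair :: "('h \<Rightarrow> 'h) \<Rightarrow> ('h \<Rightarrow> 'h) \<Rightarrow> bool"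
  where "adjoint_pair A S \<longleftrightarrow> A \<in> car \<rightarrow> car \<and> S \<in> car \<rightarrow> car \<and>
    (\<forall>v\<in>car. \<forall>w\<in>car. hip H (A v) w = hip H v (S w))"

lemma adjoint_pair_mem: "adjoint_pair A S \<Longrightarrow> v \<in> car \<Longrightarrow> A v \<in> car"
  by (auto simp: adjoint_pair_def)

lemma adjoint_pair_sym: 
  assumes "adjoint_pair A S" shows "adjoint_pair S A"
proof -
  have "hip H (S v) w = hip H v (A w)" if "v \<in> car" "w \<in> car" for v w
    using assms that ip_cnj[of "A w" v] ip_cnj[of w "S v"]
    by (auto simp: adjoint_pair_def Pi_iff)
  then show ?thesis using assms by (simp add: adjoint_pair_def)
qed

lemma ip_ext:
  assumes "x \<in> car" "y \<in> car" "\<And>v. v \<in> car \<Longrightarrow> hip H v x = hip H v y"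
  shows "x = y"
proof -
  have "hip H (x - y) (x - y) = 0"
    using assms(3)[of "x - y"] assms(1,2) by (simp add: ip_diff_right)
  then show ?thesis using ip_definite[of "x - y"] assms(1,2) by simp
qed

lemma hadjoint_eq:
  assumes "adjoint_pair A S" "w \<in> car"
  shows "hadjoint H A w = S w"
  unfolding hadjoint_def
proof (rule the_equality)
  fix z assume "z \<in> car \<and> (\<forall>v\<in>car. hip H (A v) w = hip H v z)"
  then show "z = S w"
    using assms by (intro ip_ext) (auto simp: adjoint_pair_def Pi_iff)
qed (use assms in \<open>auto simp: adjoint_pair_def\<close>)

text \<open>The adjoint is moved across in each term. Both sides are \<open>infsum\<close> of one
  family, so nothing is asserted about summability; a family that is not summable gives 0 on
  both.\<close>

lemma hs_inner_eq:
  assumes "adjoint_pair A S" "A' \<in> car \<rightarrow> car"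
  shows "hs_inner H A' A = infsum (\<lambda>e. hip H (A' e) (A e)) onb"
  unfolding hs_inner_def trace_def onb_def[symmetric]
proof (rule infsum_cong)
  fix e assume "e \<in> onb"
  then have e: "e \<in> car" "A' e \<in> car" using onb_mem assms(2) by auto
  then have "hip H (hadjoint H A (A' e)) e = hip H (S (A' e)) e"
    using hadjoint_eq assms(1) by simp
  also have "\<dots> = hip H (A' e) (A e)"
    using adjoint_pair_sym[OF assms(1)] e by (simp add: adjoint_pair_def)
  finally show "hip H (hadjoint H A (A' e)) e = hip H (A' e) (A e)" .
qed

lemma trace_abs_sq_eq:
  assumes "adjoint_pair A S"
  shows "trace_abs_sq H A = infsum (\<lambda>e. ennreal ((hnorm H (A e))\<^sup>2)) onb"
  unfolding trace_abs_sq_def pos_trace_def onb_def[symmetric]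
proof (rule infsum_cong)
  fix e assume "e \<in> onb"
  then have e: "e \<in> car" "A e \<in> car" using onb_mem adjoint_pair_mem[OF assms] by auto
  then have "hip H (hadjoint H A (A e)) e = hip H (S (A e)) e"
    using hadjoint_eq assms(1) by simp
  also have "\<dots> = hip H (A e) (A e)"
    using adjoint_pair_sym[OF assms(1)] e by (simp add: adjoint_pair_def)
  finally show "ennreal (Re (hip H (hadjoint H A (A e)) e)) = ennreal ((hnorm H (A e))\<^sup>2)"
    using e by (simp add: hnorm_sq)
qed

lemma trace_abs_sq_has_sum:
  assumes "adjoint_pair A S" "((\<lambda>e. (hnorm H (A e))\<^sup>2) has_sum s) onb"
  shows "trace_abs_sq H A = ennreal s"
  unfolding trace_abs_sq_eq[OF assms(1)]
  by (rule infsumI) (rule has_sum_ennreal[OF assms(2)], simp)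

lemma hs_norm_has_sum:
  assumes "adjoint_pair A S" "trace_abs_sq H A < \<infinity>"
  shows "((\<lambda>e. (hnorm H (A e))\<^sup>2) has_sum (hs_norm H A)\<^sup>2) onb"
  using has_sum_of_infsum_ennreal[of "\<lambda>e. (hnorm H (A e))\<^sup>2" onb] assms
  by (simp add: hs_norm_def trace_abs_sq_eq[OF assms(1)])

text \<open>Half of the basis independence of the Hilbert--Schmidt norm. The numbers |\<langle>A f,
  e\<rangle>|^2 are summed over \<open>e\<close> by Parseval and, after passing to the adjoint, over
  \<open>f\<close> by Bessel.\<close>

lemma adjoint_finite_sum_le:
  assumes A: "adjoint_pair A S" and F: "finite F" "orthonormal F"
    and M: "\<And>G. finite G \<Longrightarrow> G \<subseteq> onb \<Longrightarrow> (\<Sum>e\<in>G. (hnorm H (S e))\<^sup>2) \<le> M"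
  shows "(\<Sum>f\<in>F. (hnorm H (A f))\<^sup>2) \<le> M"
proof -
  have Fc: "f \<in> car" if "f \<in> F" for f using F that by (auto simp: orthonormal_def)
  have "((\<lambda>e. \<Sum>f\<in>F. (cmod (hip H (A f) e))\<^sup>2) has_sum (\<Sum>f\<in>F. (hnorm H (A f))\<^sup>2)) onb"
    by (intro has_sum_sum Parseval adjoint_pair_mem[OF A] Fc)
  then show ?thesis
  proof (rule has_sum_le_finite_sums)
    fix G assume G: "finite G" "G \<subseteq> onb"
    have "(\<Sum>e\<in>G. \<Sum>f\<in>F. (cmod (hip H (A f) e))\<^sup>2) \<le> (\<Sum>e\<in>G. (hnorm H (S e))\<^sup>2)"
    proof (rule sum_mono)
      fix e assume "e \<in> G"
      then have e: "e \<in> car" using G onb_mem by blast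
      have "cmod (hip H (A f) e) = cmod (hip H (S e) f)" if "f \<in> F" for f
        using A e Fc[OF that] ip_cnj[of f "S e"] adjoint_pair_mem[OF adjoint_pair_sym[OF A] e]
        by (simp add: adjoint_pair_def)
      then have "(\<Sum>f\<in>F. (cmod (hip H (A f) e))\<^sup>2) = (\<Sum>f\<in>F. (cmod (hip H (S e) f))\<^sup>2)"
        by simp
      also have "\<dots> \<le> (hnorm H (S e))\<^sup>2"
        using Bessel_finite[OF F(2,1) order_refl] adjoint_pair_mem[OF adjoint_pair_sym[OF A] e] .
      finally show "(\<Sum>f\<in>F. (cmod (hip H (A f) e))\<^sup>2) \<le> (hnorm H (S e))\<^sup>2" .
    qed
    also have "\<dots> \<le> M" by (rule M[OF G])
    finally show "(\<Sum>e\<in>G. \<Sum>f\<in>F. (cmod (hip H (A f) e))\<^sup>2) \<le> M" .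
  qed
qed

lemma orthonormal_subset: "orthonormal B \<Longrightarrow> F \<subseteq> B \<Longrightarrow> orthonormal F"
  unfolding orthonormal_def by blast

text \<open>\<open>adjoint_finite_sum_le\<close> used twice, from \<open>A\<close> on
  \<open>F\<close> to \<open>S\<close> on \<open>onb\<close> and back to \<open>A\<close> on
  \<open>onb\<close>. It makes the bound available on translates of basis vectors.\<close>

lemma hs_finite_sum_le:
  assumes A: "adjoint_pair A S" and s: "((\<lambda>e. (hnorm H (A e))\<^sup>2) has_sum s) onb"
    and F: "finite F" "orthonormal F"
  shows "(\<Sum>f\<in>F. (hnorm H (A f))\<^sup>2) \<le> s"
proof (rule adjoint_finite_sum_le[OF A F])
  fix G assume G: "finite G" "G \<subseteq> onb"
  show "(\<Sum>e\<in>G. (hnorm H (S e))\<^sup>2) \<le> s"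
  proof (rule adjoint_finite_sum_le[OF adjoint_pair_sym[OF A] G(1) orthonormal_subset[OF orthonormal_onb G(2)]])
    fix G' assume "finite G'" "G' \<subseteq> onb"
    then show "(\<Sum>e\<in>G'. (hnorm H (A e))\<^sup>2) \<le> s"
      by (intro finite_sum_le_has_sum[OF s]) auto
  qed
qed

text \<open>The element \<Sum> a_i \<otimes> cnj b_i of H \<otimes> cnj H, read as an
  operator.\<close>

definition finrank :: "'i set \<Rightarrow> ('i \<Rightarrow> 'h) \<Rightarrow> ('i \<Rightarrow> 'h) \<Rightarrow> 'h \<Rightarrow> 'h"
  where "finrank I a b v = (\<Sum>i\<in>I. hip H v (b i) *\<^sub>C a i)"

lemma finrank_mem [simp, intro]: "(\<And>i. i \<in> I \<Longrightarrow> a i \<in> car) \<Longrightarrow> finrank I a b v \<in> car"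
  by (simp add: finrank_def)

lemma ip_finrank_left:
  assumes "\<And>i. i \<in> I \<Longrightarrow> a i \<in> car" "w \<in> car"
  shows "hip H (finrank I a b v) w = (\<Sum>i\<in>I. hip H v (b i) * hip H (a i) w)"
  using assms by (simp add: finrank_def ip_sum_left ip_scale)

lemma ip_finrank_right:
  assumes "\<And>i. i \<in> I \<Longrightarrow> a i \<in> car" "w \<in> car"
  shows "hip H w (finrank I a b v) = (\<Sum>i\<in>I. cnj (hip H v (b i)) * hip H w (a i))"
  using assms by (simp add: finrank_def ip_sum_right ip_scale_right)

lemma adjoint_pair_finrank:
  assumes "\<And>i. i \<in> I \<Longrightarrow> a i \<in> car" "\<And>i. i \<in> I \<Longrightarrow> b i \<in> car"
  shows "adjoint_pair (finrank I a b) (finrank I b a)"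
  unfolding adjoint_pair_def
proof (intro conjI ballI)
  fix v w assume vw: "v \<in> car" "w \<in> car"
  have "hip H (finrank I a b v) w = (\<Sum>i\<in>I. hip H v (b i) * hip H (a i) w)"
    using vw assms by (simp add: ip_finrank_left)
  also have "\<dots> = (\<Sum>i\<in>I. cnj (hip H w (a i)) * hip H v (b i))"
    using vw assms ip_cnj[of w] by (intro sum.cong) (auto simp: mult.commute)
  also have "\<dots> = hip H v (finrank I b a w)"
    using vw assms by (simp add: ip_finrank_right)
  finally show "hip H (finrank I a b v) w = hip H v (finrank I b a w)" .
qed (use assms in auto)

text \<open>For rank one operators the Hilbert--Schmidt inner product is \<langle>a, a'\<rangle>
  times the conjugate of \<langle>b, b'\<rangle>: in each term the sum over the basis is
  \<open>Parseval_ip\<close> for \<open>b' j\<close> and \<open>b i\<close>.\<close>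

lemma finrank_has_sum:
  assumes a: "\<And>i. i \<in> I \<Longrightarrow> a i \<in> car" "\<And>i. i \<in> I \<Longrightarrow> b i \<in> car"
    and a': "\<And>j. j \<in> J \<Longrightarrow> a' j \<in> car" "\<And>j. j \<in> J \<Longrightarrow> b' j \<in> car"
  shows "((\<lambda>e. hip H (finrank I a b e) (finrank J a' b' e)) has_sum
    (\<Sum>i\<in>I. \<Sum>j\<in>J. hip H (a i) (a' j) * cnj (hip H (b i) (b' j)))) onb"
proof -
  have 1: "((\<lambda>e. \<Sum>i\<in>I. \<Sum>j\<in>J. hip H (a i) (a' j) * (hip H (b' j) e * hip H e (b i))) has_sum
    (\<Sum>i\<in>I. \<Sum>j\<in>J. hip H (a i) (a' j) * hip H (b' j) (b i))) onb"
    using a a' by (intro has_sum_sum has_sum_cmult_right Parseval_ip) auto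
  have 2: "(\<Sum>i\<in>I. \<Sum>j\<in>J. hip H (a i) (a' j) * (hip H (b' j) e * hip H e (b i)))
     = hip H (finrank I a b e) (finrank J a' b' e)" if "e \<in> onb" for e
  proof -
    have e: "e \<in> car" using onb_mem that .
    have "hip H (finrank I a b e) (finrank J a' b' e)
      = (\<Sum>i\<in>I. hip H e (b i) * (\<Sum>j\<in>J. cnj (hip H e (b' j)) * hip H (a i) (a' j)))"
      using a a' by (subst ip_finrank_left) (auto simp: ip_finrank_right[of J a'])
    also have "\<dots> = (\<Sum>i\<in>I. \<Sum>j\<in>J. hip H (a i) (a' j) * (hip H (b' j) e * hip H e (b i)))"
      unfolding sum_distrib_left using a' e ip_cnj[OF e]
      by (intro sum.cong) (auto simp: mult_ac)
    finally show ?thesis by simp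
  qed
  have 3: "(\<Sum>i\<in>I. \<Sum>j\<in>J. hip H (a i) (a' j) * hip H (b' j) (b i))
     = (\<Sum>i\<in>I. \<Sum>j\<in>J. hip H (a i) (a' j) * cnj (hip H (b i) (b' j)))"
    using a(2) a'(2) by (intro sum.cong arg_cong2[where f = "(*)"] ip_cnj refl) auto
  show ?thesis using 1 unfolding 3 by (rule has_sum_cong[THEN iffD1, rotated]) (rule 2)
qed

end

section \<open>Unitary representations of groups\<close>

context hilbert_space
begin

text \<open>The inner product in H \<otimes> cnj H of two sums of elementary tensors; by
  \<open>finrank_has_sum\<close> it is the Hilbert--Schmidt inner product of the corresponding
  operators.\<close>

definition tensor_ip :: "'i set \<Rightarrow> ('i \<Rightarrow> 'h) \<Rightarrow> ('i \<Rightarrow> 'h) \<Rightarrow> ('i \<Rightarrow> 'h) \<Rightarrow> ('i \<Rightarrow> 'h) \<Rightarrow> complex"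
  where "tensor_ip I a b a' b' = (\<Sum>i\<in>I. \<Sum>j\<in>I. hip H (a i) (a' j) * cnj (hip H (b i) (b' j)))"

lemma tensor_ip_has_sum:
  assumes "a \<in> I \<rightarrow> car" "b \<in> I \<rightarrow> car" "a' \<in> I \<rightarrow> car" "b' \<in> I \<rightarrow> car"
  shows "((\<lambda>e. hip H (finrank I a b e) (finrank I a' b' e)) has_sum tensor_ip I a b a' b') onb"
  unfolding tensor_ip_def using assms by (intro finrank_has_sum) auto

lemma tensor_ip_self_has_sum:
  assumes "a \<in> I \<rightarrow> car" "b \<in> I \<rightarrow> car"
  shows "((\<lambda>e. (hnorm H (finrank I a b e))\<^sup>2) has_sum Re (tensor_ip I a b a b)) onb"
  using has_sum_Re[OF tensor_ip_has_sum[OF assms assms]] assms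
  by (subst has_sum_cong[where g = "\<lambda>e. Re (hip H (finrank I a b e) (finrank I a b e))"])
    (auto simp: hnorm_sq Pi_iff)

text \<open>Cauchy--Schwarz with the arithmetic mean in place of the geometric one. In this form it
  holds for each basis vector and can be summed, and nothing is lost for tensors of equal
  norm.\<close>

lemma cmod_tensor_ip_le:
  assumes "a \<in> I \<rightarrow> car" "b \<in> I \<rightarrow> car" "a' \<in> I \<rightarrow> car" "b' \<in> I \<rightarrow> car"
  shows "cmod (tensor_ip I a b a' b') \<le> (Re (tensor_ip I a b a b) + Re (tensor_ip I a' b' a' b')) * (1/2)"
proof (rule norm_infsum_le[OF tensor_ip_has_sum[OF assms]])
  show "((\<lambda>e. ((hnorm H (finrank I a b e))\<^sup>2 + (hnorm H (finrank I a' b' e))\<^sup>2) * (1/2)) has_sum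
     (Re (tensor_ip I a b a b) + Re (tensor_ip I a' b' a' b')) * (1/2)) onb"
    using assms by (intro has_sum_cmult_left has_sum_add tensor_ip_self_has_sum)
  fix e assume "e \<in> onb"
  have m: "finrank I a b e \<in> car" "finrank I a' b' e \<in> car" using assms by (auto simp: Pi_iff)
  have "0 \<le> (hnorm H (finrank I a b e) - hnorm H (finrank I a' b' e))\<^sup>2" by simp
  then show "cmod (hip H (finrank I a b e) (finrank I a' b' e))
      \<le> ((hnorm H (finrank I a b e))\<^sup>2 + (hnorm H (finrank I a' b' e))\<^sup>2) * (1/2)"
    using Cauchy_Schwarz[OF m] by (simp add: power2_diff)
qed

end

locale unitary_rep = group \<Gamma> + hilbert_space H
  for \<Gamma> :: "('g, 'm) monoid_scheme" (structure) and H :: "'h::complex_vector hspace" +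
  fixes U :: "'g \<Rightarrow> 'h \<Rightarrow> 'h"
  assumes U_mem [simp, intro]: "\<lbrakk>g \<in> carrier \<Gamma>; v \<in> hcar H\<rbrakk> \<Longrightarrow> U g v \<in> hcar H"
    and U_add: "\<lbrakk>g \<in> carrier \<Gamma>; v \<in> hcar H; w \<in> hcar H\<rbrakk> \<Longrightarrow> U g (v + w) = U g v + U g w"
    and U_scale: "\<lbrakk>g \<in> carrier \<Gamma>; v \<in> hcar H\<rbrakk> \<Longrightarrow> U g (c *\<^sub>C v) = c *\<^sub>C U g v"
    and U_ip: "\<lbrakk>g \<in> carrier \<Gamma>; v \<in> hcar H; w \<in> hcar H\<rbrakk> \<Longrightarrow> hip H (U g v) (U g w) = hip H v w"
    and U_one: "v \<in> hcar H \<Longrightarrow> U \<one> v = v"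
    and U_mult: "\<lbrakk>g \<in> carrier \<Gamma>; h \<in> carrier \<Gamma>; v \<in> hcar H\<rbrakk> \<Longrightarrow> U (g \<otimes> h) v = U g (U h v)"
begin

lemma U_zero: "g \<in> carrier \<Gamma> \<Longrightarrow> U g 0 = 0"
  using U_scale[of g 0 0] by simp

lemma U_sum:
  assumes "g \<in> carrier \<Gamma>" "\<And>i. i \<in> I \<Longrightarrow> f i \<in> car"
  shows "U g (sum f I) = (\<Sum>i\<in>I. U g (f i))"
  using assms by (induct I rule: infinite_finite_induct) (auto simp: U_zero U_add)

lemma U_inv_U: "g \<in> carrier \<Gamma> \<Longrightarrow> v \<in> car \<Longrightarrow> U (inv g) (U g v) = v"
  using U_mult[of "inv g" g v] by (simp add: U_one)

lemma U_U_inv: "g \<in> carrier \<Gamma> \<Longrightarrow> v \<in> car \<Longrightarrow> U g (U (inv g) v) = v"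
  using U_mult[of g "inv g" v] by (simp add: U_one)

lemma ip_U_left: "\<lbrakk>g \<in> carrier \<Gamma>; v \<in> car; w \<in> car\<rbrakk> \<Longrightarrow> hip H (U g v) w = hip H v (U (inv g) w)"
  using U_ip[of g v "U (inv g) w"] by (simp add: U_U_inv)

lemma hnorm_U [simp]: "\<lbrakk>g \<in> carrier \<Gamma>; v \<in> car\<rbrakk> \<Longrightarrow> hnorm H (U g v) = hnorm H v"
  by (simp add: hnorm_def U_ip)

text \<open>Unitarity collects the group elements on one side, so coefficients of combinations of
  orbit vectors reduce to those of the \<open>x i\<close> at shifted elements. The formula with the
  same scalars holds in every representation, which allows approximations to be transported.\<close>

lemma ip_orbit_combination:
  assumes P: "P \<subseteq> I \<times> carrier \<Gamma>" and x: "x \<in> I \<rightarrow> car" and g: "g \<in> carrier \<Gamma>"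
  shows "hip H (U g (\<Sum>p\<in>P. a p *\<^sub>C U (snd p) (x (fst p)))) (\<Sum>q\<in>P. b q *\<^sub>C U (snd q) (x (fst q)))
    = (\<Sum>p\<in>P. \<Sum>q\<in>P. a p * cnj (b q) * hip H (U (inv (snd q) \<otimes> g \<otimes> snd p) (x (fst p))) (x (fst q)))"
proof -
  have m: "snd p \<in> carrier \<Gamma>" "x (fst p) \<in> car" if "p \<in> P" for p
    using that P x by (auto simp: Pi_iff)
  have 1: "hip H (U g (U (snd p) (x (fst p)))) (U (snd q) (x (fst q)))
      = hip H (U (inv (snd q) \<otimes> g \<otimes> snd p) (x (fst p))) (x (fst q))" if "p \<in> P" "q \<in> P" for p q
  proof -
    have "hip H (U (inv (snd q) \<otimes> g \<otimes> snd p) (x (fst p))) (x (fst q))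
      = hip H (U (inv (snd q)) (U g (U (snd p) (x (fst p))))) (x (fst q))"
      using m[OF that(1)] m[OF that(2)] g by (simp add: U_mult)
    then show ?thesis
      using m[OF that(1)] m[OF that(2)] g ip_U_left[of "inv (snd q)"] by simp
  qed
  have "hip H (U g (\<Sum>p\<in>P. a p *\<^sub>C U (snd p) (x (fst p)))) (\<Sum>q\<in>P. b q *\<^sub>C U (snd q) (x (fst q)))
    = (\<Sum>p\<in>P. a p * hip H (U g (U (snd p) (x (fst p)))) (\<Sum>q\<in>P. b q *\<^sub>C U (snd q) (x (fst q))))"
    using m g by (simp add: U_sum U_scale ip_sum_left ip_scale)
  also have "\<dots> = (\<Sum>p\<in>P. a p * (\<Sum>q\<in>P. cnj (b q) * hip H (U g (U (snd p) (x (fst p)))) (U (snd q) (x (fst q)))))"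
    using m g by (intro sum.cong refl arg_cong2[where f = "(*)"]) (simp add: ip_sum_right ip_scale_right)
  also have "\<dots> = (\<Sum>p\<in>P. \<Sum>q\<in>P. a p * cnj (b q) * hip H (U (inv (snd q) \<otimes> g \<otimes> snd p) (x (fst p))) (x (fst q)))"
    unfolding sum_distrib_left using 1 by (intro sum.cong refl) (simp add: mult.assoc)
  finally show ?thesis .
qed

text \<open>The matrix coefficient of U \<otimes> cnj U at \<Sum> a_i \<otimes> cnj b_i, that is,
  the coefficient of the conjugation action at the operator \<open>finrank I a b\<close>.\<close>

definition tensor_coeff :: "'i set \<Rightarrow> ('i \<Rightarrow> 'h) \<Rightarrow> ('i \<Rightarrow> 'h) \<Rightarrow> 'g \<Rightarrow> complex"
  where "tensor_coeff I a b g = tensor_ip I (\<lambda>i. U g (a i)) (\<lambda>i. U g (b i)) a b"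

lemma tensor_coeff_one:
  assumes "a \<in> I \<rightarrow> car" "b \<in> I \<rightarrow> car"
  shows "tensor_coeff I a b \<one> = tensor_ip I a b a b"
  using assms unfolding tensor_coeff_def tensor_ip_def by (auto intro!: sum.cong simp: U_one Pi_iff)

text \<open>A positive definite function is bounded by its value at the identity, because
  translation by \<open>g\<close> preserves the norm of the tensor.\<close>

lemma cmod_tensor_coeff_le:
  assumes a: "a \<in> I \<rightarrow> car" and b: "b \<in> I \<rightarrow> car" and g: "g \<in> carrier \<Gamma>"
  shows "cmod (tensor_coeff I a b g) \<le> Re (tensor_coeff I a b \<one>)"
proof -
  have "tensor_ip I (\<lambda>i. U g (a i)) (\<lambda>i. U g (b i)) (\<lambda>i. U g (a i)) (\<lambda>i. U g (b i)) = tensor_ip I a b a b"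
    using a b g unfolding tensor_ip_def by (auto intro!: sum.cong simp: U_ip Pi_iff)
  then show ?thesis
    using cmod_tensor_ip_le[of "\<lambda>i. U g (a i)" I "\<lambda>i. U g (b i)" a b] a b g
    unfolding tensor_coeff_one[OF a b] by (auto simp: tensor_coeff_def Pi_iff)
qed

end

lemma sum_list_sum: "(\<Sum>x\<leftarrow>xs. \<Sum>p\<in>P. f p x) = (\<Sum>p\<in>P. \<Sum>x\<leftarrow>xs. f p x)"
  for f :: "'p \<Rightarrow> 'x \<Rightarrow> 'a::comm_monoid_add"
  by (induct xs) (auto simp: sum.distrib)

text \<open>Each term of the sum satisfies \<open>Re (tensor_coeff I \<alpha> \<beta> g) \<le> Re (tensor_coeff I \<alpha> \<beta> \<one>)\<close>, so the total
  defect over \<open>F\<close> being small forces it to be small for one of the terms.\<close>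

lemma (in unitary_rep) tensor_coeff_selection:
  assumes As: "\<And>\<alpha>. \<alpha> \<in> set As \<Longrightarrow> \<alpha> \<in> I \<rightarrow> car" and Bs: "\<And>\<beta>. \<beta> \<in> set Bs \<Longrightarrow> \<beta> \<in> I \<rightarrow> car"
    and F: "finite F" "F \<subseteq> carrier \<Gamma>" and \<kappa>: "\<kappa> > 0" and \<delta>: "\<delta> * (2 * real (card F) + \<kappa>) \<le> \<kappa>"
    and near: "\<And>g. g \<in> insert \<one> F \<Longrightarrow> cmod ((\<Sum>i\<in>I. \<Sum>j\<in>I. (\<Sum>\<alpha>\<leftarrow>As. hip H (U g (\<alpha> i)) (\<alpha> j)) *
      cnj (\<Sum>\<beta>\<leftarrow>Bs. hip H (U g (\<beta> i)) (\<beta> j))) - 1) < \<delta>"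
  obtains \<alpha> \<beta> where "\<alpha> \<in> I \<rightarrow> car" "\<beta> \<in> I \<rightarrow> car" "0 < Re (tensor_coeff I \<alpha> \<beta> \<one>)"
    "\<And>g. g \<in> F \<Longrightarrow> Re (tensor_coeff I \<alpha> \<beta> \<one>) - Re (tensor_coeff I \<alpha> \<beta> g) < \<kappa> * Re (tensor_coeff I \<alpha> \<beta> \<one>)"
proof -
  let ?R = "\<lambda>\<alpha> \<beta> g. Re (tensor_coeff I \<alpha> \<beta> g)"
  \<comment> \<open>Multiplying out the two list sums turns the approximating quantity into a sum of
    coefficients over all pairs of families.\<close>
  define \<Psi> where "\<Psi> g = (\<Sum>\<alpha>\<leftarrow>As. \<Sum>\<beta>\<leftarrow>Bs. tensor_coeff I \<alpha> \<beta> g)" for g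
  have \<Psi>: "\<Psi> g = (\<Sum>i\<in>I. \<Sum>j\<in>I. (\<Sum>\<alpha>\<leftarrow>As. hip H (U g (\<alpha> i)) (\<alpha> j)) * cnj (\<Sum>\<beta>\<leftarrow>Bs. hip H (U g (\<beta> i)) (\<beta> j)))" for g
  proof -
    have "(\<Sum>\<alpha>\<leftarrow>As. f \<alpha>) * cnj (\<Sum>\<beta>\<leftarrow>Bs. h \<beta>) = (\<Sum>\<alpha>\<leftarrow>As. \<Sum>\<beta>\<leftarrow>Bs. f \<alpha> * cnj (h \<beta>))" for f h :: "_ \<Rightarrow> complex"
    proof -
      have "cnj (\<Sum>\<beta>\<leftarrow>Bs. h \<beta>) = (\<Sum>\<beta>\<leftarrow>Bs. cnj (h \<beta>))" by (induct Bs) auto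
      then show ?thesis by (simp add: sum_list_const_mult sum_list_mult_const)
    qed
    then show ?thesis
      unfolding \<Psi>_def tensor_coeff_def tensor_ip_def by (simp add: sum_list_sum)
  qed
  \<comment> \<open>The sum of \<open>t\<close> over all pairs is less than 2 \<delta> card F -
    \<kappa> (1 - \<delta>), which the hypothesis on \<delta> makes nonpositive; so \<open>t\<close>
    is negative for some pair.\<close>
  define t where "t \<alpha> \<beta> = (\<Sum>g\<in>F. ?R \<alpha> \<beta> \<one> - ?R \<alpha> \<beta> g) - \<kappa> * ?R \<alpha> \<beta> \<one>" for \<alpha> \<beta>
  have Re\<Psi>: "Re (\<Psi> g) = (\<Sum>\<alpha>\<leftarrow>As. \<Sum>\<beta>\<leftarrow>Bs. ?R \<alpha> \<beta> g)" for g
  proof -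
    have Re_list: "Re (\<Sum>x\<leftarrow>xs. f x) = (\<Sum>x\<leftarrow>xs. Re (f x))" for f :: "'z \<Rightarrow> complex" and xs
      by (induct xs) auto
    show ?thesis unfolding \<Psi>_def Re_list ..
  qed
  have "(\<Sum>\<alpha>\<leftarrow>As. \<Sum>\<beta>\<leftarrow>Bs. t \<alpha> \<beta>) = (\<Sum>g\<in>F. Re (\<Psi> \<one>) - Re (\<Psi> g)) - \<kappa> * Re (\<Psi> \<one>)"
    unfolding t_def Re\<Psi> by (simp add: sum_list_subtractf sum_list_sum sum_list_const_mult)
  moreover have "(\<Sum>g\<in>F. Re (\<Psi> \<one>) - Re (\<Psi> g)) \<le> (\<Sum>g\<in>F. 2 * \<delta>)"
  proof (rule sum_mono)
    fix g assume "g \<in> F"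
    then have "\<bar>Re (\<Psi> \<one> - 1)\<bar> < \<delta>" "\<bar>Re (\<Psi> g - 1)\<bar> < \<delta>"
      using near[of \<one>] near[of g] abs_Re_le_cmod[of "\<Psi> \<one> - 1"] abs_Re_le_cmod[of "\<Psi> g - 1"]
      unfolding \<Psi>[symmetric] by auto
    then show "Re (\<Psi> \<one>) - Re (\<Psi> g) \<le> 2 * \<delta>" by simp
  qed
  moreover have "\<kappa> * (1 - \<delta>) < \<kappa> * Re (\<Psi> \<one>)"
  proof -
    have "\<bar>Re (\<Psi> \<one> - 1)\<bar> < \<delta>"
      using near[of \<one>] abs_Re_le_cmod[of "\<Psi> \<one> - 1"] unfolding \<Psi>[symmetric] by auto
    then show ?thesis using \<kappa> by simp
  qed
  moreover have "(\<Sum>g\<in>F. 2 * \<delta>) - \<kappa> * (1 - \<delta>) \<le> 0"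
    using \<delta> by (simp add: algebra_simps)
  ultimately have neg: "(\<Sum>\<alpha>\<leftarrow>As. \<Sum>\<beta>\<leftarrow>Bs. t \<alpha> \<beta>) < 0" by linarith
  have "\<exists>\<alpha>\<in>set As. \<exists>\<beta>\<in>set Bs. t \<alpha> \<beta> < 0"
  proof (rule ccontr)
    assume "\<not> ?thesis"
    then have "0 \<le> (\<Sum>\<alpha>\<leftarrow>As. \<Sum>\<beta>\<leftarrow>Bs. t \<alpha> \<beta>)"
      by (intro sum_list_nonneg) (auto intro!: sum_list_nonneg simp: not_less)
    then show False using neg by simp
  qed
  then obtain \<alpha> \<beta> where ab: "\<alpha> \<in> set As" "\<beta> \<in> set Bs" and t: "t \<alpha> \<beta> < 0" by blast
  have m: "\<alpha> \<in> I \<rightarrow> car" "\<beta> \<in> I \<rightarrow> car" using As Bs ab by auto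
  have le: "?R \<alpha> \<beta> g \<le> ?R \<alpha> \<beta> \<one>" if "g \<in> F" for g
    using cmod_tensor_coeff_le[OF m, of g] F that complex_Re_le_cmod[of "tensor_coeff I \<alpha> \<beta> g"] by auto
  have less: "?R \<alpha> \<beta> \<one> - ?R \<alpha> \<beta> g < \<kappa> * ?R \<alpha> \<beta> \<one>" if "g \<in> F" for g
  proof -
    have "?R \<alpha> \<beta> \<one> - ?R \<alpha> \<beta> g \<le> (\<Sum>g\<in>F. ?R \<alpha> \<beta> \<one> - ?R \<alpha> \<beta> g)"
      using F le that by (intro member_le_sum) auto
    then show ?thesis using t by (simp add: t_def)
  qed
  have "0 \<le> (\<Sum>g\<in>F. ?R \<alpha> \<beta> \<one> - ?R \<alpha> \<beta> g)" using le by (intro sum_nonneg) auto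
  then have "0 < \<kappa> * ?R \<alpha> \<beta> \<one>" using t unfolding t_def by linarith
  then have "0 < ?R \<alpha> \<beta> \<one>" using \<kappa> by (simp add: zero_less_mult_iff)
  then show ?thesis using that m less by blast
qed

section \<open>Weak containment\<close>

text \<open>Weak containment for representations of a discrete group, whose compact sets are the
  finite ones. Lists allow repeated vectors, and adding approximants amounts to
  concatenation.\<close>

locale weakly_contained_reps =
  P: unitary_rep \<Gamma> H U + R: unitary_rep \<Gamma> L V
  for \<Gamma> :: "('g, 'm) monoid_scheme" (structure)
    and H :: "'h::complex_vector hspace" and U :: "'g \<Rightarrow> 'h \<Rightarrow> 'h"
    and L :: "'k::complex_vector hspace" and V :: "'g \<Rightarrow> 'k \<Rightarrow> 'k" +
  assumes weak_containment: "\<lbrakk>v \<in> hcar H; finite F; F \<subseteq> carrier \<Gamma>; \<epsilon> > 0\<rbrakk> \<Longrightarrow>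
    \<exists>As. set As \<subseteq> hcar L \<and> (\<forall>g\<in>F. cmod (hip H (U g v) v - (\<Sum>\<beta>\<leftarrow>As. hip L (V g \<beta>) \<beta>)) < \<epsilon>)"
begin

text \<open>The matrix form of weak containment: one list of families has to serve all pairs
  \<open>i\<close>, \<open>j\<close> at once.\<close>

definition approximable :: "'i set \<Rightarrow> ('i \<Rightarrow> 'h) \<Rightarrow> 'g set \<Rightarrow> real \<Rightarrow> bool"
  where "approximable I x F \<epsilon> \<longleftrightarrow> (\<exists>As. (\<forall>\<alpha>\<in>set As. \<alpha> \<in> I \<rightarrow> hcar L) \<and>
    (\<forall>g\<in>F. \<forall>i\<in>I. \<forall>j\<in>I. cmod (hip H (U g (x i)) (x j) - (\<Sum>\<alpha>\<leftarrow>As. hip L (V g (\<alpha> i)) (\<alpha> j))) < \<epsilon>))"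

lemma approximable_mono: "approximable I x F \<epsilon> \<Longrightarrow> \<epsilon> \<le> \<epsilon>' \<Longrightarrow> approximable I x F \<epsilon>'"
  unfolding approximable_def by (meson less_le_trans)

text \<open>The approximating families undergo the same combination \<open>c\<close> as the vectors;
  by \<open>ip_orbit_combination\<close> the error for \<open>y\<close> is then a combination of
  errors for \<open>x\<close>.\<close>

lemma approximable_orbit_span:
  assumes good: "\<And>F \<epsilon>. finite F \<Longrightarrow> F \<subseteq> carrier \<Gamma> \<Longrightarrow> \<epsilon> > 0 \<Longrightarrow> approximable I x F \<epsilon>"
    and x: "x \<in> I \<rightarrow> hcar H" and J: "finite J" and P: "finite P" "P \<subseteq> I \<times> carrier \<Gamma>"
    and y: "\<And>j. j \<in> J \<Longrightarrow> y j = (\<Sum>p\<in>P. c j p *\<^sub>C U (snd p) (x (fst p)))"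
    and F: "finite F" "F \<subseteq> carrier \<Gamma>" and \<epsilon>: "\<epsilon> > 0"
  shows "approximable J y F \<epsilon>"
proof -
  define C where "C = 1 + (\<Sum>j\<in>J. \<Sum>p\<in>P. cmod (c j p))"
  have C1: "C \<ge> 1" by (simp add: C_def sum_nonneg)
  have C: "(\<Sum>p\<in>P. cmod (c j p)) \<le> C" if "j \<in> J" for j
  proof -
    have "(\<Sum>p\<in>P. cmod (c j p)) \<le> (\<Sum>j\<in>J. \<Sum>p\<in>P. cmod (c j p))"
      using J that by (intro member_le_sum) (auto intro: sum_nonneg)
    then show ?thesis by (simp add: C_def)
  qed
  \<comment> \<open>The errors for \<open>x\<close> are weighted by products of two scalars, with
    total weight at most C^2, so that their sum is at most \<epsilon> / 2.\<close>
  define \<delta> where "\<delta> = \<epsilon> / (2 * C\<^sup>2)"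
  have \<delta>: "\<delta> > 0" using \<epsilon> C1 by (simp add: \<delta>_def)
  \<comment> \<open>The shifted elements that occur in \<open>ip_orbit_combination\<close>.\<close>
  define F' where "F' = (\<lambda>(g, p, q). inv (snd q) \<otimes> g \<otimes> snd p) ` (F \<times> P \<times> P)"
  have Pm: "fst p \<in> I" "snd p \<in> carrier \<Gamma>" if "p \<in> P" for p using P that by auto
  have "finite F'" "F' \<subseteq> carrier \<Gamma>" using F P Pm by (auto simp: F'_def subset_iff)
  then have "approximable I x F' \<delta>" using \<delta> by (rule good)
  then obtain As where As: "\<And>\<alpha>. \<alpha> \<in> set As \<Longrightarrow> \<alpha> \<in> I \<rightarrow> hcar L"
    and near: "\<And>g i j. \<lbrakk>g \<in> F'; i \<in> I; j \<in> I\<rbrakk> \<Longrightarrow>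
      cmod (hip H (U g (x i)) (x j) - (\<Sum>\<alpha>\<leftarrow>As. hip L (V g (\<alpha> i)) (\<alpha> j))) < \<delta>"
    unfolding approximable_def by blast
  define T where "T \<alpha> j = (\<Sum>p\<in>P. c j p *\<^sub>C V (snd p) (\<alpha> (fst p)))" for \<alpha> :: "'a \<Rightarrow> 'k" and j
  have "cmod (hip H (U g (y i)) (y j) - (\<Sum>\<alpha>\<leftarrow>As. hip L (V g (T \<alpha> i)) (T \<alpha> j))) < \<epsilon>"
    if g: "g \<in> F" and i: "i \<in> J" and j: "j \<in> J" for g i j
  proof -
    have gc: "g \<in> carrier \<Gamma>" using F g by auto
    let ?h = "\<lambda>p q. inv (snd q) \<otimes> g \<otimes> snd p"
    have 1: "hip H (U g (y i)) (y j) = (\<Sum>p\<in>P. \<Sum>q\<in>P. c i p * cnj (c j q) * hip H (U (?h p q) (x (fst p))) (x (fst q)))"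
      unfolding y[OF i] y[OF j] by (rule P.ip_orbit_combination[OF P(2) x gc])
    have "(\<Sum>\<alpha>\<leftarrow>As. hip L (V g (T \<alpha> i)) (T \<alpha> j))
      = (\<Sum>\<alpha>\<leftarrow>As. \<Sum>p\<in>P. \<Sum>q\<in>P. c i p * cnj (c j q) * hip L (V (?h p q) (\<alpha> (fst p))) (\<alpha> (fst q)))"
      unfolding T_def using As by (intro arg_cong[where f = sum_list] map_cong refl R.ip_orbit_combination[OF P(2) _ gc])
    also have "\<dots> = (\<Sum>p\<in>P. \<Sum>q\<in>P. c i p * cnj (c j q) * (\<Sum>\<alpha>\<leftarrow>As. hip L (V (?h p q) (\<alpha> (fst p))) (\<alpha> (fst q))))"
      by (simp add: sum_list_sum sum_list_const_mult)
    finally have "hip H (U g (y i)) (y j) - (\<Sum>\<alpha>\<leftarrow>As. hip L (V g (T \<alpha> i)) (T \<alpha> j))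
      = (\<Sum>p\<in>P. \<Sum>q\<in>P. c i p * cnj (c j q) * (hip H (U (?h p q) (x (fst p))) (x (fst q))
          - (\<Sum>\<alpha>\<leftarrow>As. hip L (V (?h p q) (\<alpha> (fst p))) (\<alpha> (fst q)))))"
      unfolding 1 by (simp add: sum_subtractf right_diff_distrib)
    also have "cmod \<dots> \<le> (\<Sum>p\<in>P. \<Sum>q\<in>P. cmod (c i p) * cmod (c j q) * \<delta>)"
    proof (intro sum_norm_le)
      fix p q assume pq: "p \<in> P" "q \<in> P"
      have "?h p q \<in> F'" using g pq by (force simp: F'_def)
      from near[OF this Pm(1)[OF pq(1)] Pm(1)[OF pq(2)]]
      show "cmod (c i p * cnj (c j q) * (hip H (U (?h p q) (x (fst p))) (x (fst q))
          - (\<Sum>\<alpha>\<leftarrow>As. hip L (V (?h p q) (\<alpha> (fst p))) (\<alpha> (fst q))))) \<le> cmod (c i p) * cmod (c j q) * \<delta>"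
        by (simp add: norm_mult mult_left_mono)
    qed
    also have "\<dots> = (\<Sum>p\<in>P. cmod (c i p)) * (\<Sum>q\<in>P. cmod (c j q)) * \<delta>"
      by (simp only: sum_product) (simp only: sum_distrib_right)
    also have "\<dots> \<le> C * C * \<delta>"
      using C[OF i] C[OF j] C1 \<delta> by (intro mult_right_mono mult_mono) (auto intro: sum_nonneg)
    also have "\<dots> = \<epsilon> / 2" using C1 by (simp add: \<delta>_def power2_eq_square)
    also have "\<dots> < \<epsilon>" using \<epsilon> by simp
    finally show ?thesis .
  qed
  moreover have "T \<alpha> \<in> J \<rightarrow> hcar L" if "\<alpha> \<in> set As" for \<alpha>
    using As[OF that] Pm unfolding T_def by (intro Pi_I R.sum_mem R.scale_mem R.U_mem) (auto simp: Pi_iff)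
  ultimately show ?thesis
    unfolding approximable_def by (intro exI[of _ "map T As"]) (simp add: comp_def)
qed

text \<open>Concatenated lists reproduce the two diagonal blocks and contribute nothing to the cross
  terms, which therefore have to be small in the given representation.\<close>

lemma approximable_add:
  assumes x: "x \<in> I \<rightarrow> hcar H" and y: "y \<in> I \<rightarrow> hcar H" and F: "F \<subseteq> carrier \<Gamma>"
    and ax: "approximable I x F \<epsilon>\<^sub>1" and ay: "approximable I y F \<epsilon>\<^sub>2"
    and cross: "\<And>g i j. \<lbrakk>g \<in> F; i \<in> I; j \<in> I\<rbrakk> \<Longrightarrow> cmod (hip H (U g (x i)) (y j)) \<le> \<delta>"
      "\<And>g i j. \<lbrakk>g \<in> F; i \<in> I; j \<in> I\<rbrakk> \<Longrightarrow> cmod (hip H (U g (y i)) (x j)) \<le> \<delta>"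
  shows "approximable I (\<lambda>i. x i + y i) F (\<epsilon>\<^sub>1 + \<epsilon>\<^sub>2 + 2 * \<delta>)"
proof -
  obtain As where As: "\<And>\<alpha>. \<alpha> \<in> set As \<Longrightarrow> \<alpha> \<in> I \<rightarrow> hcar L" "\<And>g i j. \<lbrakk>g \<in> F; i \<in> I; j \<in> I\<rbrakk> \<Longrightarrow>
      cmod (hip H (U g (x i)) (x j) - (\<Sum>\<alpha>\<leftarrow>As. hip L (V g (\<alpha> i)) (\<alpha> j))) < \<epsilon>\<^sub>1"
    using ax unfolding approximable_def by blast
  obtain Bs where Bs: "\<And>\<alpha>. \<alpha> \<in> set Bs \<Longrightarrow> \<alpha> \<in> I \<rightarrow> hcar L" "\<And>g i j. \<lbrakk>g \<in> F; i \<in> I; j \<in> I\<rbrakk> \<Longrightarrow>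
      cmod (hip H (U g (y i)) (y j) - (\<Sum>\<alpha>\<leftarrow>Bs. hip L (V g (\<alpha> i)) (\<alpha> j))) < \<epsilon>\<^sub>2"
    using ay unfolding approximable_def by blast
  have "cmod (hip H (U g (x i + y i)) (x j + y j) - (\<Sum>\<alpha>\<leftarrow>As @ Bs. hip L (V g (\<alpha> i)) (\<alpha> j)))
      < \<epsilon>\<^sub>1 + \<epsilon>\<^sub>2 + 2 * \<delta>" if gij: "g \<in> F" "i \<in> I" "j \<in> I" for g i j
  proof -
    let ?a = "hip H (U g (x i)) (x j) - (\<Sum>\<alpha>\<leftarrow>As. hip L (V g (\<alpha> i)) (\<alpha> j))"
    let ?b = "hip H (U g (y i)) (y j) - (\<Sum>\<alpha>\<leftarrow>Bs. hip L (V g (\<alpha> i)) (\<alpha> j))"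
    have "hip H (U g (x i + y i)) (x j + y j) - (\<Sum>\<alpha>\<leftarrow>As @ Bs. hip L (V g (\<alpha> i)) (\<alpha> j))
      = ?a + ?b + hip H (U g (x i)) (y j) + hip H (U g (y i)) (x j)"
      using gij x y F by (simp add: Pi_iff subset_iff P.U_add P.ip_add P.ip_add_right)
    also have "cmod \<dots> \<le> cmod ?a + cmod ?b + cmod (hip H (U g (x i)) (y j)) + cmod (hip H (U g (y i)) (x j))"
      by (intro norm_triangle_le add_right_mono norm_triangle_ineq)
    finally show ?thesis
      using As(2)[OF gij] Bs(2)[OF gij] cross(1)[OF gij] cross(2)[OF gij] by linarith
  qed
  moreover have "\<alpha> \<in> I \<rightarrow> hcar L" if "\<alpha> \<in> set (As @ Bs)" for \<alpha>
    using that As(1)[of \<alpha>] Bs(1)[of \<alpha>] unfolding set_append by blast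
  ultimately show ?thesis unfolding approximable_def by blast
qed

text \<open>In the induction step the new vector \<open>x k\<close> is split as \<open>p + q\<close>, with \<open>p\<close> an almost closest point
  of the span of the orbits of the old vectors; \<open>q\<close> is then almost orthogonal to that span, so
  the two parts can be approximated separately.\<close>

lemma approximable_family:
  assumes "finite I" "x \<in> I \<rightarrow> hcar H" "finite F" "F \<subseteq> carrier \<Gamma>" "\<epsilon> > 0"
  shows "approximable I x F \<epsilon>"
  using assms
\<comment> \<open>\<open>F\<close> and \<epsilon> must vary, because passing to orbit combinations
  calls for the hypothesis at shifted group elements and with a smaller error.\<close>
proof (induct I arbitrary: F \<epsilon> rule: finite_induct)
  case empty
  then show ?case by (simp add: approximable_def)
next
  case (insert k I)
  define f where "f p = U (snd p) (x (fst p))" for p :: "'a \<times> 'g"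
  \<comment> \<open>The algebraic span, not its closure: its elements are finite combinations, as
    \<open>approximable_orbit_span\<close> requires. A closest point may then fail to exist.\<close>
  define W where "W = cvec.span (f ` (I \<times> carrier \<Gamma>))"
  have xI: "x \<in> I \<rightarrow> hcar H" and xk: "x k \<in> hcar H" using insert.prems by auto
  have xm: "x i \<in> hcar H" if "i \<in> I" for i using xI that by auto
  have fm: "f p \<in> hcar H" if "p \<in> I \<times> carrier \<Gamma>" for p
    using that xI by (auto simp: f_def Pi_iff)
  have Wm: "w \<in> hcar H" if "w \<in> W" for w
    using cvec.span_minimal[of "f ` (I \<times> carrier \<Gamma>)" "hcar H"] P.subspace fm that by (auto simp: W_def)
  have Wsub: "cvec.subspace W" by (simp add: W_def)
  have expl: "\<exists>P c. finite P \<and> P \<subseteq> I \<times> carrier \<Gamma> \<and> w = (\<Sum>p\<in>P. c p *\<^sub>C f p)" if w: "w \<in> W" for w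
  proof -
    obtain t r where t: "finite t" "t \<subseteq> f ` (I \<times> carrier \<Gamma>)" "w = (\<Sum>a\<in>t. r a *\<^sub>C a)"
      using w unfolding W_def cvec.span_explicit by blast
    \<comment> \<open>Different pairs may give the same orbit vector. A set of pairs on which
      \<open>f\<close> is injective turns the sum over vectors into a sum over pairs.\<close>
    then obtain P where P: "P \<subseteq> I \<times> carrier \<Gamma>" "inj_on f P" "t = f ` P"
      by (meson subset_image_inj)
    then have "w = (\<Sum>p\<in>P. r (f p) *\<^sub>C f p)" "finite P"
      using t by (auto simp: sum.reindex finite_image_iff)
    then show ?thesis using P(1) by (intro exI[of _ P] exI[of _ "\<lambda>p. r (f p)"]) auto
  qed
  have UW: "U g w \<in> W" if g: "g \<in> carrier \<Gamma>" and w: "w \<in> W" for g w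
  proof -
    obtain P c where P: "P \<subseteq> I \<times> carrier \<Gamma>" "w = (\<Sum>p\<in>P. c p *\<^sub>C f p)" using expl[OF w] by blast
    have "U g (c p *\<^sub>C f p) \<in> W" if "p \<in> P" for p
    proof -
      have p: "fst p \<in> I" "snd p \<in> carrier \<Gamma>" using P that by auto
      then have "U g (f p) = f (fst p, g \<otimes> snd p)"
        using g funcset_mem[OF xI, of "fst p"] by (simp add: f_def P.U_mult)
      moreover have "f (fst p, g \<otimes> snd p) \<in> W"
        unfolding W_def using p g by (intro cvec.span_base imageI) auto
      moreover have "f p \<in> hcar H" using fm P(1) that by blast
      ultimately show ?thesis
        using g by (simp add: P.U_scale cvec.subspace_scale[OF Wsub])
    qed
    then have "(\<Sum>p\<in>P. U g (c p *\<^sub>C f p)) \<in> W" by (rule cvec.subspace_sum[OF Wsub])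
    moreover have "U g w = (\<Sum>p\<in>P. U g (c p *\<^sub>C f p))"
      unfolding P(2) using P(1) fm by (intro P.U_sum[OF g]) auto
    ultimately show ?thesis by simp
  qed
  \<comment> \<open>Bounds the norms of the old vectors and of \<open>p\<close>, the latter being at
    most twice the norm of \<open>x k\<close> plus \<delta>.\<close>
  define M where "M = 2 * hnorm H (x k) + 2 + (\<Sum>i\<in>I. hnorm H (x i))"
  have M2: "M \<ge> 2 + 2 * hnorm H (x k)" using xI by (auto simp: M_def Pi_iff intro!: sum_nonneg)
  have M: "M > 0" using M2 P.hnorm_nonneg[OF xk] by linarith
  \<comment> \<open>The bound 1 keeps the norm of \<open>p\<close> within \<open>M\<close>; the
    other bound makes each cross term at most \<epsilon> / 6.\<close>
  define \<delta> where "\<delta> = min 1 (\<epsilon> / (6 * M))"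
  have \<delta>: "\<delta> > 0" "\<delta> \<le> 1" "\<delta> * M \<le> \<epsilon> / 6"
  proof -
    show "\<delta> > 0" using insert.prems M by (simp add: \<delta>_def)
    have "\<delta> * M \<le> \<epsilon> / (6 * M) * M" using M by (intro mult_right_mono) (auto simp: \<delta>_def)
    then show "\<delta> * M \<le> \<epsilon> / 6" using M by simp
  qed (simp add: \<delta>_def)
  define d where "d = Inf ((\<lambda>w. (hnorm H (x k - w))\<^sup>2) ` W)"
  have W0: "0 \<in> W" using Wsub by (simp add: cvec.subspace_0)
  have bdd: "bdd_below ((\<lambda>w. (hnorm H (x k - w))\<^sup>2) ` W)" by (rule bdd_belowI[of _ 0]) auto
  have d_le: "d \<le> (hnorm H (x k - w))\<^sup>2" if "w \<in> W" for w
    unfolding d_def using bdd that by (intro cInf_lower) auto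
  have "\<exists>s\<in>(\<lambda>w. (hnorm H (x k - w))\<^sup>2) ` W. s < d + \<delta>\<^sup>2"
    using W0 \<delta> by (intro cInf_lessD) (auto simp: d_def[symmetric])
  then obtain p where p: "p \<in> W" "(hnorm H (x k - p))\<^sup>2 < d + \<delta>\<^sup>2" by blast
  define q where "q = x k - p"
  have pm: "p \<in> hcar H" using Wm p by blast
  have qm: "q \<in> hcar H" using pm xk by (simp add: q_def)
  have orth: "cmod (hip H q w) \<le> \<delta> * hnorm H w" if w: "w \<in> W" for w
  proof (rule power2_le_imp_le)
    have "(cmod (hip H q w))\<^sup>2 \<le> ((hnorm H q)\<^sup>2 - d) * (hnorm H w)\<^sup>2"
    proof (rule P.cmod_ip_sq_le[OF qm Wm[OF w]])
      fix t
      have "p + t *\<^sub>C w \<in> W"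
        using p w Wsub by (simp add: cvec.subspace_add cvec.subspace_scale)
      from d_le[OF this] show "d \<le> (hnorm H (q - t *\<^sub>C w))\<^sup>2"
        by (simp add: q_def diff_diff_eq)
    qed
    also have "\<dots> \<le> \<delta>\<^sup>2 * (hnorm H w)\<^sup>2"
      using p by (intro mult_right_mono) (auto simp: q_def)
    finally show "(cmod (hip H q w))\<^sup>2 \<le> (\<delta> * hnorm H w)\<^sup>2" by (simp add: power_mult_distrib)
  qed (use \<delta>(1) Wm[OF w] in simp)
  have "hnorm H p \<le> M"
  proof -
    have sq_add: "a\<^sup>2 + b\<^sup>2 \<le> (a + b)\<^sup>2" if "0 \<le> a" "0 \<le> b" for a b :: real
      using that by (simp add: power2_sum)
    have q1: "(hnorm H q)\<^sup>2 \<le> (hnorm H (x k))\<^sup>2 + \<delta>\<^sup>2" using p d_le[OF W0] by (simp add: q_def)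
    have q2: "(hnorm H (x k))\<^sup>2 + \<delta>\<^sup>2 \<le> (hnorm H (x k) + \<delta>)\<^sup>2" by (rule sq_add) (use \<delta>(1) P.hnorm_nonneg[OF xk] in simp_all)
    have "hnorm H q \<le> hnorm H (x k) + \<delta>"
      using \<delta>(1) P.hnorm_nonneg[OF xk] by (intro power2_le_imp_le[OF order_trans[OF q1 q2]]) linarith
    moreover have "hnorm H p \<le> hnorm H (x k) + hnorm H q"
    proof -
      have "p = x k + - q" by (simp add: q_def)
      then show ?thesis
        using P.hnorm_triangle[OF xk P.uminus_mem[OF qm]] P.hnorm_uminus[OF qm] by metis
    qed
    ultimately show ?thesis using M2 \<delta>(2) by linarith
  qed
  define x' where "x' i = (if i = k then p else x i)" for i
  define y' where "y' i = (if i = k then q else 0)" for i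
  have x'W: "x' i \<in> W" and x'M: "hnorm H (x' i) \<le> M" if "i \<in> insert k I" for i
  proof -
    have "x i \<in> W" if "i \<in> I"
    proof -
      have "f (i, \<one>) = x i" using funcset_mem[OF xI that] by (simp add: f_def P.U_one)
      moreover have "f (i, \<one>) \<in> f ` (I \<times> carrier \<Gamma>)" using that by (intro imageI) simp
      ultimately show ?thesis unfolding W_def by (metis cvec.span_base)
    qed
    moreover have "hnorm H (x i) \<le> M" if "i \<in> I"
    proof -
      have "hnorm H (x i) \<le> (\<Sum>i\<in>I. hnorm H (x i))"
        using that insert.hyps(1) by (intro member_le_sum P.hnorm_nonneg xm) auto
      then show ?thesis using P.hnorm_nonneg[OF xk] by (simp add: M_def)
    qed
    ultimately show "x' i \<in> W" "hnorm H (x' i) \<le> M"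
      using that p \<open>hnorm H p \<le> M\<close> by (auto simp: x'_def)
  qed
  have ax: "approximable (insert k I) x' F (\<epsilon> / 3)"
  proof -
    obtain P c where P: "finite P" "P \<subseteq> I \<times> carrier \<Gamma>" "p = (\<Sum>p\<in>P. c p *\<^sub>C f p)"
      using expl[OF p(1)] by blast
    \<comment> \<open>Pairs with the identity are added, so that \<open>p\<close> and the old
      vectors are combinations over one index set.\<close>
    define Q where "Q = P \<union> (\<lambda>i. (i, \<one>)) ` I"
    define b where "b j r = (if j = k then if r \<in> P then c r else 0 else if r = (j, \<one>) then 1 else 0)"
      for j r
    have Q: "finite Q" "Q \<subseteq> I \<times> carrier \<Gamma>" using P insert.hyps by (auto simp: Q_def)
    have scale_if: "(if C then a else 0) *\<^sub>C v = (if C then a *\<^sub>C v else 0)" for C a and v :: 'h by simp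
    have "x' j = (\<Sum>r\<in>Q. b j r *\<^sub>C f r)" if j: "j \<in> insert k I" for j
    proof (cases "j = k")
      case True
      have "(\<Sum>r\<in>Q. b j r *\<^sub>C f r) = (\<Sum>r\<in>Q. if r \<in> P then c r *\<^sub>C f r else 0)"
        using True by (simp add: b_def scale_if)
      also have "\<dots> = (\<Sum>r\<in>P. c r *\<^sub>C f r)"
        using Q by (simp add: sum.If_cases Q_def Int_absorb1 Int_Un_distrib2)
      finally show ?thesis using True P by (simp add: x'_def)
    next
      case False
      have "(\<Sum>r\<in>Q. b j r *\<^sub>C f r) = (\<Sum>r\<in>Q. if r = (j, \<one>) then f r else 0)"
        using False by (intro sum.cong) (auto simp: b_def scaleC_one)
      also have "\<dots> = f (j, \<one>)" using Q(1) False j by (simp add: Q_def)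
      finally show ?thesis using False j xm[of j] by (auto simp: x'_def f_def P.U_one)
    qed
    then show ?thesis
      using insert.hyps insert.prems xI Q unfolding f_def
      by (intro approximable_orbit_span[of I x "insert k I" Q x' b]) auto
  qed
  \<comment> \<open>Only the entry at \<open>k\<close>, \<open>k\<close> of the matrix of
    \<open>y'\<close> can be nonzero, so weak containment for the single vector \<open>q\<close>
    suffices.\<close>
  have ay: "approximable (insert k I) y' F (\<epsilon> / 3)"
  proof -
    obtain As where As: "set As \<subseteq> hcar L" "\<And>g. g \<in> F \<Longrightarrow> cmod (hip H (U g q) q - (\<Sum>\<beta>\<leftarrow>As. hip L (V g \<beta>) \<beta>)) < \<epsilon> / 3"
      using weak_containment[OF qm, of F "\<epsilon> / 3"] insert.prems by auto
    define T where "T \<beta> i = (if i = k then \<beta> else 0)" for \<beta> :: 'k and i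
    have "cmod (hip H (U g (y' i)) (y' j) - (\<Sum>\<beta>\<leftarrow>As. hip L (V g (T \<beta> i)) (T \<beta> j))) < \<epsilon> / 3"
      if g: "g \<in> F" for g i j
    proof (cases "i = k \<and> j = k")
      case True
      then show ?thesis using As(2)[OF g] by (simp add: y'_def T_def)
    next
      case False
      have gc: "g \<in> carrier \<Gamma>" using g insert.prems by blast
      have "hip L (V g (T \<beta> i)) (T \<beta> j) = 0" if "\<beta> \<in> set As" for \<beta>
        using False gc that As(1) by (auto simp: T_def R.U_zero)
      then have "(\<Sum>\<beta>\<leftarrow>As. hip L (V g (T \<beta> i)) (T \<beta> j)) = (\<Sum>\<beta>\<leftarrow>As. 0)"
        by (intro arg_cong[where f = sum_list] map_cong refl)
      moreover have "hip H (U g (y' i)) (y' j) = 0"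
        using False gc qm by (auto simp: y'_def P.U_zero)
      ultimately show ?thesis using insert.prems by simp
    qed
    then show ?thesis
      unfolding approximable_def using As(1)
      by (intro exI[of _ "map T As"]) (auto simp: T_def comp_def)
  qed
  have cross: "cmod (hip H (U g (x' i)) (y' j)) \<le> \<epsilon> / 6" "cmod (hip H (U g (y' i)) (x' j)) \<le> \<epsilon> / 6"
    if "g \<in> F" "i \<in> insert k I" "j \<in> insert k I" for g i j
  proof -
    have g: "g \<in> carrier \<Gamma>" using that insert.prems by blast
    have orthM: "cmod (hip H q (U h (x' l))) \<le> \<epsilon> / 6" if "h \<in> carrier \<Gamma>" "l \<in> insert k I" for h l
    proof -
      have "cmod (hip H q (U h (x' l))) \<le> \<delta> * hnorm H (x' l)"
        using orth[OF UW[OF that(1) x'W[OF that(2)]]] that x'W Wm by simp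
      also have "\<dots> \<le> \<delta> * M" using x'M[OF that(2)] \<delta> by (intro mult_left_mono) auto
      finally show ?thesis using \<delta> by linarith
    qed
    have x'm: "x' l \<in> hcar H" if "l \<in> insert k I" for l using x'W Wm that by blast
    have "cmod (hip H (U g (x' i)) q) = cmod (hip H q (U g (x' i)))"
      using P.ip_cnj[OF qm, of "U g (x' i)"] g x'm that by simp
    then show "cmod (hip H (U g (x' i)) (y' j)) \<le> \<epsilon> / 6"
      using orthM[OF g that(2)] insert.prems(4) x'm[OF that(2)] g by (auto simp: y'_def)
    show "cmod (hip H (U g (y' i)) (x' j)) \<le> \<epsilon> / 6"
      using orthM[of "inv g" j] g that insert.prems(4) x'm[OF that(3)] P.ip_U_left[OF g qm x'm[OF that(3)]]
      by (auto simp: y'_def P.U_zero)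
  qed
  have "x' \<in> insert k I \<rightarrow> hcar H" using x'W Wm by blast
  moreover have "y' \<in> insert k I \<rightarrow> hcar H" using qm by (auto simp: y'_def)
  ultimately have "approximable (insert k I) (\<lambda>i. x' i + y' i) F (\<epsilon> / 3 + \<epsilon> / 3 + 2 * (\<epsilon> / 6))"
    using insert.prems(3) ax ay cross by (rule approximable_add)
  moreover have "(\<lambda>i. x' i + y' i) = x" by (auto simp: x'_def y'_def q_def)
  ultimately show ?case by (simp add: approximable_mono)
qed

text \<open>For \<open>x\<close> and for \<open>y\<close> a sequence of approximations of increasing
  accuracy is taken. The sums of products then converge, which replaces an error estimate for
  products, and \<open>tensor_coeff_selection\<close> is applied to a late member.\<close>

lemma tensor_coeff_transfer:
  assumes I: "finite I" and x: "x \<in> I \<rightarrow> hcar H" and y: "y \<in> I \<rightarrow> hcar H"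
    and F: "finite F" "F \<subseteq> carrier \<Gamma>" and \<kappa>: "\<kappa> > 0" and \<delta>: "\<delta> * (2 * real (card F) + \<kappa>) \<le> \<kappa>"
    and near: "\<And>g. g \<in> insert \<one> F \<Longrightarrow> cmod (P.tensor_coeff I x y g - 1) < \<delta>"
  obtains \<alpha> \<beta> where "\<alpha> \<in> I \<rightarrow> hcar L" "\<beta> \<in> I \<rightarrow> hcar L" "0 < Re (R.tensor_coeff I \<alpha> \<beta> \<one>)"
    "\<And>g. g \<in> F \<Longrightarrow> Re (R.tensor_coeff I \<alpha> \<beta> \<one>) - Re (R.tensor_coeff I \<alpha> \<beta> g) < \<kappa> * Re (R.tensor_coeff I \<alpha> \<beta> \<one>)"
proof -
  have F1: "finite (insert \<one> F)" "insert \<one> F \<subseteq> carrier \<Gamma>" using F by auto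
  define lim where "lim x As \<longleftrightarrow> (\<forall>n. \<forall>\<alpha>\<in>set (As n). \<alpha> \<in> I \<rightarrow> hcar L) \<and>
    (\<forall>g\<in>insert \<one> F. \<forall>i\<in>I. \<forall>j\<in>I. (\<lambda>n. \<Sum>\<alpha>\<leftarrow>As n. hip L (V g (\<alpha> i)) (\<alpha> j)) \<longlonglongrightarrow> hip H (U g (x i)) (x j))"
    for x :: "'a \<Rightarrow> 'h" and As :: "nat \<Rightarrow> ('a \<Rightarrow> 'k) list"
  have ex: "\<exists>As. lim x As" if x: "x \<in> I \<rightarrow> hcar H" for x
  proof -
    have "approximable I x (insert \<one> F) (1 / (real n + 1))" for n
      by (rule approximable_family[OF I x F1]) simp
    then have "\<exists>As. \<forall>n. (\<forall>\<alpha>\<in>set (As n). \<alpha> \<in> I \<rightarrow> hcar L) \<and> (\<forall>g\<in>insert \<one> F. \<forall>i\<in>I. \<forall>j\<in>I.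
      cmod (hip H (U g (x i)) (x j) - (\<Sum>\<alpha>\<leftarrow>As n. hip L (V g (\<alpha> i)) (\<alpha> j))) < 1 / (real n + 1))"
      unfolding approximable_def by (intro choice allI)
    then obtain As where As: "\<And>n \<alpha>. \<alpha> \<in> set (As n) \<Longrightarrow> \<alpha> \<in> I \<rightarrow> hcar L" "\<And>n g i j. \<lbrakk>g \<in> insert \<one> F; i \<in> I; j \<in> I\<rbrakk> \<Longrightarrow>
      cmod (hip H (U g (x i)) (x j) - (\<Sum>\<alpha>\<leftarrow>As n. hip L (V g (\<alpha> i)) (\<alpha> j))) < 1 / (real n + 1)"
      by blast
    have "(\<lambda>n. \<Sum>\<alpha>\<leftarrow>As n. hip L (V g (\<alpha> i)) (\<alpha> j)) \<longlonglongrightarrow> hip H (U g (x i)) (x j)"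
      if "g \<in> insert \<one> F" "i \<in> I" "j \<in> I" for g i j
    proof (rule Lim_null[THEN iffD2], rule Lim_null_comparison)
      show "\<forall>\<^sub>F n in sequentially. cmod ((\<Sum>\<alpha>\<leftarrow>As n. hip L (V g (\<alpha> i)) (\<alpha> j)) - hip H (U g (x i)) (x j)) \<le> 1 / (real n + 1)"
        using As(2)[OF that] by (simp add: norm_minus_commute less_imp_le)
      show "(\<lambda>n. 1 / (real n + 1)) \<longlonglongrightarrow> 0"
        using LIMSEQ_inverse_real_of_nat by (simp add: inverse_eq_divide add.commute)
    qed
    then show ?thesis using As(1) unfolding lim_def by blast
  qed
  obtain As Bs where As: "lim x As" and Bs: "lim y Bs" using ex[OF x] ex[OF y] by blast
  have "\<forall>\<^sub>F n in sequentially. \<forall>g\<in>insert \<one> F. cmod ((\<Sum>i\<in>I. \<Sum>j\<in>I. (\<Sum>\<alpha>\<leftarrow>As n. hip L (V g (\<alpha> i)) (\<alpha> j)) *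
      cnj (\<Sum>\<beta>\<leftarrow>Bs n. hip L (V g (\<beta> i)) (\<beta> j))) - 1) < \<delta>"
  proof (rule eventually_ball_finite[OF F1(1)], rule ballI)
    fix g assume g: "g \<in> insert \<one> F"
    have "(\<lambda>n. cmod ((\<Sum>i\<in>I. \<Sum>j\<in>I. (\<Sum>\<alpha>\<leftarrow>As n. hip L (V g (\<alpha> i)) (\<alpha> j)) *
      cnj (\<Sum>\<beta>\<leftarrow>Bs n. hip L (V g (\<beta> i)) (\<beta> j))) - 1)) \<longlonglongrightarrow> cmod (P.tensor_coeff I x y g - 1)"
      unfolding P.tensor_coeff_def P.tensor_ip_def
      using As Bs g unfolding lim_def
      by (intro tendsto_norm tendsto_diff tendsto_const tendsto_sum tendsto_mult tendsto_cnj) blast+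
    then show "\<forall>\<^sub>F n in sequentially. cmod ((\<Sum>i\<in>I. \<Sum>j\<in>I. (\<Sum>\<alpha>\<leftarrow>As n. hip L (V g (\<alpha> i)) (\<alpha> j)) *
      cnj (\<Sum>\<beta>\<leftarrow>Bs n. hip L (V g (\<beta> i)) (\<beta> j))) - 1) < \<delta>"
      using near[OF g] by (rule order_tendstoD)
  qed
  then obtain n where n: "\<And>g. g \<in> insert \<one> F \<Longrightarrow> cmod ((\<Sum>i\<in>I. \<Sum>j\<in>I. (\<Sum>\<alpha>\<leftarrow>As n. hip L (V g (\<alpha> i)) (\<alpha> j)) *
      cnj (\<Sum>\<beta>\<leftarrow>Bs n. hip L (V g (\<beta> i)) (\<beta> j))) - 1) < \<delta>"
    by (auto simp: eventually_sequentially)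
  have AB: "\<And>\<alpha>. \<alpha> \<in> set (As n) \<Longrightarrow> \<alpha> \<in> I \<rightarrow> hcar L" "\<And>\<beta>. \<beta> \<in> set (Bs n) \<Longrightarrow> \<beta> \<in> I \<rightarrow> hcar L"
    using As Bs unfolding lim_def by blast+
  show ?thesis
    by (rule R.tensor_coeff_selection[OF AB F \<kappa> \<delta> n]) (assumption+, rule that)
qed

end

section \<open>The topology of the HLS groupoid\<close>

context approximated_group
begin

abbreviation HLS :: "(enat \<times> 'g set) top_groupoid" where "HLS \<equiv> hls_groupoid \<Gamma> K"
abbreviation kern :: "enat \<Rightarrow> 'g set" where "kern \<equiv> hls_kernel \<Gamma> K"
abbreviation proj :: "enat \<Rightarrow> 'g \<Rightarrow> 'g set" where "proj \<equiv> hls_proj \<Gamma> K"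

text \<open>The unit at level \<open>n\<close>, the identity of a quotient being the kernel
  itself.\<close>

definition pt :: "enat \<Rightarrow> enat \<times> 'g set" where "pt n = (n, kern n)"

lemma kern_normal: "kern n \<lhd> \<Gamma>"
  using K_normal one_is_normal by (cases n) (simp_all add: hls_kernel_def)

lemma proj_one: "proj n \<one> = kern n"
  using kern_normal[of n] by (simp add: hls_proj_def normal_imp_subgroup subgroup.subset)

lemma pt_eq: "pt n = (n, proj n \<one>)"
  by (simp add: pt_def proj_one)

lemma proj_infinity: "g \<in> carrier \<Gamma> \<Longrightarrow> proj \<infinity> g = {g}"
  by (simp add: hls_proj_def hls_kernel_def r_coset_def)

lemma carrier_hls_quotient: "carrier (hls_quotient \<Gamma> K n) = proj n ` carrier \<Gamma>"
  by (auto simp: hls_quotient_def carrier_FactGroup hls_proj_def)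

lemma one_hls_quotient [simp]: "\<one>\<^bsub>hls_quotient \<Gamma> K n\<^esub> = kern n"
  by (simp add: hls_quotient_def)

lemma mult_hls_quotient:
  "g \<in> carrier \<Gamma> \<Longrightarrow> h \<in> carrier \<Gamma> \<Longrightarrow> proj n g \<otimes>\<^bsub>hls_quotient \<Gamma> K n\<^esub> proj n h = proj n (g \<otimes> h)"
  by (simp add: hls_quotient_def hls_proj_def normal.rcos_sum[OF kern_normal])

lemma inv_hls_quotient:
  "g \<in> carrier \<Gamma> \<Longrightarrow> inv\<^bsub>hls_quotient \<Gamma> K n\<^esub> proj n g = proj n (inv g)"
  using normal.inv_FactGroup[OF kern_normal, of "proj n g" n] carrier_hls_quotient[of n]
  by (simp add: hls_quotient_def hls_proj_def normal.rcos_inv[OF kern_normal])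

lemma finite_proj: "finite (proj (enat n) ` carrier \<Gamma>)"
  using K_finite_index[of n] carrier_hls_quotient[of "enat n"]
  by (simp add: hls_quotient_def FactGroup_def hls_kernel_def)

lemma src_HLS [simp]: "src HLS (n, a) = pt n"
  and rng_HLS [simp]: "rng HLS (n, a) = pt n"
  and ginv_HLS: "ginv HLS (n, a) = (n, inv\<^bsub>hls_quotient \<Gamma> K n\<^esub> a)"
  and gmul_HLS: "gmul HLS (n, a) (m, b) = (n, a \<otimes>\<^bsub>hls_quotient \<Gamma> K n\<^esub> b)"
  and units_HLS: "units HLS = range pt"
  and arrows_HLS: "arrows HLS = hls_topology \<Gamma> K"
  by (auto simp: hls_groupoid_def pt_def)

lemma openin_tail:
  assumes "g \<in> carrier \<Gamma>" shows "openin (arrows HLS) {(n, proj n g) | n. enat N < n}"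
  unfolding arrows_HLS hls_topology_def openin_topology_generated_by_iff
  using assms by (intro generate_topology_on.Basis) blast

lemma openin_isolated:
  assumes "g \<in> carrier \<Gamma>" shows "openin (arrows HLS) {(enat n, proj (enat n) g)}"
  unfolding arrows_HLS hls_topology_def openin_topology_generated_by_iff
  using assms by (intro generate_topology_on.Basis) (auto simp: carrier_hls_quotient)

lemma topspace_arrows: "topspace (arrows HLS) = {(n, proj n g) | n g. g \<in> carrier \<Gamma>}"
proof -
  have "topspace (arrows HLS) = \<Union> ({{(enat n, a)} | n a. a \<in> carrier (hls_quotient \<Gamma> K (enat n))} \<union>
     {{(n, proj n g) | n. enat N < n} | g N. g \<in> carrier \<Gamma>})"
    unfolding arrows_HLS hls_topology_def by (rule topology_generated_by_topspace)
  also have "\<dots> = {(n, proj n g) | n g. g \<in> carrier \<Gamma>}"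
  proof (intro equalityI subsetI)
    fix x assume "x \<in> {(n, proj n g) | n g. g \<in> carrier \<Gamma>}"
    then obtain n g where x: "x = (n, proj n g)" "g \<in> carrier \<Gamma>" by blast
    show "x \<in> \<Union> ({{(enat n, a)} | n a. a \<in> carrier (hls_quotient \<Gamma> K (enat n))} \<union>
     {{(n, proj n g) | n. enat N < n} | g N. g \<in> carrier \<Gamma>})"
    proof (cases n)
      case (enat m)
      then show ?thesis using x by (intro UnionI[of "{x}"]) (auto simp: carrier_hls_quotient)
    next
      case infinity
      then show ?thesis using x by (intro UnionI[of "{(n, proj n g) | n. enat 0 < n}"] UnI2 CollectI exI[of _ g] exI[of _ 0] exI[of _ \<infinity>] conjI refl) auto
    qed
  qed (auto simp: carrier_hls_quotient)
  finally show ?thesis .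
qed

text \<open>Over \<infinity> different elements have different cosets, so the only subbasic sets
  containing the point of \<open>g\<close> are tails through the same \<open>g\<close>. The property
  survives finite intersections and arbitrary unions.\<close>

lemma openin_arrows_tail:
  assumes "openin (arrows HLS) W" "(\<infinity>, proj \<infinity> g) \<in> W" "g \<in> carrier \<Gamma>"
  shows "\<exists>N. \<forall>n. enat N < n \<longrightarrow> (n, proj n g) \<in> W"
proof -
  have "generate_topology_on ({{(enat n, a)} | n a. a \<in> carrier (hls_quotient \<Gamma> K (enat n))} \<union>
     {{(n, proj n g) | n. enat N < n} | g N. g \<in> carrier \<Gamma>}) W"
    using assms(1) unfolding arrows_HLS hls_topology_def openin_topology_generated_by_iff .
  then show ?thesis
    using assms(2)
  proof (induct W)
    case (Int a b)
    then obtain M N where "\<forall>n. enat M < n \<longrightarrow> (n, proj n g) \<in> a" "\<forall>n. enat N < n \<longrightarrow> (n, proj n g) \<in> b"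
      by auto
    moreover have "enat M < n \<and> enat N < n" if "enat (max M N) < n" for n
      using that by (cases n) auto
    ultimately show ?case by (intro exI[of _ "max M N"]) blast
  next
    case (UN \<K>)
    then show ?case by blast
  next
    case (Basis s)
    then obtain h N where "h \<in> carrier \<Gamma>" "s = {(n, proj n h) | n. enat N < n}" by auto
    moreover from this have "h = g" using Basis assms(3) by (auto simp: proj_infinity)
    ultimately show ?case by blast
  qed simp
qed

text \<open>Each group element traces a set \<open>W g\<close> through all fibres; these sets are
  open and cover the arrows. Compactness thus bounds the group elements, while no bound on the level
  is needed.\<close>

lemma compactin_arrows_subset:
  assumes "compactin (arrows HLS) L"
  obtains F where "finite F" "F \<subseteq> carrier \<Gamma>" "\<And>x. x \<in> L \<Longrightarrow> \<exists>g\<in>F. \<exists>n. x = (n, proj n g)"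
proof -
  define W where "W g = {(n, proj n g) | n. True}" for g
  have "openin (arrows HLS) (W g)" if g: "g \<in> carrier \<Gamma>" for g
  proof -
    \<comment> \<open>The largest generating tail still misses level 0, whose points are isolated
      and are added separately.\<close>
    have eq: "W g = {(n, proj n g) | n. enat 0 < n} \<union> {(enat 0, proj (enat 0) g)}"
      by (auto simp: W_def zero_enat_def[symmetric])
    show ?thesis unfolding eq by (rule openin_Un[OF openin_tail[OF g] openin_isolated[OF g]])
  qed
  moreover have "L \<subseteq> \<Union> (W ` carrier \<Gamma>)"
    using compactin_subset_topspace[OF assms] unfolding topspace_arrows by (force simp: W_def)
  ultimately obtain \<F> where "finite \<F>" "\<F> \<subseteq> W ` carrier \<Gamma>" "L \<subseteq> \<Union> \<F>"
    using compactinD[OF assms, of "W ` carrier \<Gamma>"] by auto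
  then obtain F where "finite F" "F \<subseteq> carrier \<Gamma>" "L \<subseteq> \<Union> (W ` F)"
    by (metis finite_subset_image)
  then show ?thesis using that by (force simp: W_def)
qed

lemma compactin_finite_arrows:
  assumes "finite F" "F \<subseteq> carrier \<Gamma>"
  shows "compactin (arrows HLS) ((\<lambda>g. (n, proj n g)) ` F)"
  using assms by (intro finite_imp_compactin) (auto simp: topspace_arrows)

lemma continuous_map_arrows_LIMSEQ:
  assumes f: "continuous_map (arrows HLS) euclidean f" and g: "g \<in> carrier \<Gamma>"
  shows "(\<lambda>m. f (enat m, proj (enat m) g)) \<longlonglongrightarrow> f (\<infinity>, proj \<infinity> g)"
proof (rule topological_tendstoI)
  fix S assume S: "open S" "f (\<infinity>, proj \<infinity> g) \<in> S"
  have "openin (arrows HLS) {x \<in> topspace (arrows HLS). f x \<in> S}"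
    using openin_continuous_map_preimage[OF f, of S] S by simp
  moreover have "(\<infinity>, proj \<infinity> g) \<in> {x \<in> topspace (arrows HLS). f x \<in> S}"
    using S g by (auto simp: topspace_arrows)
  ultimately obtain N where "\<forall>n. enat N < n \<longrightarrow> (n, proj n g) \<in> {x \<in> topspace (arrows HLS). f x \<in> S}"
    using openin_arrows_tail[OF _ _ g] by blast
  then show "\<forall>\<^sub>F m in sequentially. f (enat m, proj (enat m) g) \<in> S"
    unfolding eventually_sequentially by (intro exI[of _ "Suc N"]) auto
qed

section \<open>The unit space\<close>

abbreviation HLS_units :: "(enat \<times> 'g set) topology" where "HLS_units \<equiv> unit_space HLS"

lemma topspace_units: "topspace HLS_units = range pt"
  by (auto simp: topspace_arrows units_HLS pt_eq)

lemma pt_mem [intro]: "pt n \<in> topspace HLS_units"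
  unfolding topspace_units by blast

lemma openin_units_isolated: "openin HLS_units {pt (enat n)}"
  using openin_isolated[of \<one> n] unfolding openin_subtopology
  by (intro exI[of _ "{pt (enat n)}"]) (auto simp: units_HLS pt_eq)

lemma openin_units_tail: "openin HLS_units {pt n | n. enat N < n}"
  using openin_tail[of \<one> N] unfolding openin_subtopology
  by (intro exI[of _ "{pt n | n. enat N < n}"]) (auto simp: units_HLS pt_eq)

text \<open>The unit space is the one-point compactification of the discrete naturals, with
  \<infinity> as its only limit point.\<close>

lemma openin_units_iff:
  "openin HLS_units W \<longleftrightarrow> W \<subseteq> range pt \<and> (pt \<infinity> \<in> W \<longrightarrow> (\<exists>N. \<forall>n. enat N < n \<longrightarrow> pt n \<in> W))"
proof
  assume W: "openin HLS_units W"
  then obtain T where T: "openin (arrows HLS) T" "W = T \<inter> units HLS" unfolding openin_subtopology by blast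
  have "\<exists>N. \<forall>n. enat N < n \<longrightarrow> pt n \<in> W" if "pt \<infinity> \<in> W"
    using openin_arrows_tail[OF T(1), of \<one>] that T(2) by (auto simp: pt_eq units_HLS)
  then show "W \<subseteq> range pt \<and> (pt \<infinity> \<in> W \<longrightarrow> (\<exists>N. \<forall>n. enat N < n \<longrightarrow> pt n \<in> W))"
    using T(2) by (auto simp: units_HLS)
next
  assume W: "W \<subseteq> range pt \<and> (pt \<infinity> \<in> W \<longrightarrow> (\<exists>N. \<forall>n. enat N < n \<longrightarrow> pt n \<in> W))"
  show "openin HLS_units W"
  proof (subst openin_subopen, rule ballI)
    fix u assume u: "u \<in> W"
    then obtain n where n: "u = pt n" using W by blast
    show "\<exists>T. openin HLS_units T \<and> u \<in> T \<and> T \<subseteq> W"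
    proof (cases n)
      case (enat m)
      then show ?thesis using openin_units_isolated[of m] u n by (intro exI[of _ "{u}"]) auto
    next
      case infinity
      then obtain N where "\<forall>n. enat N < n \<longrightarrow> pt n \<in> W" using W u n by blast
      then show ?thesis using openin_units_tail[of N] infinity n
        by (intro exI[of _ "{pt n | n. enat N < n}"]) auto
    qed
  qed
qed

lemma units_continuous_iff:
  fixes f :: "enat \<times> 'g set \<Rightarrow> 'b::topological_space"
  shows "continuous_map HLS_units euclidean f \<longleftrightarrow> (\<lambda>m. f (pt (enat m))) \<longlonglongrightarrow> f (pt \<infinity>)"
proof
  assume f: "continuous_map HLS_units euclidean f"
  show "(\<lambda>m. f (pt (enat m))) \<longlonglongrightarrow> f (pt \<infinity>)"
  proof (rule topological_tendstoI)
    fix S assume S: "open S" "f (pt \<infinity>) \<in> S"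
    have "openin HLS_units {x \<in> topspace HLS_units. f x \<in> S}"
      using openin_continuous_map_preimage[OF f, of S] S by simp
    then obtain N where "\<forall>n. enat N < n \<longrightarrow> pt n \<in> {x \<in> topspace HLS_units. f x \<in> S}"
      using S pt_mem unfolding openin_units_iff by blast
    then show "\<forall>\<^sub>F m in sequentially. f (pt (enat m)) \<in> S"
      unfolding eventually_sequentially by (intro exI[of _ "Suc N"]) auto
  qed
next
  assume lim: "(\<lambda>m. f (pt (enat m))) \<longlonglongrightarrow> f (pt \<infinity>)"
  show "continuous_map HLS_units euclidean f"
    unfolding continuous_map_def
  proof (intro conjI allI impI)
    fix S :: "'b set" assume "openin euclidean S"
    then have S: "open S" by simp
    have "\<exists>N. \<forall>n. enat N < n \<longrightarrow> f (pt n) \<in> S" if inf: "f (pt \<infinity>) \<in> S"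
    proof -
      obtain N where N: "\<forall>m\<ge>N. f (pt (enat m)) \<in> S"
        using topological_tendstoD[OF lim S inf] unfolding eventually_sequentially by blast
      have "f (pt n) \<in> S" if "enat N < n" for n
        using N that inf by (cases n) auto
      then show ?thesis by blast
    qed
    then show "openin HLS_units {x \<in> topspace HLS_units. f x \<in> S}"
      unfolding openin_units_iff topspace_units by auto
  qed auto
qed

text \<open>An open set around \<infinity> omits only finitely many points. Compactness makes
  vanishing at infinity automatic, so that \<open>C0_sections\<close> and \<open>Cb_sections\<close>
  both become \<open>csec\<close>.\<close>

lemma compactin_units: "compactin HLS_units (topspace HLS_units)"
  unfolding compactin_def
proof (intro conjI allI impI)
  fix \<U> assume \<U>: "(\<forall>U\<in>\<U>. openin HLS_units U) \<and> topspace HLS_units \<subseteq> \<Union> \<U>"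
  then have "\<forall>n. \<exists>W. W \<in> \<U> \<and> pt n \<in> W" using pt_mem by blast
  then obtain U where U: "\<And>n. U n \<in> \<U>" "\<And>n. pt n \<in> U n" by metis
  obtain N where N: "\<forall>n. enat N < n \<longrightarrow> pt n \<in> U \<infinity>"
    using \<U> U openin_units_iff by blast
  have "pt n \<in> \<Union> (insert (U \<infinity>) (U ` enat ` {..N}))" for n
  proof (cases "enat N < n")
    case True
    then show ?thesis using N by blast
  next
    case False
    then obtain m where "n = enat m" "m \<le> N" by (cases n) auto
    then show ?thesis using U(2)[of n] by blast
  qed
  then show "\<exists>\<F>. finite \<F> \<and> \<F> \<subseteq> \<U> \<and> topspace HLS_units \<subseteq> \<Union> \<F>"
    unfolding topspace_units using U(1) by (intro exI[of _ "insert (U \<infinity>) (U ` enat ` {..N})"]) blast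
qed (rule order_refl)

lemma vanishes_at_infinity_units: "vanishes_at_infinity HLS_units f"
  unfolding vanishes_at_infinity_def using compactin_units by blast

lemma C0_units_iff: "f \<in> C0 HLS_units \<longleftrightarrow> (\<lambda>m. f (pt (enat m))) \<longlonglongrightarrow> f (pt \<infinity>)"
  unfolding C0_def by (simp add: vanishes_at_infinity_units units_continuous_iff del: topspace_subtopology)

end

section \<open>Sections over the unit space\<close>

locale hls_representation =
  approximated_group \<Gamma> K + continuous_unitary_representation "hls_groupoid \<Gamma> K" \<rho>
  for \<Gamma> :: "('g, 'm) monoid_scheme" (structure) and K :: "nat \<Rightarrow> 'g set"
    and \<rho> :: "(enat \<times> 'g set, 'k::complex_vector) representation"
begin

definition fibre :: "enat \<Rightarrow> 'k hspace" where "fibre n = fib \<rho> (pt n)"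

definition U :: "enat \<Rightarrow> 'g \<Rightarrow> 'k \<Rightarrow> 'k" where "U n g = act \<rho> (n, proj n g)"

lemma arrow_mem: "g \<in> carrier \<Gamma> \<Longrightarrow> (n, proj n g) \<in> topspace (arrows HLS)"
  by (auto simp: topspace_arrows)

text \<open>One group acts on all fibres: over a finite level the representation of the quotient is
  pulled back along the projection.\<close>

sublocale rep: unitary_rep \<Gamma> "fibre n" "U n" for n
proof -
  interpret F: hilbert_space "fibre n"
    unfolding fibre_def by (rule fibre_hilbert) (rule pt_mem)
  show "unitary_rep \<Gamma> (fibre n) (U n)"
  proof
    fix g v assume g: "g \<in> carrier \<Gamma>" and v: "v \<in> hcar (fibre n)"
    show "U n g v \<in> hcar (fibre n)"
      using bij_betwE[OF act_bij[OF arrow_mem[OF g, of n]]] v by (simp add: U_def fibre_def)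
    show "U n g (c *\<^sub>C v) = c *\<^sub>C U n g v" for c
      using act_scale[OF arrow_mem[OF g, of n]] v by (simp add: U_def fibre_def)
    fix w assume w: "w \<in> hcar (fibre n)"
    show "U n g (v + w) = U n g v + U n g w"
      using act_add[OF arrow_mem[OF g, of n]] v w by (simp add: U_def fibre_def)
    show "hip (fibre n) (U n g v) (U n g w) = hip (fibre n) v w"
      using act_ip[OF arrow_mem[OF g, of n]] v w by (simp add: U_def fibre_def)
  next
    fix v assume "v \<in> hcar (fibre n)"
    then show "U n \<one> v = v"
      using act_unit[of "pt n" v] by (simp add: U_def fibre_def pt_eq[symmetric] units_HLS)
  next
    fix g h v assume "g \<in> carrier \<Gamma>" "h \<in> carrier \<Gamma>" "v \<in> hcar (fibre n)"
    then show "U n (g \<otimes> h) v = U n g (U n h v)"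
      using act_mul[OF arrow_mem[of g n] arrow_mem[of h n]]
      by (simp add: U_def fibre_def gmul_HLS mult_hls_quotient)
  qed
qed

text \<open>Sections become functions of the level alone; the restriction restores the
  extensionality demanded by \<open>csec_sections\<close>.\<close>

definition sec :: "(enat \<Rightarrow> 'k) \<Rightarrow> enat \<times> 'g set \<Rightarrow> 'k"
  where "sec s = (\<lambda>u\<in>range pt. s (fst u))"

lemma sec_pt [simp]: "sec s (pt n) = s n"
  by (simp add: sec_def pt_def)

definition is_section :: "(enat \<Rightarrow> 'k) \<Rightarrow> bool" where "is_section s \<longleftrightarrow> sec s \<in> csec \<rho>"

lemma sec_csec: "\<xi> \<in> csec \<rho> \<Longrightarrow> sec (\<lambda>n. \<xi> (pt n)) = \<xi>"
  using csec_sections unfolding topspace_units sec_def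
  by (auto simp: fun_eq_iff pt_def restrict_def PiE_def extensional_def)

lemma csec_section: "\<xi> \<in> csec \<rho> \<Longrightarrow> is_section (\<lambda>n. \<xi> (pt n))"
  by (simp add: is_section_def sec_csec)

lemma csec_mem: "\<xi> \<in> csec \<rho> \<Longrightarrow> \<xi> (pt n) \<in> hcar (fibre n)"
  using csec_sections unfolding topspace_units fibre_def by blast

lemma section_mem: "is_section s \<Longrightarrow> s n \<in> hcar (fibre n)"
  using csec_mem[of "sec s" n] by (simp add: is_section_def)

lemma section_zero: "is_section (\<lambda>n. 0)"
  using csec_zero unfolding is_section_def sec_def topspace_units .

lemma section_add: "is_section s \<Longrightarrow> is_section t \<Longrightarrow> is_section (\<lambda>n. s n + t n)"
  using csec_add[of "sec s" "sec t"] unfolding is_section_def topspace_units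
  by (simp add: sec_def restrict_def cong: if_cong)

lemma section_scale: "is_section s \<Longrightarrow> is_section (\<lambda>n. c *\<^sub>C s n)"
  using csec_scale[of "sec s" c] unfolding is_section_def topspace_units
  by (simp add: sec_def restrict_def cong: if_cong)

lemma section_sum: "(\<And>i. i \<in> I \<Longrightarrow> is_section (s i)) \<Longrightarrow> is_section (\<lambda>n. \<Sum>i\<in>I. s i n)"
  by (induct I rule: infinite_finite_induct) (auto simp: section_zero section_add)

lemma section_dense:
  assumes "v \<in> hcar (fibre n)" "\<epsilon> > 0"
  shows "\<exists>s. is_section s \<and> hnorm (fibre n) (v - s n) < \<epsilon>"
proof -
  interpret M: Metric_space "hcar (fibre n)" "hdist (fibre n)" by (rule rep.Metric_space_car)
  have "v \<in> M.mtopology closure_of ((\<lambda>\<xi>. \<xi> (pt n)) ` csec \<rho>)"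
    using csec_dense[OF pt_mem, of n] assms(1) by (simp add: fibre_def htop_def)
  then obtain \<xi> where "\<xi> \<in> csec \<rho>" "hdist (fibre n) v (\<xi> (pt n)) < \<epsilon>"
    using assms(2) unfolding M.metric_closure_of by auto
  then show ?thesis
    using csec_section csec_mem assms(1) by (intro exI[of _ "\<lambda>n. \<xi> (pt n)"]) (simp add: rep.hdist_eq)
qed

text \<open>Local approximability is a condition at \<infinity> only: the other points are isolated,
  and there \<open>section_dense\<close> supplies a section with a close value.\<close>

lemma sectionI:
  assumes mem: "\<And>n. s n \<in> hcar (fibre n)"
    and approx: "\<And>\<epsilon>. \<epsilon> > 0 \<Longrightarrow> \<exists>t. is_section t \<and> hnorm (fibre \<infinity>) (s \<infinity> - t \<infinity>) \<le> \<epsilon> \<and>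
      (\<forall>\<^sub>F m in sequentially. hnorm (fibre (enat m)) (s (enat m) - t (enat m)) \<le> \<epsilon>)"
  shows "is_section s"
  unfolding is_section_def
proof (rule csec_local)
  show "sec s \<in> (\<Pi>\<^sub>E u\<in>topspace HLS_units. hcar (fib \<rho> u))"
    unfolding topspace_units using mem by (auto simp: sec_def fibre_def pt_def)
  fix u and \<epsilon> :: real assume "u \<in> topspace HLS_units" and \<epsilon>: "\<epsilon> > 0"
  then obtain n where n: "u = pt n" unfolding topspace_units by blast
  have dist: "hdist (fib \<rho> (pt k)) (sec s (pt k)) (sec t (pt k)) = hnorm (fibre k) (s k - t k)"
    if "is_section t" for k t
    using mem section_mem[OF that] by (simp add: fibre_def[symmetric] rep.hdist_eq)
  show "\<exists>\<eta>\<in>csec \<rho>. \<exists>W. openin HLS_units W \<and> u \<in> W \<and> (\<forall>v\<in>W. hdist (fib \<rho> v) (sec s v) (\<eta> v) \<le> \<epsilon>)"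
  proof (cases n)
    case (enat m)
    obtain t where t: "is_section t" "hnorm (fibre n) (s n - t n) < \<epsilon>" using section_dense[OF mem \<epsilon>] by blast
    show ?thesis
    proof (intro bexI[of _ "sec t"] exI[of _ "{pt n}"] conjI ballI)
      fix v assume "v \<in> {pt n}"
      then show "hdist (fib \<rho> v) (sec s v) (sec t v) \<le> \<epsilon>" using dist[OF t(1), of n] t(2) by simp
    qed (use t enat n openin_units_isolated[of m] in \<open>auto simp: is_section_def\<close>)
  next
    case infinity
    obtain t where t: "is_section t" "hnorm (fibre \<infinity>) (s \<infinity> - t \<infinity>) \<le> \<epsilon>"
      "\<forall>\<^sub>F m in sequentially. hnorm (fibre (enat m)) (s (enat m) - t (enat m)) \<le> \<epsilon>"
      using approx[OF \<epsilon>] by blast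
    then obtain N where N: "\<And>m. m \<ge> N \<Longrightarrow> hnorm (fibre (enat m)) (s (enat m) - t (enat m)) \<le> \<epsilon>"
      by (auto simp: eventually_sequentially)
    show ?thesis
    proof (intro bexI[of _ "sec t"] exI[of _ "{pt n | n. enat N < n}"] conjI ballI)
      fix v assume "v \<in> {pt n | n. enat N < n}"
      then obtain k where k: "v = pt k" "enat N < k" by blast
      then have "hnorm (fibre k) (s k - t k) \<le> \<epsilon>" using N t(2) by (cases k) auto
      then show "hdist (fib \<rho> v) (sec s v) (sec t v) \<le> \<epsilon>" using dist[OF t(1), of k] k by simp
    qed (use t infinity n openin_units_tail[of N] in \<open>auto simp: is_section_def\<close>)
  qed
qed

lemma csec_continuous_norm:
  assumes "is_section s"
  shows "(\<lambda>m. hnorm (fibre (enat m)) (s (enat m))) \<longlonglongrightarrow> hnorm (fibre \<infinity>) (s \<infinity>)"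
  using csec_norm[of "sec s"] assms unfolding units_continuous_iff by (simp add: is_section_def fibre_def)

lemma C0_sections_eq: "C0_sections HLS_units \<rho> = csec \<rho>"
  unfolding C0_sections_def using vanishes_at_infinity_units by blast

lemma Cb_sections_eq: "Cb_sections HLS_units \<rho> = csec \<rho>"
proof -
  have "\<exists>M. \<forall>u\<in>topspace HLS_units. hnorm (fib \<rho> u) (\<xi> u) \<le> M" if \<xi>: "\<xi> \<in> csec \<rho>" for \<xi>
  proof -
    have "Bseq (\<lambda>m. hnorm (fibre (enat m)) (\<xi> (pt (enat m))))"
      using csec_continuous_norm[OF csec_section[OF \<xi>]] convergentI convergent_imp_Bseq by blast
    then obtain M where M: "\<And>m. norm (hnorm (fibre (enat m)) (\<xi> (pt (enat m)))) \<le> M"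
      unfolding Bseq_def by blast
    have "hnorm (fibre n) (\<xi> (pt n)) \<le> max M (hnorm (fibre \<infinity>) (\<xi> (pt \<infinity>)))" for n
      using M by (cases n) (auto simp: le_max_iff_disj dest: order_trans[OF abs_ge_self])
    then show ?thesis
      unfolding topspace_units by (auto simp: fibre_def)
  qed
  then show ?thesis unfolding Cb_sections_def by blast
qed

text \<open>The arrows of a fixed \<open>g\<close> over the finite levels converge to its arrow over
  \<infinity>. Through this limit the fibre at \<infinity> controls those at large levels.\<close>

lemma section_coefficient_LIMSEQ:
  assumes s: "is_section s" and t: "is_section t" and g: "g \<in> carrier \<Gamma>"
  shows "(\<lambda>m. hip (fibre (enat m)) (U (enat m) g (s (enat m))) (t (enat m)))
    \<longlonglongrightarrow> hip (fibre \<infinity>) (U \<infinity> g (s \<infinity>)) (t \<infinity>)"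
proof -
  have "continuous_map (arrows HLS) euclidean (coefficient HLS \<rho> (sec s) (sec t))"
    using s t by (intro act_continuous) (auto simp: C0_sections_eq is_section_def)
  from continuous_map_arrows_LIMSEQ[OF this g] show ?thesis
    by (simp add: coefficient_def fibre_def U_def)
qed

lemma section_ip_LIMSEQ:
  assumes s: "is_section s" and t: "is_section t"
  shows "(\<lambda>m. hip (fibre (enat m)) (s (enat m)) (t (enat m))) \<longlonglongrightarrow> hip (fibre \<infinity>) (s \<infinity>) (t \<infinity>)"
  using section_coefficient_LIMSEQ[OF s t one_closed] by (simp add: rep.U_one section_mem[OF s])

text \<open>Values at finitely many isolated points do not affect continuity; this permits a
  different operator over each small level.\<close>

lemma section_eventually:
  assumes mem: "\<And>n. s n \<in> hcar (fibre n)" and t: "is_section t" and inf: "s \<infinity> = t \<infinity>"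
    and ev: "\<forall>\<^sub>F m in sequentially. s (enat m) = t (enat m)"
  shows "is_section s"
proof (rule sectionI[OF mem])
  fix \<epsilon> :: real assume "\<epsilon> > 0"
  then show "\<exists>t. is_section t \<and> hnorm (fibre \<infinity>) (s \<infinity> - t \<infinity>) \<le> \<epsilon> \<and>
      (\<forall>\<^sub>F m in sequentially. hnorm (fibre (enat m)) (s (enat m) - t (enat m)) \<le> \<epsilon>)"
    using t inf ev by (intro exI[of _ t]) (auto elim!: eventually_mono)
qed

lemma section_mult:
  assumes s: "is_section s" and f: "(\<lambda>m. f (enat m)) \<longlonglongrightarrow> f \<infinity>"
  shows "is_section (\<lambda>n. f n *\<^sub>C s n)"
proof (rule sectionI)
  show "f n *\<^sub>C s n \<in> hcar (fibre n)" for n using section_mem[OF s] by simp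
  fix \<epsilon> :: real assume \<epsilon>: "\<epsilon> > 0"
  have dist: "hnorm (fibre n) (f n *\<^sub>C s n - f \<infinity> *\<^sub>C s n) = cmod (f n - f \<infinity>) * hnorm (fibre n) (s n)" for n
    using rep.hnorm_scale[OF section_mem[OF s], of n "f n - f \<infinity>"]
    by (simp add: cvec.scale_left_diff_distrib)
  have "(\<lambda>m. cmod (f (enat m) - f \<infinity>) * hnorm (fibre (enat m)) (s (enat m)))
      \<longlonglongrightarrow> cmod (f \<infinity> - f \<infinity>) * hnorm (fibre \<infinity>) (s \<infinity>)"
    by (intro tendsto_intros f csec_continuous_norm s)
  then have "\<forall>\<^sub>F m in sequentially. cmod (f (enat m) - f \<infinity>) * hnorm (fibre (enat m)) (s (enat m)) < \<epsilon>"
    by (rule order_tendstoD) (use \<epsilon> in simp)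
  then show "\<exists>t. is_section t \<and> hnorm (fibre \<infinity>) (f \<infinity> *\<^sub>C s \<infinity> - t \<infinity>) \<le> \<epsilon> \<and>
      (\<forall>\<^sub>F m in sequentially. hnorm (fibre (enat m)) (f (enat m) *\<^sub>C s (enat m) - t (enat m)) \<le> \<epsilon>)"
    using \<epsilon> dist section_scale[OF s, of "f \<infinity>"]
    by (intro exI[of _ "\<lambda>n. f \<infinity> *\<^sub>C s n"]) (auto elim!: eventually_mono)
qed

text \<open>At \<infinity>, density yields sections close to \<open>v\<close>, not through it. A
  diagonal choice repairs this: over level \<open>m\<close> the section follows the last
  \<open>t k\<close> with k \<le> m that agrees well enough there with all earlier ones.\<close>

lemma section_extend:
  assumes v: "v \<in> hcar (fibre n)"
  shows "\<exists>s. is_section s \<and> s n = v"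
proof (cases n)
  case (enat k)
  have "is_section (\<lambda>m. if m = n then v else 0)"
  proof (rule section_eventually[OF _ section_zero])
    show "\<forall>\<^sub>F m in sequentially. (if enat m = n then v else 0) = 0"
      using enat unfolding eventually_sequentially by (intro exI[of _ "Suc k"]) auto
  qed (use v enat in auto)
  then show ?thesis by (intro exI[of _ "\<lambda>m. if m = n then v else 0"]) simp
next
  case infinity
  define e where "e k = 1 / (real k + 1)" for k
  have e: "e k > 0" for k by (simp add: e_def)
  have e_mono: "e l \<le> e k" if "k \<le> l" for k l using that by (simp add: e_def frac_le)
  have "\<exists>s. is_section s \<and> hnorm (fibre \<infinity>) (v - s \<infinity>) < e k" for k
    using section_dense[OF _ e] v infinity by simp
  then obtain t where t: "\<And>k. is_section (t k)" "\<And>k. hnorm (fibre \<infinity>) (v - t k \<infinity>) < e k" by metis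
  \<comment> \<open>At \<infinity> the values of \<open>t i\<close> and \<open>t k\<close> are
    within \<open>e i\<close> and \<open>e k\<close> of \<open>v\<close>, so the condition holds
    over almost all \<open>m\<close>.\<close>
  define P where "P k m \<longleftrightarrow> (\<forall>i\<le>k. hnorm (fibre (enat m)) (t i (enat m) - t k (enat m)) < e i + e k)" for k m
  have evP: "\<forall>\<^sub>F m in sequentially. P k m" for k
  proof -
    have "\<forall>\<^sub>F m in sequentially. hnorm (fibre (enat m)) (t i (enat m) - t k (enat m)) < e i + e k" for i
    proof -
      have "is_section (\<lambda>n. t i n + (- 1) *\<^sub>C t k n)" using t(1) by (intro section_add section_scale)
      then have "is_section (\<lambda>n. t i n - t k n)" by simp
      moreover have "hnorm (fibre \<infinity>) (t i \<infinity> - t k \<infinity>) < e i + e k"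
        using rep.hnorm_triangle_diff[of "t i \<infinity>" \<infinity> v "t k \<infinity>"] t(2)[of i] t(2)[of k]
          section_mem[OF t(1)] v infinity rep.hnorm_minus_commute[of v \<infinity> "t i \<infinity>"] by simp
      ultimately show ?thesis by (intro order_tendstoD(2)[OF csec_continuous_norm])
    qed
    then have "\<forall>\<^sub>F m in sequentially. \<forall>i\<in>{..k}. hnorm (fibre (enat m)) (t i (enat m) - t k (enat m)) < e i + e k"
      by (intro eventually_ball_finite) auto
    then show ?thesis by (simp add: P_def atMost_def)
  qed
  define \<kappa> where "\<kappa> m = Max {k. k \<le> m \<and> P k m}" for m
  \<comment> \<open>Index 0 always qualifies, being compared only with itself, so the maximum
    exists.\<close>
  have ne: "0 \<in> {k. k \<le> m \<and> P k m}" for m by (simp add: P_def e_def)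
  have fin: "finite {k. k \<le> m \<and> P k m}" for m by (rule finite_subset[of _ "{..m}"]) auto
  have P\<kappa>: "P (\<kappa> m) m" for m
    using Max_in[OF fin, of m] ne[of m] unfolding \<kappa>_def by blast
  have \<kappa>_ge: "k \<le> \<kappa> m" if "k \<le> m" "P k m" for k m
    unfolding \<kappa>_def using that by (intro Max_ge[OF fin]) simp
  define s where "s n = (case n of enat m \<Rightarrow> t (\<kappa> m) n | \<infinity> \<Rightarrow> v)" for n
  have "is_section s"
  proof (rule sectionI)
    show "s n \<in> hcar (fibre n)" for n using section_mem[OF t(1)] v infinity by (cases n) (auto simp: s_def)
    fix \<epsilon> :: real assume \<epsilon>: "\<epsilon> > 0"
    \<comment> \<open>As soon as \<open>\<kappa> m\<close> is at least \<open>k\<close>, the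
      distance to \<open>t k\<close> is below e k + e (\<kappa> m), hence below 2 e k.\<close>
    obtain k where k: "e k < \<epsilon> / 2"
      using nat_approx_posE[of "\<epsilon> / 2"] \<epsilon> by (auto simp: e_def add.commute)
    have "\<forall>\<^sub>F m in sequentially. hnorm (fibre (enat m)) (s (enat m) - t k (enat m)) \<le> \<epsilon>"
      using evP[of k] eventually_ge_at_top[of k]
    proof eventually_elim
      case (elim m)
      then have ge: "k \<le> \<kappa> m" by (intro \<kappa>_ge)
      then have "hnorm (fibre (enat m)) (t k (enat m) - t (\<kappa> m) (enat m)) < e k + e (\<kappa> m)"
        using P\<kappa>[of m] by (simp add: P_def)
      then show ?case
        using e_mono[OF ge] k section_mem[OF t(1)] rep.hnorm_minus_commute[of "t k (enat m)" "enat m" "t (\<kappa> m) (enat m)"]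
        by (simp add: s_def)
    qed
    moreover have "hnorm (fibre \<infinity>) (s \<infinity> - t k \<infinity>) \<le> \<epsilon>"
      using t(2)[of k] k \<epsilon> by (simp add: s_def)
    ultimately show "\<exists>t. is_section t \<and> hnorm (fibre \<infinity>) (s \<infinity> - t \<infinity>) \<le> \<epsilon> \<and>
      (\<forall>\<^sub>F m in sequentially. hnorm (fibre (enat m)) (s (enat m) - t (enat m)) \<le> \<epsilon>)"
      using t(1) by blast
  qed
  then show ?thesis using infinity by (intro exI[of _ s]) (simp add: s_def)
qed

lemma section_finrank:
  assumes a: "\<And>i. i \<in> I \<Longrightarrow> is_section (\<lambda>n. a n i)" and b: "\<And>i. i \<in> I \<Longrightarrow> is_section (\<lambda>n. b n i)" and s: "is_section s"
  shows "is_section (\<lambda>n. rep.finrank n I (a n) (b n) (s n))"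
  unfolding rep.finrank_def using a b s by (intro section_sum section_mult section_ip_LIMSEQ)

section \<open>Adjointable operators and their localizations\<close>

abbreviation loc :: "((enat \<times> 'g set \<Rightarrow> 'k) \<Rightarrow> enat \<times> 'g set \<Rightarrow> 'k) \<Rightarrow> enat \<Rightarrow> 'k \<Rightarrow> 'k"
  where "loc T n \<equiv> localization HLS_units \<rho> T (pt n)"

definition section_adjoint ::
    "((enat \<times> 'g set \<Rightarrow> 'k) \<Rightarrow> enat \<times> 'g set \<Rightarrow> 'k) \<Rightarrow> ((enat \<times> 'g set \<Rightarrow> 'k) \<Rightarrow> enat \<times> 'g set \<Rightarrow> 'k) \<Rightarrow> bool"
  where "section_adjoint T S \<longleftrightarrow> T \<in> csec \<rho> \<rightarrow> csec \<rho> \<and> S \<in> csec \<rho> \<rightarrow> csec \<rho> \<and>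
    (\<forall>\<xi>\<in>csec \<rho>. \<forall>\<eta>\<in>csec \<rho>. \<forall>n. hip (fibre n) (T \<xi> (pt n)) (\<eta> (pt n)) = hip (fibre n) (\<xi> (pt n)) (S \<eta> (pt n)))"

lemma adjointable_iff: "adjointable HLS_units \<rho> T \<longleftrightarrow> (\<exists>S. section_adjoint T S)"
  unfolding adjointable_def C0_sections_eq section_adjoint_def topspace_units fibre_def by auto

lemma section_adjoint_sym:
  assumes "section_adjoint T S" shows "section_adjoint S T"
proof -
  have TS: "T \<in> csec \<rho> \<rightarrow> csec \<rho>" "S \<in> csec \<rho> \<rightarrow> csec \<rho>" using assms by (auto simp: section_adjoint_def)
  have "hip (fibre n) (S \<xi> (pt n)) (\<eta> (pt n)) = hip (fibre n) (\<xi> (pt n)) (T \<eta> (pt n))"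
    if \<xi>: "\<xi> \<in> csec \<rho>" and \<eta>: "\<eta> \<in> csec \<rho>" for \<xi> \<eta> n
  proof -
    have m: "T \<eta> (pt n) \<in> hcar (fibre n)" "S \<xi> (pt n) \<in> hcar (fibre n)"
      using TS \<xi> \<eta> by (auto intro!: csec_mem)
    have "hip (fibre n) (T \<eta> (pt n)) (\<xi> (pt n)) = hip (fibre n) (\<eta> (pt n)) (S \<xi> (pt n))"
      using assms \<xi> \<eta> by (simp add: section_adjoint_def)
    then show ?thesis
      using rep.ip_cnj[OF m(1) csec_mem[OF \<xi>]] rep.ip_cnj[OF csec_mem[OF \<eta>] m(2)] by simp
  qed
  then show ?thesis using TS by (simp add: section_adjoint_def)
qed

lemma section_through:
  assumes "v \<in> hcar (fibre n)"
  shows "\<exists>\<xi>\<in>csec \<rho>. \<xi> (pt n) = v"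
proof -
  obtain s where "is_section s" "s n = v" using section_extend[OF assms] by blast
  then show ?thesis by (intro bexI[of _ "sec s"]) (simp_all add: is_section_def)
qed

text \<open>The value of the image depends only on the value of the section: its inner product with
  any vector, extended to a section, is computed through the adjoint. This makes the description in
  \<open>localization\<close> meaningful.\<close>

lemma localization_section:
  assumes TS: "section_adjoint T S" and \<xi>: "\<xi> \<in> csec \<rho>"
  shows "loc T n (\<xi> (pt n)) = T \<xi> (pt n)"
  unfolding localization_def C0_sections_eq
proof (rule the_equality)
  fix w assume "\<exists>\<zeta>\<in>csec \<rho>. \<zeta> (pt n) = \<xi> (pt n) \<and> w = T \<zeta> (pt n)"
  then obtain \<zeta> where \<zeta>: "\<zeta> \<in> csec \<rho>" "\<zeta> (pt n) = \<xi> (pt n)" "w = T \<zeta> (pt n)" by blast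
  have mem: "w \<in> hcar (fibre n)" "T \<xi> (pt n) \<in> hcar (fibre n)"
    using TS \<xi> \<zeta> by (auto simp: section_adjoint_def intro!: csec_mem)
  show "w = T \<xi> (pt n)"
  proof (rule rep.ip_ext[OF mem])
    fix v assume v: "v \<in> hcar (fibre n)"
    obtain \<eta> where \<eta>: "\<eta> \<in> csec \<rho>" "\<eta> (pt n) = v" using section_through[OF v] by blast
    have "hip (fibre n) (T \<theta> (pt n)) v = hip (fibre n) (\<theta> (pt n)) (S \<eta> (pt n))" if "\<theta> \<in> csec \<rho>" for \<theta>
      using TS \<eta> that by (auto simp: section_adjoint_def)
    then have "hip (fibre n) w v = hip (fibre n) (T \<xi> (pt n)) v"
      using \<zeta> \<xi> by simp
    then show "hip (fibre n) v w = hip (fibre n) v (T \<xi> (pt n))"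
      using rep.ip_cnj[OF mem(1) v] rep.ip_cnj[OF mem(2) v] by simp
  qed
qed (use \<xi> in blast)

lemma adjoint_pair_localization:
  assumes TS: "section_adjoint T S"
  shows "rep.adjoint_pair n (loc T n) (loc S n)"
proof -
  have T: "loc T n (\<xi> (pt n)) = T \<xi> (pt n)" "T \<xi> \<in> csec \<rho>" if "\<xi> \<in> csec \<rho>" for \<xi>
    using localization_section[OF TS that] TS that by (auto simp: section_adjoint_def)
  have S: "loc S n (\<xi> (pt n)) = S \<xi> (pt n)" "S \<xi> \<in> csec \<rho>" if "\<xi> \<in> csec \<rho>" for \<xi>
    using localization_section[OF section_adjoint_sym[OF TS] that] TS that by (auto simp: section_adjoint_def)
  have "loc T n v \<in> hcar (fibre n)" "loc S n v \<in> hcar (fibre n)" if "v \<in> hcar (fibre n)" for v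
    using section_through[OF that] T S csec_mem by metis+
  moreover have "hip (fibre n) (loc T n v) w = hip (fibre n) v (loc S n w)"
    if v: "v \<in> hcar (fibre n)" and w: "w \<in> hcar (fibre n)" for v w
  proof -
    obtain \<xi> where \<xi>: "\<xi> \<in> csec \<rho>" "v = \<xi> (pt n)" using section_through[OF v] by blast
    obtain \<eta> where \<eta>: "\<eta> \<in> csec \<rho>" "w = \<eta> (pt n)" using section_through[OF w] by blast
    show ?thesis
      unfolding \<xi>(2) \<eta>(2) T(1)[OF \<xi>(1)] S(1)[OF \<eta>(1)]
      using TS \<xi>(1) \<eta>(1) by (simp add: section_adjoint_def)
  qed
  ultimately show ?thesis by (simp add: rep.adjoint_pair_def)
qed

definition bundle_op :: "(enat \<Rightarrow> 'k \<Rightarrow> 'k) \<Rightarrow> (enat \<times> 'g set \<Rightarrow> 'k) \<Rightarrow> enat \<times> 'g set \<Rightarrow> 'k"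
  where "bundle_op A \<xi> = sec (\<lambda>n. A n (\<xi> (pt n)))"

lemma section_adjoint_bundle_op:
  assumes adj: "\<And>n. rep.adjoint_pair n (A n) (B n)"
    and A: "\<And>s. is_section s \<Longrightarrow> is_section (\<lambda>n. A n (s n))" and B: "\<And>s. is_section s \<Longrightarrow> is_section (\<lambda>n. B n (s n))"
  shows "section_adjoint (bundle_op A) (bundle_op B)"
proof -
  have "hip (fibre n) (A n (\<xi> (pt n))) (\<eta> (pt n)) = hip (fibre n) (\<xi> (pt n)) (B n (\<eta> (pt n)))"
    if "\<xi> \<in> csec \<rho>" "\<eta> \<in> csec \<rho>" for \<xi> \<eta> n
    using adj[of n] csec_mem[OF that(1), of n] csec_mem[OF that(2), of n] by (simp add: rep.adjoint_pair_def)
  moreover have "sec (\<lambda>n. A n (\<xi> (pt n))) \<in> csec \<rho>" "sec (\<lambda>n. B n (\<xi> (pt n))) \<in> csec \<rho>"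
    if "\<xi> \<in> csec \<rho>" for \<xi>
    using A[OF csec_section[OF that]] B[OF csec_section[OF that]] by (simp_all add: is_section_def)
  ultimately show ?thesis by (simp add: section_adjoint_def bundle_op_def)
qed

lemma localization_bundle_op:
  assumes AB: "section_adjoint (bundle_op A) (bundle_op B)" and v: "v \<in> hcar (fibre n)"
  shows "loc (bundle_op A) n v = A n v"
proof -
  obtain \<xi> where \<xi>: "\<xi> \<in> csec \<rho>" "\<xi> (pt n) = v" using section_through[OF v] by blast
  then show ?thesis using localization_section[OF AB \<xi>(1), of n] by (simp add: bundle_op_def)
qed

end

section \<open>Almost invariant Hilbert--Schmidt operators\<close>

context unitary_rep
begin

lemma inj_on_U: "g \<in> carrier \<Gamma> \<Longrightarrow> inj_on (U g) car"
  by (metis U_inv_U inj_on_inverseI)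

lemma orthonormal_U_image:
  assumes B: "orthonormal B" and g: "g \<in> carrier \<Gamma>" shows "orthonormal (U g ` B)"
  unfolding orthonormal_def
proof (intro conjI ballI)
  have Bc: "x \<in> car" if "x \<in> B" for x using B that by (auto simp: orthonormal_def)
  then show "U g ` B \<subseteq> car" using g by auto
  fix e f assume "e \<in> U g ` B" "f \<in> U g ` B"
  then obtain x y where xy: "x \<in> B" "y \<in> B" "e = U g x" "f = U g y" by blast
  then have "e = f \<longleftrightarrow> x = y" using inj_onD[OF inj_on_U[OF g], of x y] Bc by auto
  then show "hip H e f = (if e = f then 1 else 0)"
    using B xy Bc g by (simp add: orthonormal_def U_ip)
qed

text \<open>Conjugating a rank one operator moves both of its vectors; this identifies conjugation
  with U \<otimes> cnj U.\<close>

lemma U_finrank_U_inv: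
  assumes g: "g \<in> carrier \<Gamma>" and a: "a \<in> I \<rightarrow> car" and b: "b \<in> I \<rightarrow> car" and v: "v \<in> car"
  shows "U g (finrank I a b (U (inv g) v)) = finrank I (\<lambda>i. U g (a i)) (\<lambda>i. U g (b i)) v"
proof -
  have "hip H (U (inv g) v) (b i) = hip H v (U g (b i))" if "i \<in> I" for i
    using ip_U_left[of "inv g" v "b i"] g v funcset_mem[OF b that] by simp
  then show ?thesis
    using g a by (simp add: finrank_def U_sum U_scale Pi_iff)
qed

text \<open>The error is governed by the Hilbert--Schmidt norm of the tail of \<open>A\<close>, which conjugation does
  not change; hence the bound is uniform in \<open>g\<close>.\<close>

lemma hs_coefficient_finite_part:
  assumes A: "adjoint_pair A S" and s: "((\<lambda>e. (hnorm H (A e))\<^sup>2) has_sum s) onb" and s4: "s \<le> 4"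
    and I: "finite I" "I \<subseteq> onb" and \<eta>: "\<eta> > 0" and part: "s - \<eta>\<^sup>2 \<le> (\<Sum>e\<in>I. (hnorm H (A e))\<^sup>2)"
    and g: "g \<in> carrier \<Gamma>"
  shows "cmod ((\<Sum>e\<in>I. hip H (U g (A (U (inv g) e))) (A e)) - tensor_coeff I A (\<lambda>e. e) g) \<le> 3 * \<eta>"
proof -
  have Ic: "e \<in> car" if "e \<in> I" for e using I that onb_mem by blast
  have Am: "A v \<in> car" if "v \<in> car" for v using adjoint_pair_mem[OF A that] .
  \<comment> \<open>The subtracted operator is \<open>A\<close> after the projection to the span of
    \<open>I\<close>, so \<open>D\<close> is the tail of \<open>A\<close>.\<close>
  define D where "D v = A v - finrank I A (\<lambda>e. e) v" for v
  have fm: "finrank I A (\<lambda>e. e) v \<in> car" "finrank I (\<lambda>e. e) A v \<in> car" for v using Ic Am by auto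
  have D: "adjoint_pair D (\<lambda>v. S v - finrank I (\<lambda>e. e) A v)"
    using A adjoint_pair_finrank[of I A "\<lambda>e. e"] Ic Am fm
    unfolding adjoint_pair_def D_def by (simp add: Pi_iff ip_diff_left ip_diff_right)
  have De: "(hnorm H (D e))\<^sup>2 = (hnorm H (A e))\<^sup>2 - (if e \<in> I then (hnorm H (A e))\<^sup>2 else 0)"
    if "e \<in> onb" for e
  proof -
    have "finrank I A (\<lambda>e. e) e = (\<Sum>i\<in>I. if i = e then A i else 0)"
      unfolding finrank_def
    proof (rule sum.cong)
      fix i assume "i \<in> I"
      then have "hip H e i = (if e = i then 1 else 0)"
        using orthonormal_onb I that unfolding orthonormal_def by blast
      then show "hip H e i *\<^sub>C A i = (if i = e then A i else 0)" by (simp add: scaleC_one)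
    qed simp
    also have "\<dots> = (if e \<in> I then A e else 0)" using I by simp
    finally show ?thesis by (simp add: D_def)
  qed
  have "((\<lambda>e. if e \<in> I then (hnorm H (A e))\<^sup>2 else 0) has_sum (\<Sum>e\<in>I. (hnorm H (A e))\<^sup>2)) onb"
    using I by (intro has_sum_finite_neutralI[of I]) auto
  from has_sum_add[OF s has_sum_uminusI[OF this]]
  have Ds: "((\<lambda>e. (hnorm H (D e))\<^sup>2) has_sum (s - (\<Sum>e\<in>I. (hnorm H (A e))\<^sup>2))) onb"
    using De by (subst has_sum_cong) auto
  \<comment> \<open>Translated basis vectors need not belong to \<open>onb\<close>, but
    \<open>hs_finite_sum_le\<close> covers every finite orthonormal set.\<close>
  have "(\<Sum>f\<in>U (inv g) ` I. (hnorm H (D f))\<^sup>2) \<le> s - (\<Sum>e\<in>I. (hnorm H (A e))\<^sup>2)"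
    using I g by (intro hs_finite_sum_le[OF D Ds] finite_imageI orthonormal_U_image
        orthonormal_subset[OF orthonormal_onb]) auto
  also have "\<dots> \<le> \<eta>\<^sup>2" using part by simp
  finally have D\<eta>: "(\<Sum>f\<in>I. (hnorm H (D (U (inv g) f)))\<^sup>2) \<le> \<eta>\<^sup>2"
    using inj_on_subset[OF inj_on_U[of "inv g"], of I] g Ic by (simp add: sum.reindex subset_iff)
  have As: "(\<Sum>f\<in>I. (hnorm H (A f))\<^sup>2) \<le> 4"
    using finite_sum_le_has_sum[OF s I] s4 by simp
  have split: "hip H (U g (A (U (inv g) f))) (A f) - hip H (U g (D (U (inv g) f))) (A f)
      = (\<Sum>e\<in>I. hip H (U g (A e)) (A f) * cnj (hip H (U g e) f))" if f: "f \<in> I" for f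
  proof -
    have fc: "f \<in> car" "U (inv g) f \<in> car" using Ic f g by auto
    have "A (U (inv g) f) = D (U (inv g) f) + finrank I A (\<lambda>e. e) (U (inv g) f)" by (simp add: D_def)
    then have "U g (A (U (inv g) f)) = U g (D (U (inv g) f)) + U g (finrank I A (\<lambda>e. e) (U (inv g) f))"
      using g fc fm adjoint_pair_mem[OF D] by (simp add: U_add)
    also have "U g (finrank I A (\<lambda>e. e) (U (inv g) f)) = finrank I (\<lambda>e. U g (A e)) (U g) f"
      using g fc Ic Am by (subst U_finrank_U_inv) auto
    finally have "hip H (U g (A (U (inv g) f))) (A f) - hip H (U g (D (U (inv g) f))) (A f)
       = hip H (finrank I (\<lambda>e. U g (A e)) (U g) f) (A f)"
      using g fc Ic Am adjoint_pair_mem[OF D] by (simp add: ip_add)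
    also have "\<dots> = (\<Sum>e\<in>I. hip H f (U g e) * hip H (U g (A e)) (A f))"
      using g fc Ic Am by (intro ip_finrank_left) auto
    also have "\<dots> = (\<Sum>e\<in>I. hip H (U g (A e)) (A f) * cnj (hip H (U g e) f))"
      using g fc Ic ip_cnj[of "U g _" f] by (intro sum.cong) auto
    finally show ?thesis .
  qed
  have "tensor_coeff I A (\<lambda>e. e) g = (\<Sum>f\<in>I. \<Sum>e\<in>I. hip H (U g (A e)) (A f) * cnj (hip H (U g e) f))"
    unfolding tensor_coeff_def tensor_ip_def by (rule sum.swap)
  then have "(\<Sum>e\<in>I. hip H (U g (A (U (inv g) e))) (A e)) - tensor_coeff I A (\<lambda>e. e) g
      = (\<Sum>f\<in>I. hip H (U g (D (U (inv g) f))) (A f))"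
    by (simp add: split[symmetric] sum_subtractf)
  also have "cmod \<dots> \<le> (\<Sum>f\<in>I. ((hnorm H (D (U (inv g) f)))\<^sup>2 / \<eta> + \<eta> * (hnorm H (A f))\<^sup>2) / 2)"
  proof (rule sum_norm_le)
    fix f assume f: "f \<in> I"
    define x y where "x = hnorm H (D (U (inv g) f))" and "y = hnorm H (A f)"
    have "cmod (hip H (U g (D (U (inv g) f))) (A f)) \<le> x * y"
      using Cauchy_Schwarz[of "U g (D (U (inv g) f))" "A f"] f g Ic Am adjoint_pair_mem[OF D]
      by (simp add: x_def y_def)
    \<comment> \<open>The weight \<eta> balances a tail of squared norm at most \<eta>^2 against a
      total of at most 4, and the sum is at most 5 \<eta> / 2.\<close>
    also have "\<dots> \<le> (x\<^sup>2 / \<eta> + \<eta> * y\<^sup>2) / 2"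
    proof -
      have "0 \<le> (x - \<eta> * y)\<^sup>2 / \<eta>" using \<eta> by simp
      also have "\<dots> = x\<^sup>2 / \<eta> + \<eta> * y\<^sup>2 - 2 * (x * y)"
        using \<eta> by (simp add: field_simps power2_eq_square)
      finally show ?thesis by simp
    qed
    finally show "cmod (hip H (U g (D (U (inv g) f))) (A f))
      \<le> ((hnorm H (D (U (inv g) f)))\<^sup>2 / \<eta> + \<eta> * (hnorm H (A f))\<^sup>2) / 2"
      by (simp add: x_def y_def)
  qed
  also have "\<dots> = ((\<Sum>f\<in>I. (hnorm H (D (U (inv g) f)))\<^sup>2) / \<eta> + \<eta> * (\<Sum>f\<in>I. (hnorm H (A f))\<^sup>2)) / 2"
    by (simp add: sum_divide_distrib[symmetric] sum.distrib sum_distrib_left)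
  also have "\<dots> \<le> (\<eta>\<^sup>2 / \<eta> + \<eta> * 4) / 2"
    using D\<eta> As \<eta> by (intro divide_right_mono add_mono mult_left_mono) auto
  also have "\<dots> \<le> 3 * \<eta>" using \<eta> by (simp add: power2_eq_square)
  finally show ?thesis .
qed

text \<open>\<open>I\<close> is taken so large that the partial coefficient sums lie within \<delta>
  of 1 and that less than (\<delta> / 3)^2 of the squared norm is left outside. The latter replaces
  the partial sums by tensor coefficients at the cost of another \<delta>.\<close>

lemma almost_invariant_finite_part:
  assumes A: "adjoint_pair A S" and s: "((\<lambda>e. (hnorm H (A e))\<^sup>2) has_sum s) onb" "s \<le> 4"
    and F: "finite F" "F \<subseteq> carrier \<Gamma>" and \<delta>: "0 < \<delta>" "\<delta> < 1"
    and near: "\<And>g. g \<in> F \<Longrightarrow> cmod (infsum (\<lambda>e. hip H (U g (A (U (inv g) e))) (A e)) onb - 1) < \<delta>"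
  obtains I where "finite I" "I \<subseteq> onb" "\<And>g. g \<in> F \<Longrightarrow> cmod (tensor_coeff I A (\<lambda>e. e) g - 1) < 2 * \<delta>"
proof -
  let ?c = "\<lambda>g e. hip H (U g (A (U (inv g) e))) (A e)"
  have "\<forall>\<^sub>F I in finite_subsets_at_top onb. \<forall>g\<in>F. cmod (sum (?c g) I - 1) < \<delta>"
  proof (rule eventually_ball_finite[OF F(1)], rule ballI)
    fix g assume g: "g \<in> F"
    \<comment> \<open>Otherwise \<open>infsum\<close> would have its default value 0, at distance 1
      from 1, contrary to \<delta> < 1.\<close>
    have "?c g summable_on onb"
      using near[OF g] \<delta> infsum_not_exists[of "?c g" onb] by fastforce
    then have "(sum (?c g) \<longlongrightarrow> infsum (?c g) onb) (finite_subsets_at_top onb)"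
      using has_sum_infsum unfolding has_sum_def by blast
    then have "((\<lambda>I. cmod (sum (?c g) I - 1)) \<longlongrightarrow> cmod (infsum (?c g) onb - 1)) (finite_subsets_at_top onb)"
      by (intro tendsto_intros)
    then show "\<forall>\<^sub>F I in finite_subsets_at_top onb. cmod (sum (?c g) I - 1) < \<delta>"
      using near[OF g] by (rule order_tendstoD)
  qed
  moreover have "\<forall>\<^sub>F I in finite_subsets_at_top onb. s - (\<delta> / 3)\<^sup>2 < (\<Sum>e\<in>I. (hnorm H (A e))\<^sup>2)"
    using s(1) unfolding has_sum_def by (rule order_tendstoD) (use \<delta> in simp)
  moreover have "\<forall>\<^sub>F I in finite_subsets_at_top onb. finite I \<and> I \<subseteq> onb"
    by (rule eventually_finite_subsets_at_top_weakI) auto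
  ultimately have "\<forall>\<^sub>F I in finite_subsets_at_top onb. (finite I \<and> I \<subseteq> onb) \<and>
      (\<forall>g\<in>F. cmod (sum (?c g) I - 1) < \<delta>) \<and> s - (\<delta> / 3)\<^sup>2 < (\<Sum>e\<in>I. (hnorm H (A e))\<^sup>2)"
    by eventually_elim blast
  then have "\<exists>I. (finite I \<and> I \<subseteq> onb) \<and>
      (\<forall>g\<in>F. cmod (sum (?c g) I - 1) < \<delta>) \<and> s - (\<delta> / 3)\<^sup>2 < (\<Sum>e\<in>I. (hnorm H (A e))\<^sup>2)"
    by (rule eventually_happens'[OF finite_subsets_at_top_neq_bot])
  then obtain I where I: "finite I" "I \<subseteq> onb" "\<And>g. g \<in> F \<Longrightarrow> cmod (sum (?c g) I - 1) < \<delta>"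
      "s - (\<delta> / 3)\<^sup>2 < (\<Sum>e\<in>I. (hnorm H (A e))\<^sup>2)"
    by (elim exE conjE) (rule that, auto)
  show ?thesis
  proof (rule that[OF I(1,2)])
    fix g assume g: "g \<in> F"
    have "cmod (sum (?c g) I - tensor_coeff I A (\<lambda>e. e) g) \<le> 3 * (\<delta> / 3)"
      using I g F \<delta> by (intro hs_coefficient_finite_part[OF A s]) auto
    then show "cmod (tensor_coeff I A (\<lambda>e. e) g - 1) < 2 * \<delta>"
      using I(3)[OF g] norm_triangle_ineq[of "tensor_coeff I A (\<lambda>e. e) g - sum (?c g) I" "sum (?c g) I - 1"]
        norm_minus_commute[of "tensor_coeff I A (\<lambda>e. e) g" "sum (?c g) I"]
      by simp
  qed
qed

text \<open>By \<open>cmod_tensor_coeff_le\<close> the modulus at \<one> is at most the real part,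
  which forces the number to be real.\<close>

lemma tensor_coeff_one_eq_of_real:
  assumes "a \<in> I \<rightarrow> car" "b \<in> I \<rightarrow> car"
  shows "tensor_coeff I a b \<one> = of_real (Re (tensor_coeff I a b \<one>))"
proof -
  let ?z = "tensor_coeff I a b \<one>"
  have "(cmod ?z)\<^sup>2 \<le> (Re ?z)\<^sup>2"
    using cmod_tensor_coeff_le[OF assms one_closed] by (intro power_mono) auto
  then have "Im ?z = 0" by (simp add: cmod_power2)
  then show ?thesis by (simp add: complex_eq_iff)
qed

text \<open>The normalised coefficient z has modulus at most 1, so |z - 1|^2 \<le> 2 (1 - Re z). A
  real defect below \<epsilon>^2 / 2 therefore gives distance below \<epsilon>.\<close>

lemma tensor_coeff_ratio:
  assumes ab: "a \<in> I \<rightarrow> car" "b \<in> I \<rightarrow> car" and g: "g \<in> carrier \<Gamma>" and \<epsilon>: "\<epsilon> > 0"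
    and pos: "0 < Re (tensor_coeff I a b \<one>)"
    and less: "Re (tensor_coeff I a b \<one>) - Re (tensor_coeff I a b g) < (\<epsilon>\<^sup>2 / 2) * Re (tensor_coeff I a b \<one>)"
  shows "cmod (tensor_coeff I a b g / tensor_coeff I a b \<one> - 1) < \<epsilon>"
proof -
  define r where "r = Re (tensor_coeff I a b \<one>)"
  define z where "z = tensor_coeff I a b g / of_real r"
  have eq: "tensor_coeff I a b g / tensor_coeff I a b \<one> = z"
    using tensor_coeff_one_eq_of_real[OF ab] by (simp add: z_def r_def)
  have r: "r > 0" using pos by (simp add: r_def)
  have "cmod z \<le> 1"
    using cmod_tensor_coeff_le[OF ab g] r by (simp add: z_def norm_divide r_def)
  then have z1: "(cmod z)\<^sup>2 \<le> 1" by (simp add: power_le_one)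
  have "Re (tensor_coeff I a b g) = r * Re z" using r by (simp add: z_def)
  then have "r * (1 - Re z) < r * (\<epsilon>\<^sup>2 / 2)"
    using less by (simp add: r_def[symmetric] right_diff_distrib mult.commute)
  then have "1 - Re z < \<epsilon>\<^sup>2 / 2" using r by (simp only: mult_less_cancel_left_pos)
  moreover have "(cmod (z - 1))\<^sup>2 = (cmod z)\<^sup>2 - 2 * Re z + 1"
    unfolding cmod_power2 by (simp add: power2_eq_square algebra_simps)
  ultimately have "(cmod (z - 1))\<^sup>2 < \<epsilon>\<^sup>2" using z1 by linarith
  then show ?thesis unfolding eq using \<epsilon> by (simp add: power2_less_imp_less)
qed

lemma tensor_coeff_scale:
  assumes "a \<in> I \<rightarrow> car" "b \<in> I \<rightarrow> car" "g \<in> carrier \<Gamma>"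
  shows "tensor_coeff I (\<lambda>i. c *\<^sub>C a i) b g = of_real ((cmod c)\<^sup>2) * tensor_coeff I a b g"
proof -
  have "hip H (U g (c *\<^sub>C a i)) (c *\<^sub>C a j) = of_real ((cmod c)\<^sup>2) * hip H (U g (a i)) (a j)"
    if "i \<in> I" "j \<in> I" for i j
    using assms funcset_mem[OF assms(1)] that
    by (simp add: U_scale ip_scale ip_scale_right complex_norm_square del: of_real_power)
  then show ?thesis
    unfolding tensor_coeff_def tensor_ip_def sum_distrib_left
    by (intro sum.cong refl) (simp add: mult.assoc)
qed

text \<open>The norm is required to be exactly 1, and \<open>B\<close> is carried along because an
  adjointable operator on sections needs an adjoint on sections.\<close>

definition almost_invariant :: "'g set \<Rightarrow> real \<Rightarrow> ('h \<Rightarrow> 'h) \<Rightarrow> ('h \<Rightarrow> 'h) \<Rightarrow> bool"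
  where "almost_invariant F \<epsilon> A B \<longleftrightarrow> adjoint_pair A B \<and> ((\<lambda>e. (hnorm H (A e))\<^sup>2) has_sum 1) onb \<and>
    (\<forall>g\<in>F. cmod (infsum (\<lambda>e. hip H (U g (A (U (inv g) e))) (A e)) onb - 1) < \<epsilon>)"

lemma almost_invariant_finrank:
  assumes a: "a \<in> I \<rightarrow> car" and b: "b \<in> I \<rightarrow> car" and F: "F \<subseteq> carrier \<Gamma>"
    and one: "tensor_coeff I a b \<one> = 1" and near: "\<And>g. g \<in> F \<Longrightarrow> cmod (tensor_coeff I a b g - 1) < \<epsilon>"
  shows "almost_invariant F \<epsilon> (finrank I a b) (finrank I b a)"
proof -
  have "adjoint_pair (finrank I a b) (finrank I b a)"
    using a b by (intro adjoint_pair_finrank) auto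
  moreover have "((\<lambda>e. (hnorm H (finrank I a b e))\<^sup>2) has_sum 1) onb"
    using tensor_ip_self_has_sum[OF a b] one tensor_coeff_one[OF a b] by simp
  moreover have "infsum (\<lambda>e. hip H (U g (finrank I a b (U (inv g) e))) (finrank I a b e)) onb = tensor_coeff I a b g"
    if "g \<in> F" for g
  proof -
    have g: "g \<in> carrier \<Gamma>" using F that by blast
    have m: "(\<lambda>i. U g (a i)) \<in> I \<rightarrow> car" "(\<lambda>i. U g (b i)) \<in> I \<rightarrow> car" using a b g by (auto simp: Pi_iff)
    have "infsum (\<lambda>e. hip H (U g (finrank I a b (U (inv g) e))) (finrank I a b e)) onb
      = infsum (\<lambda>e. hip H (finrank I (\<lambda>i. U g (a i)) (\<lambda>i. U g (b i)) e) (finrank I a b e)) onb"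
      using U_finrank_U_inv[OF g a b onb_mem] by (intro infsum_cong) simp
    also have "\<dots> = tensor_coeff I a b g"
      unfolding tensor_coeff_def by (rule infsumI) (rule tensor_ip_has_sum[OF m a b])
    finally show ?thesis .
  qed
  ultimately show ?thesis using near by (simp add: almost_invariant_def)
qed

text \<open>If \<open>v\<close> has a finite orbit, summing the rank one operators of its points gives a
  nonzero invariant operator.\<close>

lemma tensor_coeff_finite_orbit:
  assumes v: "v \<in> car" "v \<noteq> 0" and fin: "finite ((\<lambda>h. U h v) ` carrier \<Gamma>)"
  defines "Orb \<equiv> (\<lambda>h. U h v) ` carrier \<Gamma>"
  shows "0 < Re (tensor_coeff Orb (\<lambda>x. x) (\<lambda>x. x) \<one>)"
    and "g \<in> carrier \<Gamma> \<Longrightarrow> tensor_coeff Orb (\<lambda>x. x) (\<lambda>x. x) g = tensor_coeff Orb (\<lambda>x. x) (\<lambda>x. x) \<one>"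
proof -
  have Oc: "x \<in> car" if "x \<in> Orb" for x using that v by (auto simp: Orb_def)
  have vO: "v \<in> Orb" using v by (auto simp: Orb_def U_one intro!: image_eqI[of _ _ \<one>])
  have one: "tensor_coeff Orb (\<lambda>x. x) (\<lambda>x. x) \<one> = (\<Sum>x\<in>Orb. \<Sum>y\<in>Orb. hip H x y * cnj (hip H x y))"
    using Oc by (subst tensor_coeff_one) (auto simp: tensor_ip_def)
  \<comment> \<open>The coefficient at \<one> is a sum of squares, to which the pair
    \<open>v\<close>, \<open>v\<close> contributes.\<close>
  have "0 < (cmod (hip H v v))\<^sup>2" using v ip_definite by auto
  also have "\<dots> \<le> (\<Sum>y\<in>Orb. (cmod (hip H v y))\<^sup>2)"
    using vO fin by (intro member_le_sum) (auto simp: Orb_def)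
  also have "\<dots> \<le> (\<Sum>x\<in>Orb. \<Sum>y\<in>Orb. (cmod (hip H x y))\<^sup>2)"
    using vO fin by (intro member_le_sum[where f = "\<lambda>x. \<Sum>y\<in>Orb. (cmod (hip H x y))\<^sup>2"])
      (auto simp: Orb_def intro: sum_nonneg)
  also have "\<dots> = Re (tensor_coeff Orb (\<lambda>x. x) (\<lambda>x. x) \<one>)"
    unfolding one by (simp add: complex_norm_square[symmetric] del: of_real_power)
  finally show "0 < Re (tensor_coeff Orb (\<lambda>x. x) (\<lambda>x. x) \<one>)" .
  show "tensor_coeff Orb (\<lambda>x. x) (\<lambda>x. x) g = tensor_coeff Orb (\<lambda>x. x) (\<lambda>x. x) \<one>" if g: "g \<in> carrier \<Gamma>"
  proof -
    have sub: "U h ` Orb \<subseteq> Orb" if "h \<in> carrier \<Gamma>" for h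
    proof
      fix y assume "y \<in> U h ` Orb"
      then obtain k where k: "k \<in> carrier \<Gamma>" "y = U h (U k v)" by (auto simp: Orb_def)
      then have "y = U (h \<otimes> k) v" using that v by (simp add: U_mult)
      then show "y \<in> Orb" using that k(1) by (auto simp: Orb_def)
    qed
    \<comment> \<open>Only the outer index is substituted: \<open>U g\<close> permutes the orbit,
      and the left term at \<open>x\<close> is the right term at \<open>U g x\<close>.\<close>
    have "(\<Sum>x\<in>Orb. \<Sum>y\<in>Orb. hip H (U g x) y * cnj (hip H (U g x) y)) = (\<Sum>x\<in>Orb. \<Sum>y\<in>Orb. hip H x y * cnj (hip H x y))"
      by (rule sum.reindex_bij_witness[of Orb "U (inv g)" "U g"])
        (use sub g Oc in \<open>auto simp: U_inv_U U_U_inv\<close>)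
    then show ?thesis unfolding one by (simp add: tensor_coeff_def tensor_ip_def)
  qed
qed

end

section \<open>Amenable representations\<close>

context hls_representation
begin

abbreviation conj_coeff :: "((enat \<times> 'g set \<Rightarrow> 'k) \<Rightarrow> enat \<times> 'g set \<Rightarrow> 'k) \<Rightarrow> enat \<times> 'g set \<Rightarrow> complex"
  where "conj_coeff T x \<equiv> hs_inner (fib \<rho> (rng HLS x))
            (translate HLS \<rho> x (localization HLS_units \<rho> T (src HLS x)))
            (localization HLS_units \<rho> T (rng HLS x))"

lemma conj_coeff_eq:
  assumes TS: "section_adjoint T S" and g: "g \<in> carrier \<Gamma>"
  shows "conj_coeff T (n, proj n g)
    = infsum (\<lambda>e. hip (fibre n) (U n g (loc T n (U n (inv g) e))) (loc T n e)) (rep.onb n)"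
proof -
  have adj: "rep.adjoint_pair n (loc T n) (loc S n)" by (rule adjoint_pair_localization[OF TS])
  have tr: "translate HLS \<rho> (n, proj n g) (loc T n) = (\<lambda>v. U n g (loc T n (U n (inv g) v)))"
    using g by (simp add: translate_def U_def ginv_HLS inv_hls_quotient fun_eq_iff)
  have "(\<lambda>v. U n g (loc T n (U n (inv g) v))) \<in> hcar (fibre n) \<rightarrow> hcar (fibre n)"
    using g rep.adjoint_pair_mem[OF adj] by auto
  from rep.hs_inner_eq[OF adj this] show ?thesis
    by (simp add: tr fibre_def)
qed

text \<open>A single operator far along the net suffices. Its localization, restricted to finitely
  many basis vectors, is the sum of the tensors T e \<otimes> cnj e, which explains why the second
  family is the identity.\<close>

lemma amenable_almost_invariant_family:
  assumes am: "amenable_representation HLS \<rho>"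
    and F: "finite F" "F \<subseteq> carrier \<Gamma>" and \<delta>: "0 < \<delta>" "\<delta> < 1"
  obtains I :: "'k set" and x where "finite I" "x \<in> I \<rightarrow> hcar (fibre \<infinity>)" "(\<lambda>e. e) \<in> I \<rightarrow> hcar (fibre \<infinity>)"
    "\<And>g. g \<in> F \<Longrightarrow> cmod (rep.tensor_coeff \<infinity> I x (\<lambda>e. e) g - 1) < 2 * \<delta>"
proof -
  obtain FF where FF: "FF \<noteq> bot"
      "FF \<le> principal {T. hilbert_schmidt HLS_units \<rho> T \<and> hs_sup_norm HLS_units \<rho> T \<le> 1}"
      "\<And>L. compactin HLS_units L \<Longrightarrow>
        uniform_limit L (\<lambda>T u. hs_norm (fib \<rho> u) (localization HLS_units \<rho> T u)) (\<lambda>_. 1) FF"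
      "\<And>L. compactin (arrows HLS) L \<Longrightarrow> uniform_limit L conj_coeff (\<lambda>_. 1) FF"
    using am unfolding amenable_representation_def by blast
  have "\<forall>\<^sub>F T in FF. hilbert_schmidt HLS_units \<rho> T"
    using FF(2) unfolding le_principal by (rule eventually_mono) simp
  \<comment> \<open>A coarse tolerance: it bounds the norm by 2, whose square is the 4 in
    \<open>almost_invariant_finite_part\<close>.\<close>
  moreover have "\<forall>\<^sub>F T in FF. \<bar>hs_norm (fibre \<infinity>) (loc T \<infinity>) - 1\<bar> < 1"
  proof -
    have "compactin HLS_units {pt \<infinity>}" by (rule finite_imp_compactin) (use pt_mem in auto)
    from FF(3)[OF this] show ?thesis
      by (auto simp: uniform_limit_iff dist_real_def fibre_def dest: spec[of _ 1])
  qed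
  moreover have "\<forall>\<^sub>F T in FF. \<forall>g\<in>F. cmod (conj_coeff T (\<infinity>, proj \<infinity> g) - 1) < \<delta>"
    using FF(4)[OF compactin_finite_arrows[OF F, of \<infinity>]] \<delta>
    by (auto simp: uniform_limit_iff dist_norm)
  ultimately have "\<forall>\<^sub>F T in FF. hilbert_schmidt HLS_units \<rho> T \<and> \<bar>hs_norm (fibre \<infinity>) (loc T \<infinity>) - 1\<bar> < 1 \<and>
      (\<forall>g\<in>F. cmod (conj_coeff T (\<infinity>, proj \<infinity> g) - 1) < \<delta>)"
    by eventually_elim blast
  then have "\<exists>T. hilbert_schmidt HLS_units \<rho> T \<and> \<bar>hs_norm (fibre \<infinity>) (loc T \<infinity>) - 1\<bar> < 1 \<and>
      (\<forall>g\<in>F. cmod (conj_coeff T (\<infinity>, proj \<infinity> g) - 1) < \<delta>)"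
    by (rule eventually_happens'[OF FF(1)])
  then obtain T where T: "hilbert_schmidt HLS_units \<rho> T" and norm: "\<bar>hs_norm (fibre \<infinity>) (loc T \<infinity>) - 1\<bar> < 1"
    and near: "\<forall>g\<in>F. cmod (conj_coeff T (\<infinity>, proj \<infinity> g) - 1) < \<delta>"
    by (elim exE conjE)
  obtain S where TS: "section_adjoint T S"
    using T unfolding hilbert_schmidt_def adjointable_iff by blast
  have adj: "rep.adjoint_pair \<infinity> (loc T \<infinity>) (loc S \<infinity>)" by (rule adjoint_pair_localization[OF TS])
  have "trace_abs_sq (fibre \<infinity>) (loc T \<infinity>) < \<infinity>"
    using T pt_mem[of \<infinity>] unfolding hilbert_schmidt_def fibre_def by blast
  then have s: "((\<lambda>e. (hnorm (fibre \<infinity>) (loc T \<infinity> e))\<^sup>2) has_sum (hs_norm (fibre \<infinity>) (loc T \<infinity>))\<^sup>2) (rep.onb \<infinity>)"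
    by (rule rep.hs_norm_has_sum[OF adj])
  have "(hs_norm (fibre \<infinity>) (loc T \<infinity>))\<^sup>2 \<le> 2\<^sup>2"
    using norm by (intro power_mono) auto
  then have s4: "(hs_norm (fibre \<infinity>) (loc T \<infinity>))\<^sup>2 \<le> 4" by simp
  have near': "cmod (infsum (\<lambda>e. hip (fibre \<infinity>) (U \<infinity> g (loc T \<infinity> (U \<infinity> (inv g) e))) (loc T \<infinity> e)) (rep.onb \<infinity>) - 1) < \<delta>"
    if "g \<in> F" for g
  proof -
    have g: "g \<in> carrier \<Gamma>" using that F by blast
    show ?thesis using near that unfolding conj_coeff_eq[OF TS g, symmetric] by blast
  qed
  obtain I where I: "finite I" "I \<subseteq> rep.onb \<infinity>"
      "\<And>g. g \<in> F \<Longrightarrow> cmod (rep.tensor_coeff \<infinity> I (loc T \<infinity>) (\<lambda>e. e) g - 1) < 2 * \<delta>"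
    by (rule rep.almost_invariant_finite_part[OF adj s s4 F \<delta> near']) (assumption, rule that)
  have m: "e \<in> hcar (fibre \<infinity>)" if "e \<in> I" for e using I(2) that rep.onb_mem by blast
  show ?thesis
    by (rule that[OF I(1) _ _ I(3)]) (use m rep.adjoint_pair_mem[OF adj] in auto)
qed

text \<open>The action factors through a finite quotient, so any nonzero vector has a finite orbit;
  the invariant operator of that orbit only has to be normalised.\<close>

lemma invariant_operator_finite_level:
  assumes F: "F \<subseteq> carrier \<Gamma>" and \<epsilon>: "\<epsilon> > 0"
  shows "\<exists>A B. rep.almost_invariant (enat m) F \<epsilon> A B"
proof -
  let ?n = "enat m"
  have "hcar (fibre ?n) \<noteq> {0}" using fibre_nonzero[OF pt_mem] by (simp add: fibre_def)
  then obtain v where v: "v \<in> hcar (fibre ?n)" "v \<noteq> 0" using rep.zero_mem[of ?n] by blast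
  define Orb where "Orb = (\<lambda>h. U ?n h v) ` carrier \<Gamma>"
  have "Orb = (\<lambda>a. act \<rho> (?n, a) v) ` proj ?n ` carrier \<Gamma>" by (auto simp: Orb_def U_def)
  then have fin: "finite Orb" using finite_proj by simp
  define r where "r = Re (rep.tensor_coeff ?n Orb (\<lambda>x. x) (\<lambda>x. x) \<one>)"
  have id: "(\<lambda>x. x) \<in> Orb \<rightarrow> hcar (fibre ?n)" using v by (auto simp: Orb_def)
  have r: "r > 0"
    unfolding r_def Orb_def by (rule rep.tensor_coeff_finite_orbit(1)[OF v fin[unfolded Orb_def]])
  \<comment> \<open>Scaling one of the two families by \<open>c\<close> multiplies the coefficient
    by |c|^2 = 1 / r, which makes the squared norm 1.\<close>
  define c where "c = complex_of_real (1 / sqrt r)"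
  have coeff: "rep.tensor_coeff ?n Orb (\<lambda>x. c *\<^sub>C x) (\<lambda>x. x) g = 1" if g: "g \<in> carrier \<Gamma>" for g
  proof -
    have "rep.tensor_coeff ?n Orb (\<lambda>x. x) (\<lambda>x. x) g = of_real r"
      unfolding r_def rep.tensor_coeff_one_eq_of_real[OF id id, symmetric]
      unfolding Orb_def by (rule rep.tensor_coeff_finite_orbit(2)[OF v fin[unfolded Orb_def] g])
    moreover have "(cmod c)\<^sup>2 = 1 / r" using r by (simp add: c_def norm_divide power_divide)
    ultimately show ?thesis
      unfolding rep.tensor_coeff_scale[OF id id g] using r by simp
  qed
  have "rep.almost_invariant ?n F \<epsilon> (rep.finrank ?n Orb (\<lambda>x. c *\<^sub>C x) (\<lambda>x. x)) (rep.finrank ?n Orb (\<lambda>x. x) (\<lambda>x. c *\<^sub>C x))"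
    using id F \<epsilon> coeff by (intro rep.almost_invariant_finrank) auto
  then show ?thesis by blast
qed

text \<open>The values at \<open>\<infinity>\<close> control all but finitely many fibres, and the remaining ones carry
  representations of finite groups.\<close>

lemma extend_almost_invariant:
  assumes I: "finite I" and \<alpha>: "\<alpha> \<in> I \<rightarrow> hcar (fibre \<infinity>)" and \<beta>: "\<beta> \<in> I \<rightarrow> hcar (fibre \<infinity>)"
    and F: "finite F" "F \<subseteq> carrier \<Gamma>" and \<epsilon>: "\<epsilon> > 0"
    and pos: "0 < Re (rep.tensor_coeff \<infinity> I \<alpha> \<beta> \<one>)"
    and near: "\<And>g. g \<in> F \<Longrightarrow> cmod (rep.tensor_coeff \<infinity> I \<alpha> \<beta> g / rep.tensor_coeff \<infinity> I \<alpha> \<beta> \<one> - 1) < \<epsilon>"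
  shows "\<exists>A B. section_adjoint (bundle_op A) (bundle_op B) \<and> (\<forall>n. rep.almost_invariant n F \<epsilon> (A n) (B n))"
proof -
  have "\<forall>i\<in>I. \<exists>s. is_section s \<and> s \<infinity> = \<alpha> i" using section_extend \<alpha> by blast
  then obtain a where a: "\<And>i. i \<in> I \<Longrightarrow> is_section (a i)" "\<And>i. i \<in> I \<Longrightarrow> a i \<infinity> = \<alpha> i" by metis
  have "\<forall>i\<in>I. \<exists>s. is_section s \<and> s \<infinity> = \<beta> i" using section_extend \<beta> by blast
  then obtain b where b: "\<And>i. i \<in> I \<Longrightarrow> is_section (b i)" "\<And>i. i \<in> I \<Longrightarrow> b i \<infinity> = \<beta> i" by metis
  define \<Phi> where "\<Phi> n g = rep.tensor_coeff n I (\<lambda>i. a i n) (\<lambda>i. b i n) g" for n g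
  have ma: "(\<lambda>i. a i n) \<in> I \<rightarrow> hcar (fibre n)" and mb: "(\<lambda>i. b i n) \<in> I \<rightarrow> hcar (fibre n)" for n
    using a(1) b(1) section_mem by auto
  have \<Phi>inf: "\<Phi> \<infinity> g = rep.tensor_coeff \<infinity> I \<alpha> \<beta> g" for g
    unfolding \<Phi>_def rep.tensor_coeff_def rep.tensor_ip_def
    using a(2) b(2) by (intro sum.cong refl) simp
  have lim: "(\<lambda>m. \<Phi> (enat m) g) \<longlonglongrightarrow> \<Phi> \<infinity> g" if "g \<in> carrier \<Gamma>" for g
    unfolding \<Phi>_def rep.tensor_coeff_def rep.tensor_ip_def
    by (intro tendsto_sum tendsto_mult tendsto_cnj section_coefficient_LIMSEQ a(1) b(1) that)
  have ne: "\<Phi> \<infinity> \<one> \<noteq> 0" using pos unfolding \<Phi>inf by auto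
  have "\<forall>\<^sub>F m in sequentially. 0 < Re (\<Phi> (enat m) \<one>)"
    using tendsto_Re[OF lim[OF one_closed]] pos unfolding \<Phi>inf by (rule order_tendstoD)
  moreover have "\<forall>\<^sub>F m in sequentially. \<forall>g\<in>F. cmod (\<Phi> (enat m) g / \<Phi> (enat m) \<one> - 1) < \<epsilon>"
  proof (rule eventually_ball_finite[OF F(1)], rule ballI)
    fix g assume g: "g \<in> F"
    then have gc: "g \<in> carrier \<Gamma>" using F by blast
    have "(\<lambda>m. cmod (\<Phi> (enat m) g / \<Phi> (enat m) \<one> - 1)) \<longlonglongrightarrow> cmod (\<Phi> \<infinity> g / \<Phi> \<infinity> \<one> - 1)"
      by (intro tendsto_intros lim gc one_closed ne)
    then show "\<forall>\<^sub>F m in sequentially. cmod (\<Phi> (enat m) g / \<Phi> (enat m) \<one> - 1) < \<epsilon>"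
      using near[OF g] unfolding \<Phi>inf by (rule order_tendstoD)
  qed
  ultimately have "\<forall>\<^sub>F m in sequentially. 0 < Re (\<Phi> (enat m) \<one>) \<and> (\<forall>g\<in>F. cmod (\<Phi> (enat m) g / \<Phi> (enat m) \<one> - 1) < \<epsilon>)"
    by eventually_elim blast
  then obtain N where N: "\<And>m. m \<ge> N \<Longrightarrow> 0 < Re (\<Phi> (enat m) \<one>) \<and> (\<forall>g\<in>F. cmod (\<Phi> (enat m) g / \<Phi> (enat m) \<one> - 1) < \<epsilon>)"
    unfolding eventually_sequentially by blast
  have tail: "0 < Re (\<Phi> n \<one>) \<and> (\<forall>g\<in>F. cmod (\<Phi> n g / \<Phi> n \<one> - 1) < \<epsilon>)" if "enat N \<le> n" for n
    using that N pos near by (cases n) (auto simp: \<Phi>inf)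
  \<comment> \<open>Normalises the operator in each fibre of the tail. It converges because the
    radicands have a positive limit, so the scaled vectors remain sections.\<close>
  define f where "f n = complex_of_real (1 / sqrt (Re (\<Phi> n \<one>)))" for n
  define a' where "a' n i = f n *\<^sub>C a i n" for n i
  have "(\<lambda>m. f (enat m)) \<longlonglongrightarrow> f \<infinity>"
    unfolding f_def using pos
    by (intro tendsto_of_real tendsto_divide tendsto_const tendsto_real_sqrt tendsto_Re lim one_closed)
      (simp add: \<Phi>inf)
  then have a'is_section: "is_section (\<lambda>n. a' n i)" if "i \<in> I" for i
    unfolding a'_def by (rule section_mult[OF a(1)[OF that]])
  have ma': "a' n \<in> I \<rightarrow> hcar (fibre n)" for n using a'is_section section_mem by blast
  have ai_tail: "rep.almost_invariant n F \<epsilon> (rep.finrank n I (a' n) (\<lambda>i. b i n)) (rep.finrank n I (\<lambda>i. b i n) (a' n))"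
    if n: "enat N \<le> n" for n
  proof -
    have p: "0 < Re (\<Phi> n \<one>)" using tail[OF n] by blast
    have sq: "(cmod (f n))\<^sup>2 = 1 / Re (\<Phi> n \<one>)" using p by (simp add: f_def norm_divide power_divide)
    have real: "\<Phi> n \<one> = of_real (Re (\<Phi> n \<one>))"
      unfolding \<Phi>_def by (rule rep.tensor_coeff_one_eq_of_real[OF ma mb])
    have "rep.tensor_coeff n I (a' n) (\<lambda>i. b i n) g = \<Phi> n g / \<Phi> n \<one>" if "g \<in> carrier \<Gamma>" for g
      unfolding a'_def rep.tensor_coeff_scale[OF ma mb that] sq
      by (subst (2) real) (simp add: \<Phi>_def)
    then show ?thesis
      using tail[OF n] p ma' mb F by (intro rep.almost_invariant_finrank) auto
  qed
  have "\<forall>m. \<exists>C D. rep.almost_invariant (enat m) F \<epsilon> C D"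
    using invariant_operator_finite_level[OF F(2) \<epsilon>] by blast
  then obtain C D where CD: "\<And>m. rep.almost_invariant (enat m) F \<epsilon> (C m) (D m)" by metis
  \<comment> \<open>Every level below \<open>N\<close> is finite, so \<open>the_enat\<close>
    recovers it.\<close>
  define A where "A n = (if enat N \<le> n then rep.finrank n I (a' n) (\<lambda>i. b i n) else C (the_enat n))" for n
  define B where "B n = (if enat N \<le> n then rep.finrank n I (\<lambda>i. b i n) (a' n) else D (the_enat n))" for n
  have ai: "rep.almost_invariant n F \<epsilon> (A n) (B n)" for n
  proof (cases "enat N \<le> n")
    case True
    then show ?thesis using ai_tail[of n] by (simp add: A_def B_def)
  next
    case False
    then obtain m where "n = enat m" by (cases n) auto
    then show ?thesis using False CD[of m] by (simp add: A_def B_def)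
  qed
  have adj: "rep.adjoint_pair n (A n) (B n)" for n using ai[of n] by (simp add: rep.almost_invariant_def)
  \<comment> \<open>Only finitely many isolated fibres differ from the finite rank families, as
    \<open>section_eventually\<close> requires.\<close>
  have ev: "\<forall>\<^sub>F m in sequentially. enat N \<le> enat m"
    using eventually_ge_at_top[of N] by simp
  have "is_section (\<lambda>n. A n (s n))" if s: "is_section s" for s
  proof (rule section_eventually)
    show "is_section (\<lambda>n. rep.finrank n I (a' n) (\<lambda>i. b i n) (s n))"
      by (rule section_finrank[OF _ _ s]) (use a'is_section b(1) in auto)
    show "\<forall>\<^sub>F m in sequentially. A (enat m) (s (enat m)) = rep.finrank (enat m) I (a' (enat m)) (\<lambda>i. b i (enat m)) (s (enat m))"
      using ev by (rule eventually_mono) (simp add: A_def)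
  qed (use rep.adjoint_pair_mem[OF adj] section_mem[OF s] in \<open>auto simp: A_def\<close>)
  moreover have "is_section (\<lambda>n. B n (s n))" if s: "is_section s" for s
  proof (rule section_eventually)
    show "is_section (\<lambda>n. rep.finrank n I (\<lambda>i. b i n) (a' n) (s n))"
      by (rule section_finrank[OF _ _ s]) (use a'is_section b(1) in auto)
    show "\<forall>\<^sub>F m in sequentially. B (enat m) (s (enat m)) = rep.finrank (enat m) I (\<lambda>i. b i (enat m)) (a' (enat m)) (s (enat m))"
      using ev by (rule eventually_mono) (simp add: B_def)
  qed (use rep.adjoint_pair_mem[OF rep.adjoint_pair_sym[OF adj]] section_mem[OF s] in \<open>auto simp: B_def\<close>)
  ultimately have "section_adjoint (bundle_op A) (bundle_op B)"
    by (intro section_adjoint_bundle_op adj)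
  then show ?thesis using ai by blast
qed

text \<open>The squared norm is the constant function 1, which lies in \<open>C0\<close> because the
  unit space is compact.\<close>

lemma almost_invariant_bundle_op:
  assumes AB: "section_adjoint (bundle_op A) (bundle_op B)"
    and ai: "\<And>n. rep.almost_invariant n F \<epsilon> (A n) (B n)" and F: "F \<subseteq> carrier \<Gamma>"
  shows "hilbert_schmidt HLS_units \<rho> (bundle_op A)"
    and "hs_norm (fib \<rho> (pt n)) (loc (bundle_op A) n) = 1"
    and "g \<in> F \<Longrightarrow> cmod (conj_coeff (bundle_op A) (n, proj n g) - 1) < \<epsilon>"
proof -
  have loc: "loc (bundle_op A) n v = A n v" if "v \<in> hcar (fibre n)" for n v
    by (rule localization_bundle_op[OF AB that])
  have tr: "trace_abs_sq (fib \<rho> (pt n)) (loc (bundle_op A) n) = 1" for n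
  proof -
    have "((\<lambda>e. (hnorm (fibre n) (loc (bundle_op A) n e))\<^sup>2) has_sum 1) (rep.onb n)"
      using ai[of n] loc[OF rep.onb_mem] by (simp add: rep.almost_invariant_def cong: has_sum_cong)
    from rep.trace_abs_sq_has_sum[OF adjoint_pair_localization[OF AB] this] show ?thesis
      by (simp add: fibre_def)
  qed
  show "hs_norm (fib \<rho> (pt n)) (loc (bundle_op A) n) = 1" by (simp add: hs_norm_def tr)
  show "hilbert_schmidt HLS_units \<rho> (bundle_op A)"
    unfolding hilbert_schmidt_def adjointable_iff C0_units_iff topspace_units
    using AB tr by auto
  show "cmod (conj_coeff (bundle_op A) (n, proj n g) - 1) < \<epsilon>" if g: "g \<in> F"
  proof -
    have gc: "g \<in> carrier \<Gamma>" using F g by blast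
    have "conj_coeff (bundle_op A) (n, proj n g)
      = infsum (\<lambda>e. hip (fibre n) (U n g (A n (U n (inv g) e))) (A n e)) (rep.onb n)"
      unfolding conj_coeff_eq[OF AB gc] using loc rep.onb_mem gc by (intro infsum_cong) simp
    then show ?thesis using ai[of n] g by (simp add: rep.almost_invariant_def)
  qed
qed

text \<open>Since the estimates hold over all levels, a compact set of arrows only demands finitely
  many group elements. Countability provides an increasing sequence of finite sets that absorbs
  them, so the net can be a sequence.\<close>

lemma amenableI:
  assumes count: "countable (carrier \<Gamma>)"
    and ex: "\<And>F \<epsilon>. \<lbrakk>finite F; F \<subseteq> carrier \<Gamma>; \<epsilon> > 0\<rbrakk> \<Longrightarrow>
      \<exists>A B. section_adjoint (bundle_op A) (bundle_op B) \<and> (\<forall>n. rep.almost_invariant n F \<epsilon> (A n) (B n))"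
  shows "amenable_representation HLS \<rho>"
proof -
  define E where "E k = from_nat_into (carrier \<Gamma>) ` {..k}" for k :: nat
  define e where "e k = 1 / (real k + 1)" for k
  have ne: "carrier \<Gamma> \<noteq> {}" using one_closed by blast
  have E: "finite (E k)" "E k \<subseteq> carrier \<Gamma>" for k
    using from_nat_into[OF ne] by (auto simp: E_def)
  have "\<forall>k. \<exists>T. hilbert_schmidt HLS_units \<rho> T \<and> (\<forall>n. hs_norm (fib \<rho> (pt n)) (loc T n) = 1) \<and>
      (\<forall>n. \<forall>g\<in>E k. cmod (conj_coeff T (n, proj n g) - 1) < e k)"
  proof
    fix k
    obtain A B where AB: "section_adjoint (bundle_op A) (bundle_op B)"
        "\<And>n. rep.almost_invariant n (E k) (e k) (A n) (B n)"
      using ex[OF E, of "e k" k] by (auto simp: e_def)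
    show "\<exists>T. hilbert_schmidt HLS_units \<rho> T \<and> (\<forall>n. hs_norm (fib \<rho> (pt n)) (loc T n) = 1) \<and>
      (\<forall>n. \<forall>g\<in>E k. cmod (conj_coeff T (n, proj n g) - 1) < e k)"
      using almost_invariant_bundle_op[OF AB E(2)] by (intro exI[of _ "bundle_op A"]) blast
  qed
  from choice[OF this] obtain T where T: "\<And>k. hilbert_schmidt HLS_units \<rho> (T k)"
      "\<And>k n. hs_norm (fib \<rho> (pt n)) (loc (T k) n) = 1"
      "\<And>k n g. g \<in> E k \<Longrightarrow> cmod (conj_coeff (T k) (n, proj n g) - 1) < e k"
    by blast
  show ?thesis
    unfolding amenable_representation_def
  proof (intro exI[of _ "filtermap T sequentially"] conjI allI impI)
    show "filtermap T sequentially \<noteq> bot" by (simp add: filtermap_bot_iff)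
    have "hs_sup_norm HLS_units \<rho> (T k) \<le> 1" for k
      unfolding hs_sup_norm_def topspace_units by (rule cSUP_least) (auto simp: T(2))
    then show "filtermap T sequentially \<le> principal {T. hilbert_schmidt HLS_units \<rho> T \<and> hs_sup_norm HLS_units \<rho> T \<le> 1}"
      by (simp add: le_principal eventually_filtermap T(1))
  next
    fix L assume "compactin HLS_units L"
    then have "L \<subseteq> topspace HLS_units" by (rule compactin_subset_topspace)
    then have L: "L \<subseteq> range pt" unfolding topspace_units .
    have "hs_norm (fib \<rho> u) (localization HLS_units \<rho> (T k) u) = 1" if "u \<in> L" for u k
      using L that T(2) by auto
    then show "uniform_limit L (\<lambda>T u. hs_norm (fib \<rho> u) (localization HLS_units \<rho> T u)) (\<lambda>_. 1) (filtermap T sequentially)"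
      by (simp add: uniform_limit_iff eventually_filtermap)
  next
    fix L assume "compactin (arrows HLS) L"
    then obtain F where F: "finite F" "F \<subseteq> carrier \<Gamma>" "\<And>x. x \<in> L \<Longrightarrow> \<exists>g\<in>F. \<exists>n. x = (n, proj n g)"
      by (rule compactin_arrows_subset) (rule that)
    have "\<forall>\<^sub>F k in sequentially. \<forall>x\<in>L. dist (conj_coeff (T k) x) 1 < \<epsilon>" if \<epsilon>: "\<epsilon> > 0" for \<epsilon>
    proof -
      have "\<forall>\<^sub>F k in sequentially. \<forall>g\<in>F. g \<in> E k"
      proof (rule eventually_ball_finite[OF F(1)], rule ballI)
        fix g assume "g \<in> F"
        then have "g \<in> range (from_nat_into (carrier \<Gamma>))"
          using F(2) range_from_nat_into[OF ne count] by blast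
        then obtain j where j: "g = from_nat_into (carrier \<Gamma>) j" by blast
        show "\<forall>\<^sub>F k in sequentially. g \<in> E k"
          using eventually_ge_at_top[of j] by (rule eventually_mono) (simp add: E_def j)
      qed
      moreover have "\<forall>\<^sub>F k in sequentially. e k < \<epsilon>"
      proof -
        have "e \<longlonglongrightarrow> 0"
          using LIMSEQ_inverse_real_of_nat by (simp add: e_def[abs_def] inverse_eq_divide add.commute)
        then show ?thesis using \<epsilon> by (rule order_tendstoD)
      qed
      ultimately show ?thesis
      proof eventually_elim
        case (elim k)
        show ?case
        proof
          fix x assume "x \<in> L"
          then obtain g n where x: "g \<in> F" "x = (n, proj n g)" using F(3) by blast
          then have "cmod (conj_coeff (T k) (n, proj n g) - 1) < e k" using elim(1) by (intro T(3)) blast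
          then show "dist (conj_coeff (T k) x) 1 < \<epsilon>"
            unfolding x(2) dist_norm using elim(2) by linarith
        qed
      qed
    qed
    then show "uniform_limit L conj_coeff (\<lambda>_. 1) (filtermap T sequentially)"
      by (simp add: uniform_limit_iff eventually_filtermap)
  qed
qed

end

text \<open>Every vector over \<infinity> is the value of a section, and a finite set of arrows over
  \<infinity> is compact, so the groupoid condition specialises to the group.\<close>

lemma weakly_contained_reps_at_infinity:
  assumes "hls_representation \<Gamma> K \<pi>" "hls_representation \<Gamma> K \<rho>"
    and wc: "weakly_contained (hls_groupoid \<Gamma> K) \<pi> \<rho>"
  shows "weakly_contained_reps \<Gamma> (hls_representation.fibre \<Gamma> K \<pi> \<infinity>) (hls_representation.U \<Gamma> K \<pi> \<infinity>)
    (hls_representation.fibre \<Gamma> K \<rho> \<infinity>) (hls_representation.U \<Gamma> K \<rho> \<infinity>)"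
proof -
  interpret P: hls_representation \<Gamma> K \<pi> by fact
  interpret R: hls_representation \<Gamma> K \<rho> by fact
  show ?thesis
  proof
    fix v F and \<epsilon> :: real
    assume v: "v \<in> hcar (P.fibre \<infinity>)" and F: "finite F" "F \<subseteq> carrier \<Gamma>" and \<epsilon>: "\<epsilon> > 0"
    obtain \<xi> where \<xi>: "\<xi> \<in> csec \<pi>" "\<xi> (P.pt \<infinity>) = v" using P.section_through[OF v] by blast
    have "coefficient P.HLS \<pi> \<xi> \<xi> \<in> pd_functions P.HLS \<pi>"
      using \<xi>(1) unfolding pd_functions_def P.Cb_sections_eq by blast
    from wc[unfolded weakly_contained_def, rule_format, OF this P.compactin_finite_arrows[OF F, of \<infinity>] \<epsilon>]
    obtain n \<eta> where \<eta>: "\<forall>i\<in>{1..n::nat}. \<eta> i \<in> Cb_sections P.HLS_units \<rho>"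
      and near: "\<forall>x\<in>(\<lambda>g. (\<infinity>, P.proj \<infinity> g)) ` F.
        cmod (coefficient P.HLS \<pi> \<xi> \<xi> x - (\<Sum>i=1..n. coefficient P.HLS \<rho> (\<eta> i) (\<eta> i) x)) < \<epsilon>"
      by (elim exE conjE) (rule that)
    show "\<exists>As. set As \<subseteq> hcar (R.fibre \<infinity>) \<and>
      (\<forall>g\<in>F. cmod (hip (P.fibre \<infinity>) (P.U \<infinity> g v) v - (\<Sum>\<beta>\<leftarrow>As. hip (R.fibre \<infinity>) (R.U \<infinity> g \<beta>) \<beta>)) < \<epsilon>)"
    proof (intro exI[of _ "map (\<lambda>i. \<eta> i (P.pt \<infinity>)) [1..<Suc n]"] conjI ballI)
      show "set (map (\<lambda>i. \<eta> i (P.pt \<infinity>)) [1..<Suc n]) \<subseteq> hcar (R.fibre \<infinity>)"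
        using \<eta> R.csec_mem unfolding R.Cb_sections_eq by auto
      fix g assume "g \<in> F"
      then have "cmod (coefficient P.HLS \<pi> \<xi> \<xi> (\<infinity>, P.proj \<infinity> g)
          - (\<Sum>i=1..n. coefficient P.HLS \<rho> (\<eta> i) (\<eta> i) (\<infinity>, P.proj \<infinity> g))) < \<epsilon>"
        by (intro near[rule_format] imageI)
      moreover have "(\<Sum>\<beta>\<leftarrow>map (\<lambda>i. \<eta> i (P.pt \<infinity>)) [1..<Suc n]. hip (R.fibre \<infinity>) (R.U \<infinity> g \<beta>) \<beta>)
        = (\<Sum>i=1..n. coefficient P.HLS \<rho> (\<eta> i) (\<eta> i) (\<infinity>, P.proj \<infinity> g))"
        unfolding map_map comp_def interv_sum_list_conv_sum_set_nat
        by (intro sum.cong) (auto simp: coefficient_def R.fibre_def R.U_def)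
      ultimately show "cmod (hip (P.fibre \<infinity>) (P.U \<infinity> g v) v
          - (\<Sum>\<beta>\<leftarrow>map (\<lambda>i. \<eta> i (P.pt \<infinity>)) [1..<Suc n]. hip (R.fibre \<infinity>) (R.U \<infinity> g \<beta>) \<beta>)) < \<epsilon>"
        by (simp only:) (simp add: coefficient_def P.fibre_def P.U_def \<xi>(2))
    qed
  qed
qed

theorem corollary5p3:
  fixes \<Gamma> :: "('g, 'm) monoid_scheme" and K :: "nat \<Rightarrow> 'g set"
    and \<pi> :: "(enat \<times> 'g set, 'h::complex_vector) representation"
    and \<rho> :: "(enat \<times> 'g set, 'k::complex_vector) representation"
  assumes "approximated_group \<Gamma> K"
    and "countable (carrier \<Gamma>)"
    and "continuous_unitary_representation (hls_groupoid \<Gamma> K) \<pi>"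
    and "continuous_unitary_representation (hls_groupoid \<Gamma> K) \<rho>"
    and "amenable_representation (hls_groupoid \<Gamma> K) \<pi>"
    and "weakly_contained (hls_groupoid \<Gamma> K) \<pi> \<rho>"
  shows "amenable_representation (hls_groupoid \<Gamma> K) \<rho>"
proof -
  have P: "hls_representation \<Gamma> K \<pi>" and R: "hls_representation \<Gamma> K \<rho>"
    using assms(1,3,4) by (simp_all add: hls_representation_def)
  interpret P: hls_representation \<Gamma> K \<pi> by (rule P)
  interpret R: hls_representation \<Gamma> K \<rho> by (rule R)
  interpret W: weakly_contained_reps \<Gamma> "P.fibre \<infinity>" "P.U \<infinity>" "R.fibre \<infinity>" "R.U \<infinity>"
    by (rule weakly_contained_reps_at_infinity[OF P R assms(6)])
  show ?thesis
  proof (rule R.amenableI[OF assms(2)])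
    fix F and \<epsilon> :: real assume F: "finite F" "F \<subseteq> carrier \<Gamma>" and \<epsilon>: "\<epsilon> > 0"
    define \<kappa> where "\<kappa> = \<epsilon>\<^sup>2 / 2"
    \<comment> \<open>Amenability supplies families with error 2 \<delta>, and this choice turns the
      condition 2 \<delta> (2 card F + \<kappa>) \<le> \<kappa> of the averaging step into an
      equality.\<close>
    define \<delta> where "\<delta> = \<kappa> / (2 * (2 * real (card F) + \<kappa>))"
    have \<kappa>: "\<kappa> > 0" using \<epsilon> by (simp add: \<kappa>_def)
    then have pos: "2 * real (card F) + \<kappa> > 0" by (simp add: add_nonneg_pos)
    have \<delta>: "0 < \<delta>" "\<delta> < 1" "2 * \<delta> * (2 * real (card F) + \<kappa>) \<le> \<kappa>"
      using \<kappa> pos by (simp_all add: \<delta>_def field_simps)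
    \<comment> \<open>The identity is included because averaging needs the total norm, the
      coefficient at \<one>, to be near 1 as well.\<close>
    have F1: "finite (insert \<one>\<^bsub>\<Gamma>\<^esub> F)" "insert \<one>\<^bsub>\<Gamma>\<^esub> F \<subseteq> carrier \<Gamma>" using F by auto
    obtain I :: "'h set" and x where I: "finite I" "x \<in> I \<rightarrow> hcar (P.fibre \<infinity>)" "(\<lambda>e. e) \<in> I \<rightarrow> hcar (P.fibre \<infinity>)"
        "\<And>g. g \<in> insert \<one>\<^bsub>\<Gamma>\<^esub> F \<Longrightarrow> cmod (P.rep.tensor_coeff \<infinity> I x (\<lambda>e. e) g - 1) < 2 * \<delta>"
      using P.amenable_almost_invariant_family[OF assms(5) F1 \<delta>(1,2)] by blast
    obtain \<alpha> \<beta> where ab: "\<alpha> \<in> I \<rightarrow> hcar (R.fibre \<infinity>)" "\<beta> \<in> I \<rightarrow> hcar (R.fibre \<infinity>)"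
        "0 < Re (R.rep.tensor_coeff \<infinity> I \<alpha> \<beta> \<one>\<^bsub>\<Gamma>\<^esub>)"
        "\<And>g. g \<in> F \<Longrightarrow> Re (R.rep.tensor_coeff \<infinity> I \<alpha> \<beta> \<one>\<^bsub>\<Gamma>\<^esub>) - Re (R.rep.tensor_coeff \<infinity> I \<alpha> \<beta> g)
          < \<kappa> * Re (R.rep.tensor_coeff \<infinity> I \<alpha> \<beta> \<one>\<^bsub>\<Gamma>\<^esub>)"
      using W.tensor_coeff_transfer[OF I(1-3) F \<kappa> \<delta>(3) I(4)] by blast
    have "cmod (R.rep.tensor_coeff \<infinity> I \<alpha> \<beta> g / R.rep.tensor_coeff \<infinity> I \<alpha> \<beta> \<one>\<^bsub>\<Gamma>\<^esub> - 1) < \<epsilon>"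
      if "g \<in> F" for g
      using that F(2) ab(4)[OF that] by (intro R.rep.tensor_coeff_ratio[OF ab(1,2) _ \<epsilon> ab(3)]) (auto simp: \<kappa>_def)
    then show "\<exists>A B. R.section_adjoint (R.bundle_op A) (R.bundle_op B) \<and>
        (\<forall>n. R.rep.almost_invariant n F \<epsilon> (A n) (B n))"
      by (rule R.extend_almost_invariant[OF I(1) ab(1,2) F \<epsilon> ab(3)])
  qed
qed

end
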